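(* Let $(R,m_R)$ be a normal Noetherian local domain and let $\mathcal I=\{I_n\}_{n\in\mathbb N}$ be a graded family of $m_R$-primary ideals of $R$. Let $\pi:\mathrm{Proj}(R[\mathcal I])\to\mathrm{Spec}(R)$ be the natural projection. If the analytic spread $\ell(\mathcal I)$ is $0$, then $\pi^{-1}(m_R)=\emptyset$ and $\mathrm{Proj}(R[\mathcal I])\cong\mathrm{Spec}(R)\setminus\{m_R\}$; in particular, $\mathrm{Proj}(R[\mathcal I])$ is a Noetherian scheme.
   Context: A graded family of ideals in $R$ is a family $\mathcal I=\{I_n\}_{n\in\mathbb N}$ of ideals with $I_0=R$ and $I_mI_n\subset I_{m+n}$ for all $m,n$; it is a graded family of $m_R$-primary ideals if $I_n$ is $m_R$-primary for all $n>0$. The Rees algebra is the graded ring $R[\mathcal I]=\bigoplus_{n\ge0}I_n$ (not necessarily Noetherian). The analytic spread of $\mathcal I$ is $\ell(\mathcal I)=\dim R[\mathcal I]/m_RR[\mathcal I]$ (Krull dimension). *)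

theory Defs
  imports
    "HOL-Algebra.UnivPoly"
    "HOL-Algebra.Ideal_Product"
    "HOL-Algebra.Ring_Divisibility"
    "HOL-Analysis.Abstract_Topology"
    "HOL-Library.Extended_Real"
begin

section \<open>Commutative algebra\<close>

text \<open>A chain \<open>C 0 \<subset> \<dots> \<subset> C n\<close> of primes has length \<open>n\<close>. The zero ring has no primes and gets
  dimension \<open>Sup {} = -\<infinity>\<close>.\<close>

definition krull_dim :: "('a, 'm) ring_scheme \<Rightarrow> ereal" where
  "krull_dim A = (SUP n \<in> {n. \<exists>C :: nat \<Rightarrow> 'a set.
      (\<forall>i\<le>n. primeideal (C i) A) \<and> (\<forall>i<n. C i \<subset> C (Suc i))}. ereal (real n))"

definition local_ring :: "('a, 'm) ring_scheme \<Rightarrow> bool" where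
  "local_ring A \<longleftrightarrow> cring A \<and> (\<exists>!M. maximalideal M A)"

definition max_ideal :: "('a, 'm) ring_scheme \<Rightarrow> 'a set" where
  "max_ideal A = (THE M. maximalideal M A)"

definition local_ring_hom ::
    "('a, 'm) ring_scheme \<Rightarrow> ('b, 'n) ring_scheme \<Rightarrow> ('a \<Rightarrow> 'b) \<Rightarrow> bool" where
  "local_ring_hom A B h \<longleftrightarrow> h \<in> ring_hom A B \<and> h ` max_ideal A \<subseteq> max_ideal B"

definition radical :: "('a, 'm) ring_scheme \<Rightarrow> 'a set \<Rightarrow> 'a set" where
  "radical A J = {a \<in> carrier A. \<exists>n::nat. a [^]\<^bsub>A\<^esub> n \<in> J}"

definition primary_ideal :: "'a set \<Rightarrow> ('a, 'm) ring_scheme \<Rightarrow> bool" where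
  "primary_ideal Q A \<longleftrightarrow> ideal Q A \<and> Q \<noteq> carrier A \<and>
     (\<forall>a\<in>carrier A. \<forall>b\<in>carrier A. a \<otimes>\<^bsub>A\<^esub> b \<in> Q \<longrightarrow> a \<in> Q \<or> (\<exists>n::nat. b [^]\<^bsub>A\<^esub> n \<in> Q))"

text \<open>\<open>fraction A S a s\<close> is the class of \<open>a / s\<close> in the localization of \<open>A\<close> at the multiplicative
  set \<open>S\<close>. The operations on classes are unions over representatives; all members of such a union
  coincide.\<close>

definition fraction :: "('a, 'm) ring_scheme \<Rightarrow> 'a set \<Rightarrow> 'a \<Rightarrow> 'a \<Rightarrow> ('a \<times> 'a) set" where
  "fraction A S a s = {(b, t). b \<in> carrier A \<and> t \<in> S \<and>
     (\<exists>u\<in>S. u \<otimes>\<^bsub>A\<^esub> (t \<otimes>\<^bsub>A\<^esub> a) = u \<otimes>\<^bsub>A\<^esub> (s \<otimes>\<^bsub>A\<^esub> b))}"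

definition localization :: "('a, 'm) ring_scheme \<Rightarrow> 'a set \<Rightarrow> ('a \<times> 'a) set ring" where
  "localization A S = \<lparr>
     carrier = {fraction A S a s | a s. a \<in> carrier A \<and> s \<in> S},
     monoid.mult = (\<lambda>x y. \<Union>(a, s)\<in>x. \<Union>(b, t)\<in>y. fraction A S (a \<otimes>\<^bsub>A\<^esub> b) (s \<otimes>\<^bsub>A\<^esub> t)),
     monoid.one = fraction A S \<one>\<^bsub>A\<^esub> \<one>\<^bsub>A\<^esub>,
     ring.zero = fraction A S \<zero>\<^bsub>A\<^esub> \<one>\<^bsub>A\<^esub>,
     ring.add = (\<lambda>x y. \<Union>(a, s)\<in>x. \<Union>(b, t)\<in>y.
              fraction A S (t \<otimes>\<^bsub>A\<^esub> a \<oplus>\<^bsub>A\<^esub> s \<otimes>\<^bsub>A\<^esub> b) (s \<otimes>\<^bsub>A\<^esub> t))\<rparr>"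

definition integral_element ::
    "('a, 'm) ring_scheme \<Rightarrow> ('b, 'n) ring_scheme \<Rightarrow> ('a \<Rightarrow> 'b) \<Rightarrow> 'b \<Rightarrow> bool" where
  "integral_element A B \<phi> x \<longleftrightarrow> (\<exists>p\<in>carrier (UP A).
     coeff (UP A) p (deg A p) = \<one>\<^bsub>A\<^esub> \<and> eval A B \<phi> x p = \<zero>\<^bsub>B\<^esub>)"

definition normal_domain :: "('a, 'm) ring_scheme \<Rightarrow> bool" where
  "normal_domain A \<longleftrightarrow> domain A \<and>
     (let S = carrier A - {\<zero>\<^bsub>A\<^esub>}; K = localization A S; \<phi> = (\<lambda>a. fraction A S a \<one>\<^bsub>A\<^esub>)
      in \<forall>x\<in>carrier K. integral_element A K \<phi> x \<longrightarrow> x \<in> \<phi> ` carrier A)"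

section \<open>Graded families of ideals\<close>

definition graded_family :: "('a, 'm) ring_scheme \<Rightarrow> (nat \<Rightarrow> 'a set) \<Rightarrow> bool" where
  "graded_family R I \<longleftrightarrow> (\<forall>n. ideal (I n) R) \<and> I 0 = carrier R \<and>
     (\<forall>m n. I m \<cdot>\<^bsub>R\<^esub> I n \<subseteq> I (m + n))"

definition graded_family_of_primary_ideals ::
    "('a, 'm) ring_scheme \<Rightarrow> 'a set \<Rightarrow> (nat \<Rightarrow> 'a set) \<Rightarrow> bool" where
  "graded_family_of_primary_ideals R M I \<longleftrightarrow> graded_family R I \<and>
     (\<forall>n>0. primary_ideal (I n) R \<and> radical R (I n) = M)"

text \<open>The direct sum of the \<open>I n\<close> is realised as the subring of \<open>R[t]\<close> of polynomials whose
  \<open>n\<close>-th coefficient lies in \<open>I n\<close>; its graded pieces consist of the monomials \<open>a t^n\<close>.\<close>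

definition rees_algebra :: "('a, 'm) ring_scheme \<Rightarrow> (nat \<Rightarrow> 'a set) \<Rightarrow> ('a, nat \<Rightarrow> 'a) up_ring" where
  "rees_algebra R I =
     (UP R) \<lparr>carrier := {p \<in> carrier (UP R). \<forall>n. coeff (UP R) p n \<in> I n}\<rparr>"

definition rees_piece :: "('a, 'm) ring_scheme \<Rightarrow> (nat \<Rightarrow> 'a set) \<Rightarrow> nat \<Rightarrow> (nat \<Rightarrow> 'a) set" where
  "rees_piece R I n = (\<lambda>a. monom (UP R) a n) ` I n"

definition rees_unit :: "('a, 'm) ring_scheme \<Rightarrow> 'a \<Rightarrow> nat \<Rightarrow> 'a" where
  "rees_unit R a = monom (UP R) a 0"

definition analytic_spread :: "('a, 'm) ring_scheme \<Rightarrow> (nat \<Rightarrow> 'a set) \<Rightarrow> ereal" where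
  "analytic_spread R I =
     krull_dim (rees_algebra R I Quot (Idl\<^bsub>rees_algebra R I\<^esub> (rees_unit R ` max_ideal R)))"

section \<open>Locally ringed spaces\<close>

text \<open>A space with a presheaf of rings. Only the values on open sets matter;
  \<open>rs_res X U V\<close> is the restriction from \<open>U\<close> to \<open>V\<close>.\<close>

record ('x, 's) rspace =
  rs_top :: "'x topology"
  rs_sec :: "'x set \<Rightarrow> 's ring"
  rs_res :: "'x set \<Rightarrow> 'x set \<Rightarrow> 's \<Rightarrow> 's"

definition ring_presheaf :: "('x, 's) rspace \<Rightarrow> bool" where
  "ring_presheaf X \<longleftrightarrow>
     (\<forall>U. openin (rs_top X) U \<longrightarrow> cring (rs_sec X U)) \<and>
     (\<forall>U V. openin (rs_top X) U \<and> openin (rs_top X) V \<and> V \<subseteq> U \<longrightarrow>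
        rs_res X U V \<in> ring_hom (rs_sec X U) (rs_sec X V)) \<and>
     (\<forall>U. openin (rs_top X) U \<longrightarrow> (\<forall>s\<in>carrier (rs_sec X U). rs_res X U U s = s)) \<and>
     (\<forall>U V W. openin (rs_top X) U \<and> openin (rs_top X) V \<and> openin (rs_top X) W \<and> W \<subseteq> V \<and> V \<subseteq> U
        \<longrightarrow> (\<forall>s\<in>carrier (rs_sec X U). rs_res X V W (rs_res X U V s) = rs_res X U W s))"

definition ringed_space :: "('x, 's) rspace \<Rightarrow> bool" where
  "ringed_space X \<longleftrightarrow> ring_presheaf X \<and>
     (\<forall>\<U>. (\<forall>U\<in>\<U>. openin (rs_top X) U) \<longrightarrow>
        (\<forall>s\<in>carrier (rs_sec X (\<Union>\<U>)). \<forall>t\<in>carrier (rs_sec X (\<Union>\<U>)).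
           (\<forall>U\<in>\<U>. rs_res X (\<Union>\<U>) U s = rs_res X (\<Union>\<U>) U t) \<longrightarrow> s = t) \<and>
        (\<forall>\<sigma>. (\<forall>U\<in>\<U>. \<sigma> U \<in> carrier (rs_sec X U)) \<and>
             (\<forall>U\<in>\<U>. \<forall>V\<in>\<U>. rs_res X U (U \<inter> V) (\<sigma> U) = rs_res X V (U \<inter> V) (\<sigma> V)) \<longrightarrow>
           (\<exists>s\<in>carrier (rs_sec X (\<Union>\<U>)). \<forall>U\<in>\<U>. rs_res X (\<Union>\<U>) U s = \<sigma> U)))"

definition germ :: "('x, 's) rspace \<Rightarrow> 'x \<Rightarrow> 'x set \<Rightarrow> 's \<Rightarrow> ('x set \<times> 's) set" where
  "germ X x U s = {(V, t). openin (rs_top X) V \<and> x \<in> V \<and> t \<in> carrier (rs_sec X V) \<and>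
     (\<exists>W. openin (rs_top X) W \<and> x \<in> W \<and> W \<subseteq> U \<inter> V \<and> rs_res X U W s = rs_res X V W t)}"

definition stalk :: "('x, 's) rspace \<Rightarrow> 'x \<Rightarrow> ('x set \<times> 's) set ring" where
  "stalk X x = \<lparr>
     carrier = {germ X x U s | U s.
                  openin (rs_top X) U \<and> x \<in> U \<and> s \<in> carrier (rs_sec X U)},
     monoid.mult = (\<lambda>g h. \<Union>(U, s)\<in>g. \<Union>(V, t)\<in>h. germ X x (U \<inter> V)
              (rs_res X U (U \<inter> V) s \<otimes>\<^bsub>rs_sec X (U \<inter> V)\<^esub> rs_res X V (U \<inter> V) t)),
     monoid.one = germ X x (topspace (rs_top X)) \<one>\<^bsub>rs_sec X (topspace (rs_top X))\<^esub>,
     ring.zero = germ X x (topspace (rs_top X)) \<zero>\<^bsub>rs_sec X (topspace (rs_top X))\<^esub>,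
     ring.add = (\<lambda>g h. \<Union>(U, s)\<in>g. \<Union>(V, t)\<in>h. germ X x (U \<inter> V)
              (rs_res X U (U \<inter> V) s \<oplus>\<^bsub>rs_sec X (U \<inter> V)\<^esub> rs_res X V (U \<inter> V) t))\<rparr>"

definition locally_ringed_space :: "('x, 's) rspace \<Rightarrow> bool" where
  "locally_ringed_space X \<longleftrightarrow> ringed_space X \<and> (\<forall>x\<in>topspace (rs_top X). local_ring (stalk X x))"

definition open_subspace :: "('x, 's) rspace \<Rightarrow> 'x set \<Rightarrow> ('x, 's) rspace" where
  "open_subspace X U = X \<lparr>rs_top := subtopology (rs_top X) U\<rparr>"

text \<open>A morphism \<open>X \<rightarrow> Y\<close> consists of a map of points and, for each open \<open>V\<close> of \<open>Y\<close>, a map from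
  the sections over \<open>V\<close> to the sections over its preimage.\<close>

record ('x, 's, 'y, 't) rs_map =
  pt_map :: "'x \<Rightarrow> 'y"
  sec_map :: "'y set \<Rightarrow> 't \<Rightarrow> 's"

definition rs_preimage ::
    "('x, 's) rspace \<Rightarrow> ('x, 's, 'y, 't) rs_map \<Rightarrow> 'y set \<Rightarrow> 'x set" where
  "rs_preimage X \<phi> V = pt_map \<phi> -` V \<inter> topspace (rs_top X)"

definition stalk_map ::
    "('x, 's) rspace \<Rightarrow> ('x, 's, 'y, 't) rs_map \<Rightarrow> 'x \<Rightarrow> ('y set \<times> 't) set \<Rightarrow> ('x set \<times> 's) set" where
  "stalk_map X \<phi> x g = (\<Union>(V, t)\<in>g. germ X x (rs_preimage X \<phi> V) (sec_map \<phi> V t))"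

definition lrs_morphism ::
    "('x, 's) rspace \<Rightarrow> ('y, 't) rspace \<Rightarrow> ('x, 's, 'y, 't) rs_map \<Rightarrow> bool" where
  "lrs_morphism X Y \<phi> \<longleftrightarrow>
     continuous_map (rs_top X) (rs_top Y) (pt_map \<phi>) \<and>
     (\<forall>V. openin (rs_top Y) V \<longrightarrow>
        sec_map \<phi> V \<in> ring_hom (rs_sec Y V) (rs_sec X (rs_preimage X \<phi> V))) \<and>
     (\<forall>V W. openin (rs_top Y) V \<and> openin (rs_top Y) W \<and> W \<subseteq> V \<longrightarrow>
        (\<forall>t\<in>carrier (rs_sec Y V). sec_map \<phi> W (rs_res Y V W t) =
           rs_res X (rs_preimage X \<phi> V) (rs_preimage X \<phi> W) (sec_map \<phi> V t))) \<and>
     (\<forall>x\<in>topspace (rs_top X).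
        local_ring_hom (stalk Y (pt_map \<phi> x)) (stalk X x) (stalk_map X \<phi> x))"

text \<open>Isomorphism in the category of locally ringed spaces: mutually inverse morphisms. The last
  two conditions say that the section maps of \<open>\<psi> \<circ> \<phi>\<close> and \<open>\<phi> \<circ> \<psi>\<close> are identities.\<close>

definition lrs_isomorphic :: "('x, 's) rspace \<Rightarrow> ('y, 't) rspace \<Rightarrow> bool" where
  "lrs_isomorphic X Y \<longleftrightarrow> (\<exists>\<phi> \<psi>. lrs_morphism X Y \<phi> \<and> lrs_morphism Y X \<psi> \<and>
     (\<forall>x\<in>topspace (rs_top X). pt_map \<psi> (pt_map \<phi> x) = x) \<and>
     (\<forall>y\<in>topspace (rs_top Y). pt_map \<phi> (pt_map \<psi> y) = y) \<and>
     (\<forall>U. openin (rs_top X) U \<longrightarrow> (\<forall>s\<in>carrier (rs_sec X U).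
        sec_map \<phi> (rs_preimage Y \<psi> U) (sec_map \<psi> U s) = s)) \<and>
     (\<forall>V. openin (rs_top Y) V \<longrightarrow> (\<forall>t\<in>carrier (rs_sec Y V).
        sec_map \<psi> (rs_preimage X \<phi> V) (sec_map \<phi> V t) = t)))"

text \<open>The sheaf of functions \<open>s\<close> with \<open>s x\<close> in the ring \<open>L x\<close> that locally satisfy \<open>F\<close>, with
  pointwise operations. Sections over \<open>U\<close> are undefined outside \<open>U\<close>, so that they are
  determined by their values on \<open>U\<close>.\<close>

definition local_sections ::
    "'x topology \<Rightarrow> ('x \<Rightarrow> 'b ring) \<Rightarrow> ('x set \<Rightarrow> ('x \<Rightarrow> 'b) \<Rightarrow> bool) \<Rightarrow> 'x set \<Rightarrow> ('x \<Rightarrow> 'b) ring" where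
  "local_sections T L F U = \<lparr>
     carrier = {s \<in> (\<Pi>\<^sub>E x\<in>U. carrier (L x)).
                  \<forall>x\<in>U. \<exists>V. openin T V \<and> x \<in> V \<and> V \<subseteq> U \<and> F V s},
     monoid.mult = (\<lambda>s t. \<lambda>x\<in>U. s x \<otimes>\<^bsub>L x\<^esub> t x),
     monoid.one = (\<lambda>x\<in>U. \<one>\<^bsub>L x\<^esub>),
     ring.zero = (\<lambda>x\<in>U. \<zero>\<^bsub>L x\<^esub>),
     ring.add = (\<lambda>s t. \<lambda>x\<in>U. s x \<oplus>\<^bsub>L x\<^esub> t x)\<rparr>"

definition function_space ::
    "'x topology \<Rightarrow> ('x \<Rightarrow> 'b ring) \<Rightarrow> ('x set \<Rightarrow> ('x \<Rightarrow> 'b) \<Rightarrow> bool) \<Rightarrow> ('x, 'x \<Rightarrow> 'b) rspace" where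
  "function_space T L F =
     \<lparr>rs_top = T, rs_sec = local_sections T L F, rs_res = (\<lambda>U V s. restrict s V)\<rparr>"

section \<open>Affine schemes and schemes\<close>

definition zariski :: "('a, 'm) ring_scheme \<Rightarrow> 'a set topology" where
  "zariski A = topology (\<lambda>U. \<exists>J. ideal J A \<and> U = {P. primeideal P A \<and> \<not> J \<subseteq> P})"

lemma istopology_zariski:
  assumes "ring A"
  shows "istopology (\<lambda>U. \<exists>J. ideal J A \<and> U = {P. primeideal P A \<and> \<not> J \<subseteq> P})"
proof -
  interpret ring A by fact
  show ?thesis
    unfolding istopology_def
  proof (rule conjI; intro allI impI)
    fix S T
    assume "\<exists>J. ideal J A \<and> S = {P. primeideal P A \<and> \<not> J \<subseteq> P}"
      and "\<exists>J. ideal J A \<and> T = {P. primeideal P A \<and> \<not> J \<subseteq> P}"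
    then obtain J K where J: "ideal J A" "S = {P. primeideal P A \<and> \<not> J \<subseteq> P}"
      and K: "ideal K A" "T = {P. primeideal P A \<and> \<not> K \<subseteq> P}"
      by blast
    have "\<not> J \<inter> K \<subseteq> P" if P: "primeideal P A" and JK: "\<not> J \<subseteq> P" "\<not> K \<subseteq> P" for P
    proof -
      obtain a b where ab: "a \<in> J" "a \<notin> P" "b \<in> K" "b \<notin> P"
        using JK by blast
      then have "a \<in> carrier A" "b \<in> carrier A"
        using J K by (auto dest: ideal.Icarr)
      then have "a \<otimes>\<^bsub>A\<^esub> b \<in> J \<inter> K" "a \<otimes>\<^bsub>A\<^esub> b \<notin> P"
        using ab J K P
        by (auto intro: ideal.I_l_closed ideal.I_r_closed dest: primeideal.I_prime)
      then show ?thesis by blast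
    qed
    then have "S \<inter> T = {P. primeideal P A \<and> \<not> J \<inter> K \<subseteq> P}"
      using J K by blast
    moreover have "ideal (J \<inter> K) A"
      using J K by (simp add: i_intersect)
    ultimately show "\<exists>J. ideal J A \<and> S \<inter> T = {P. primeideal P A \<and> \<not> J \<subseteq> P}"
      by blast
  next
    fix \<K>
    assume "\<forall>U\<in>\<K>. \<exists>J. ideal J A \<and> U = {P. primeideal P A \<and> \<not> J \<subseteq> P}"
    then obtain J where J: "\<And>U. U \<in> \<K> \<Longrightarrow> ideal (J U) A"
        "\<And>U. U \<in> \<K> \<Longrightarrow> U = {P. primeideal P A \<and> \<not> J U \<subseteq> P}"
      by metis
    have sub: "(\<Union>U\<in>\<K>. J U) \<subseteq> carrier A"
      using J(1) by (auto dest: ideal.Icarr)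
    define N where "N = Idl\<^bsub>A\<^esub> (\<Union>U\<in>\<K>. J U)"
    have N: "N \<subseteq> P \<longleftrightarrow> (\<forall>U\<in>\<K>. J U \<subseteq> P)" if "primeideal P A" for P
    proof
      show "\<forall>U\<in>\<K>. J U \<subseteq> P" if "N \<subseteq> P"
        using genideal_self[OF sub] that by (auto simp: N_def)
      have "ideal P A"
        using \<open>primeideal P A\<close> by (rule primeideal.axioms(1))
      then show "N \<subseteq> P" if "\<forall>U\<in>\<K>. J U \<subseteq> P"
        unfolding N_def using that by (intro genideal_minimal) auto
    qed
    have "\<Union>\<K> = {P. primeideal P A \<and> \<not> N \<subseteq> P}"
    proof (rule Set.set_eqI)
      fix P
      have "P \<in> \<Union>\<K> \<longleftrightarrow> (\<exists>U\<in>\<K>. primeideal P A \<and> \<not> J U \<subseteq> P)"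
        using J(2) by (metis (mono_tags, lifting) Union_iff mem_Collect_eq)
      then show "P \<in> \<Union>\<K> \<longleftrightarrow> P \<in> {P. primeideal P A \<and> \<not> N \<subseteq> P}"
        using N[of P] by blast
    qed
    moreover have "ideal N A"
      unfolding N_def by (rule genideal_ideal[OF sub])
    ultimately show "\<exists>J. ideal J A \<and> \<Union>\<K> = {P. primeideal P A \<and> \<not> J \<subseteq> P}"
      by blast
  qed
qed

definition Spec :: "('a, 'm) ring_scheme \<Rightarrow> ('a set, 'a set \<Rightarrow> ('a \<times> 'a) set) rspace" where
  "Spec A = function_space (zariski A) (\<lambda>P. localization A (carrier A - P))
     (\<lambda>V s. \<exists>a\<in>carrier A. \<exists>f\<in>carrier A. \<forall>Q\<in>V. f \<notin> Q \<and> s Q = fraction A (carrier A - Q) a f)"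

text \<open>In the next definitions the coordinate ring has its elements in the type of the sections of
  the space. This is no restriction: if \<open>X\<close> is isomorphic to \<open>Spec B\<close>, then \<open>B\<close> is isomorphic to
  the ring of global sections of \<open>X\<close>.\<close>

definition scheme :: "('x, 's) rspace \<Rightarrow> bool" where
  "scheme X \<longleftrightarrow> locally_ringed_space X \<and>
     (\<forall>x\<in>topspace (rs_top X). \<exists>U. openin (rs_top X) U \<and> x \<in> U \<and>
        (\<exists>A :: 's ring. cring A \<and> lrs_isomorphic (open_subspace X U) (Spec A)))"

definition locally_noetherian_scheme :: "('x, 's) rspace \<Rightarrow> bool" where
  "locally_noetherian_scheme X \<longleftrightarrow> scheme X \<and>
     (\<forall>x\<in>topspace (rs_top X). \<exists>U. openin (rs_top X) U \<and> x \<in> U \<and>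
        (\<exists>A :: 's ring. cring A \<and> noetherian_ring A \<and>
           lrs_isomorphic (open_subspace X U) (Spec A)))"

definition noetherian_scheme :: "('x, 's) rspace \<Rightarrow> bool" where
  "noetherian_scheme X \<longleftrightarrow> locally_noetherian_scheme X \<and> compact_space (rs_top X)"

section \<open>Proj\<close>

text \<open>A graded ring is given as a ring \<open>S\<close> together with its graded pieces \<open>G n\<close>.\<close>

definition irrelevant_ideal :: "('a, 'm) ring_scheme \<Rightarrow> (nat \<Rightarrow> 'a set) \<Rightarrow> 'a set" where
  "irrelevant_ideal S G = Idl\<^bsub>S\<^esub> (\<Union>n\<in>{0<..}. G n)"

definition proj_points :: "('a, 'm) ring_scheme \<Rightarrow> (nat \<Rightarrow> 'a set) \<Rightarrow> 'a set set" where
  "proj_points S G = {P. primeideal P S \<and> P = Idl\<^bsub>S\<^esub> (P \<inter> (\<Union>n. G n)) \<and>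
     \<not> irrelevant_ideal S G \<subseteq> P}"

definition homogeneous_outside :: "(nat \<Rightarrow> 'a set) \<Rightarrow> 'a set \<Rightarrow> 'a set" where
  "homogeneous_outside G P = (\<Union>n. G n) - P"

text \<open>The subring of degree zero elements of the localization of \<open>S\<close> at the homogeneous elements
  outside \<open>P\<close>.\<close>

definition homogeneous_localization ::
    "('a, 'm) ring_scheme \<Rightarrow> (nat \<Rightarrow> 'a set) \<Rightarrow> 'a set \<Rightarrow> ('a \<times> 'a) set ring" where
  "homogeneous_localization S G P = (localization S (homogeneous_outside G P))
     \<lparr>carrier := {fraction S (homogeneous_outside G P) a f | a f n.
                   a \<in> G n \<and> f \<in> G n \<and> f \<notin> P}\<rparr>"

definition Proj ::
    "('a, 'm) ring_scheme \<Rightarrow> (nat \<Rightarrow> 'a set) \<Rightarrow> ('a set, 'a set \<Rightarrow> ('a \<times> 'a) set) rspace" where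
  "Proj S G = function_space (subtopology (zariski S) (proj_points S G))
     (homogeneous_localization S G)
     (\<lambda>V s. \<exists>n. \<exists>a\<in>G n. \<exists>f\<in>G n. \<forall>Q\<in>V.
        f \<notin> Q \<and> s Q = fraction S (homogeneous_outside G Q) a f)"

definition Proj_rees ::
    "('a, 'm) ring_scheme \<Rightarrow> (nat \<Rightarrow> 'a set) \<Rightarrow>
      ((nat \<Rightarrow> 'a) set, (nat \<Rightarrow> 'a) set \<Rightarrow> ((nat \<Rightarrow> 'a) \<times> (nat \<Rightarrow> 'a)) set) rspace" where
  "Proj_rees R I = Proj (rees_algebra R I) (rees_piece R I)"

text \<open>The natural projection from \<open>Proj R[I]\<close> to \<open>Spec R\<close>: on points it is contraction along
  \<open>R \<rightarrow> R[I]\<close>, and on local rings it sends \<open>a / b\<close> to the fraction of the images of \<open>a\<close> and \<open>b\<close>.\<close>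

definition rees_projection ::
    "('a, 'm) ring_scheme \<Rightarrow> (nat \<Rightarrow> 'a set) \<Rightarrow>
      ((nat \<Rightarrow> 'a) set, (nat \<Rightarrow> 'a) set \<Rightarrow> ((nat \<Rightarrow> 'a) \<times> (nat \<Rightarrow> 'a)) set,
       'a set, 'a set \<Rightarrow> ('a \<times> 'a) set) rs_map" where
  "rees_projection R I =
     (let c = (\<lambda>P. {r \<in> carrier R. rees_unit R r \<in> P}) in
      \<lparr>pt_map = c,
       sec_map = (\<lambda>V s. \<lambda>P \<in> c -` V \<inter> topspace (rs_top (Proj_rees R I)).
         \<Union>(a, b)\<in>s (c P). fraction (rees_algebra R I) (homogeneous_outside (rees_piece R I) P)
           (rees_unit R a) (rees_unit R b))\<rparr>)"

end

theory Submission
  imports Defs "HOL-Algebra.Weak_Morphisms" "HOL-Algebra.Subrings"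
begin

text \<open>If \<open>P\<close> is a point of \<open>Proj R[I]\<close> over \<open>m\<close>, then \<open>m R[I] \<subseteq> P\<close> and \<open>P\<close> is properly contained in the
  homogeneous maximal ideal \<open>m + I 1 + I 2 + \<dots>\<close>, so the fibre ring has dimension at least \<open>1\<close>. Hence
  analytic spread \<open>0\<close> makes the fibre over \<open>m\<close> empty. Over a prime \<open>q \<noteq> m\<close> no \<open>I n\<close> is
  contained in \<open>q\<close>, so that the only homogeneous prime over \<open>q\<close> consists of the polynomials with
  coefficients in \<open>q\<close>, and \<open>a t^n / f t^n = a / f\<close> identifies the local rings.

  The affine scheme \<open>Spec A\<close> is \<open>Proj\<close> of \<open>A\<close> for the grading in which every piece is all of \<open>A\<close>, so
  that localizations, structure sheaves and morphisms can be treated once, for \<open>Proj\<close>.\<close>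

section \<open>Localization\<close>

text \<open>The structure sheaves are never compared by computing sections. Sections are functions
  into local rings that are locally given by one fraction, so an isomorphism amounts to a
  homeomorphism together with isomorphisms of the rings at the points, provided that locally given
  fractions go to locally given fractions. The locale \<open>contraction_iso\<close> collects what
  has to be checked for this. It is met in two situations: R -> R[I] over the punctured spectrum,
  and R -> R_f over the basic open set of f.

  The obstacle to Noetherianity is that R[I] may fail to be Noetherian, so nothing can be read off
  from the standard charts of Proj. Everything is drawn from R instead. For f in m, the part of Proj
  where f does not vanish and Spec R_f both contract isomorphically onto the basic open set of f in
  Spec R. These parts cover Proj because no point lies over m. Quasi-compactness comes from the
  maximum condition on ideals of R and is carried over by contraction.\<close>

lemma (in cring) sum_fractions_assoc:
  assumes "a \<in> carrier R" "b \<in> carrier R" "c \<in> carrier R"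
    and "s \<in> carrier R" "t \<in> carrier R" "r \<in> carrier R"
  shows "s \<otimes> (t \<otimes> r) \<otimes> (r \<otimes> (t \<otimes> a \<oplus> s \<otimes> b) \<oplus> s \<otimes> t \<otimes> c)
    = s \<otimes> t \<otimes> r \<otimes> (t \<otimes> r \<otimes> a \<oplus> s \<otimes> (r \<otimes> b \<oplus> t \<otimes> c))"
  using assms by algebra

text \<open>This identity and the preceding one are the distributive law and the associative law of
  addition for a/s, b/t, c/r after cross-multiplication, arranged as the goals that
  \<open>fraction_eqI\<close> leaves in \<open>cring_localization\<close>.\<close>

lemma (in cring) sum_fractions_distr:
  assumes "a \<in> carrier R" "b \<in> carrier R" "c \<in> carrier R"
    and "s \<in> carrier R" "t \<in> carrier R" "r \<in> carrier R"
  shows "s \<otimes> r \<otimes> (t \<otimes> r) \<otimes> ((t \<otimes> a \<oplus> s \<otimes> b) \<otimes> c)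
    = s \<otimes> t \<otimes> r \<otimes> (t \<otimes> r \<otimes> (a \<otimes> c) \<oplus> s \<otimes> r \<otimes> (b \<otimes> c))"
  using assms by algebra

text \<open>Sums and products of classes, of fractions as well as of germs, are unions over
  representatives. Such a union is the common value as soon as a representative exists, so each
  application has to supply only independence of the representatives.\<close>

lemma UN_const_pair:
  assumes "p \<in> X" "\<And>a s. (a, s) \<in> X \<Longrightarrow> f a s = c"
  shows "(\<Union>(a, s)\<in>X. f a s) = c"
  using assms by (cases p) auto

locale mult_system = cring A for A (structure) and S +
  assumes S_sub: "S \<subseteq> carrier A"
    and one_in_S: "\<one> \<in> S"
    and mult_in_S: "\<lbrakk>s \<in> S; t \<in> S\<rbrakk> \<Longrightarrow> s \<otimes> t \<in> S"
begin

lemma S_carrier [simp]: "s \<in> S \<Longrightarrow> s \<in> carrier A"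
  using S_sub by blast

declare one_in_S [simp] mult_in_S [simp]

lemma fraction_rel_trans:
  assumes c: "a \<in> carrier A" "b \<in> carrier A" "c \<in> carrier A" and S: "s \<in> S" "t \<in> S" "r \<in> S"
    and 1: "\<exists>u\<in>S. u \<otimes> (t \<otimes> a) = u \<otimes> (s \<otimes> b)" and 2: "\<exists>u\<in>S. u \<otimes> (r \<otimes> b) = u \<otimes> (t \<otimes> c)"
  shows "\<exists>u\<in>S. u \<otimes> (r \<otimes> a) = u \<otimes> (s \<otimes> c)"
proof -
  obtain u v where u: "u \<in> S" "u \<otimes> (t \<otimes> a) = u \<otimes> (s \<otimes> b)"
    and v: "v \<in> S" "v \<otimes> (r \<otimes> b) = v \<otimes> (t \<otimes> c)"
    using 1 2 by blast
  \<comment> \<open>The middle denominator t belongs to the witness: it allows the two relations to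
    be chained through b.\<close>
  have "(u \<otimes> v \<otimes> t) \<otimes> (r \<otimes> a) = (v \<otimes> r) \<otimes> (u \<otimes> (t \<otimes> a))"
    using c S u(1) v(1) by (simp add: m_ac)
  also have "\<dots> = (u \<otimes> s) \<otimes> (v \<otimes> (r \<otimes> b))"
    unfolding u(2) using c S u(1) v(1) by (simp add: m_ac)
  also have "\<dots> = (u \<otimes> v \<otimes> t) \<otimes> (s \<otimes> c)"
    unfolding v(2) using c S u(1) v(1) by (simp add: m_ac)
  finally show ?thesis
    using S u(1) v(1) mult_in_S by blast
qed

text \<open>A class is literally its set of representatives. Equal classes therefore contain each
  other's pairs, and conversely transitivity, applied in both directions, makes the two sets
  equal.\<close>

lemma fraction_eq_iff:
  assumes c: "a \<in> carrier A" "b \<in> carrier A" and S: "s \<in> S" "t \<in> S"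
  shows "fraction A S a s = fraction A S b t \<longleftrightarrow> (\<exists>u\<in>S. u \<otimes> (t \<otimes> a) = u \<otimes> (s \<otimes> b))"
proof
  have "(a, s) \<in> fraction A S a s"
    using c S one_in_S by (auto simp: fraction_def)
  moreover assume "fraction A S a s = fraction A S b t"
  ultimately have "(a, s) \<in> fraction A S b t"
    by simp
  then obtain u where "u \<in> S" "u \<otimes> (s \<otimes> b) = u \<otimes> (t \<otimes> a)"
    by (auto simp: fraction_def)
  then show "\<exists>u\<in>S. u \<otimes> (t \<otimes> a) = u \<otimes> (s \<otimes> b)"
    by (intro bexI[of _ u]) simp_all
next
  assume rel: "\<exists>u\<in>S. u \<otimes> (t \<otimes> a) = u \<otimes> (s \<otimes> b)"
  then have rel': "\<exists>u\<in>S. u \<otimes> (s \<otimes> b) = u \<otimes> (t \<otimes> a)"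
    by metis
  have "(\<exists>u\<in>S. u \<otimes> (r \<otimes> a) = u \<otimes> (s \<otimes> d)) \<longleftrightarrow> (\<exists>u\<in>S. u \<otimes> (r \<otimes> b) = u \<otimes> (t \<otimes> d))"
    if "d \<in> carrier A" "r \<in> S" for d r
    using fraction_rel_trans[of b a d t s r] fraction_rel_trans[of a b d s t r] rel rel' that c S
    by blast
  then show "fraction A S a s = fraction A S b t"
    unfolding fraction_def by blast
qed

lemma fraction_eqI:
  assumes "a \<in> carrier A" "b \<in> carrier A" "s \<in> S" "t \<in> S" "t \<otimes> a = s \<otimes> b"
  shows "fraction A S a s = fraction A S b t"
  using assms one_in_S by (subst fraction_eq_iff) auto

lemma mem_fraction: "\<lbrakk>a \<in> carrier A; s \<in> S\<rbrakk> \<Longrightarrow> (a, s) \<in> fraction A S a s"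
  using one_in_S by (auto simp: fraction_def)

lemma mem_fractionD:
  assumes "(b, t) \<in> fraction A S a s" "a \<in> carrier A" "s \<in> S"
  shows "b \<in> carrier A" "t \<in> S" "fraction A S b t = fraction A S a s"
proof -
  show b: "b \<in> carrier A" "t \<in> S"
    using assms(1) by (auto simp: fraction_def)
  obtain u where "u \<in> S" "u \<otimes> (t \<otimes> a) = u \<otimes> (s \<otimes> b)"
    using assms(1) by (auto simp: fraction_def)
  then show "fraction A S b t = fraction A S a s"
    using assms(2,3) b by (subst fraction_eq_iff) (auto intro!: bexI[of _ u])
qed

lemma localization_mult:
  assumes c: "a \<in> carrier A" "b \<in> carrier A" and S: "s \<in> S" "t \<in> S"
  shows "fraction A S a s \<otimes>\<^bsub>localization A S\<^esub> fraction A S b t = fraction A S (a \<otimes> b) (s \<otimes> t)"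
proof -
  have eq: "fraction A S (a' \<otimes> b') (s' \<otimes> t') = fraction A S (a \<otimes> b) (s \<otimes> t)"
    if m: "(a', s') \<in> fraction A S a s" "(b', t') \<in> fraction A S b t" for a' s' b' t'
  proof -
    have cc: "a' \<in> carrier A" "s' \<in> S" "b' \<in> carrier A" "t' \<in> S"
      using m by (auto simp: fraction_def)
    obtain u where u: "u \<in> S" "u \<otimes> (s' \<otimes> a) = u \<otimes> (s \<otimes> a')"
      using m(1) by (auto simp: fraction_def)
    obtain v where v: "v \<in> S" "v \<otimes> (t' \<otimes> b) = v \<otimes> (t \<otimes> b')"
      using m(2) by (auto simp: fraction_def)
    have "(u \<otimes> v) \<otimes> ((s \<otimes> t) \<otimes> (a' \<otimes> b')) = (u \<otimes> (s \<otimes> a')) \<otimes> (v \<otimes> (t \<otimes> b'))"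
      using c S cc u(1) v(1) by (simp add: m_ac)
    also have "\<dots> = (u \<otimes> v) \<otimes> ((s' \<otimes> t') \<otimes> (a \<otimes> b))"
      unfolding u(2)[symmetric] v(2)[symmetric] using c S cc u(1) v(1) by (simp add: m_ac)
    finally show ?thesis
      using c S cc u(1) v(1) mult_in_S by (subst fraction_eq_iff) (auto intro!: bexI[of _ "u \<otimes> v"])
  qed
  show ?thesis
    unfolding localization_def monoid.simps
    by (rule UN_const_pair[OF mem_fraction[OF c(1) S(1)]], rule UN_const_pair[OF mem_fraction[OF c(2) S(2)]])
      (rule eq)
qed

lemma localization_add:
  assumes c: "a \<in> carrier A" "b \<in> carrier A" and S: "s \<in> S" "t \<in> S"
  shows "fraction A S a s \<oplus>\<^bsub>localization A S\<^esub> fraction A S b t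
    = fraction A S (t \<otimes> a \<oplus> s \<otimes> b) (s \<otimes> t)"
proof -
  have eq: "fraction A S (t' \<otimes> a' \<oplus> s' \<otimes> b') (s' \<otimes> t') = fraction A S (t \<otimes> a \<oplus> s \<otimes> b) (s \<otimes> t)"
    if m: "(a', s') \<in> fraction A S a s" "(b', t') \<in> fraction A S b t" for a' s' b' t'
  proof -
    have cc: "a' \<in> carrier A" "s' \<in> S" "b' \<in> carrier A" "t' \<in> S"
      using m by (auto simp: fraction_def)
    obtain u where u: "u \<in> S" "u \<otimes> (s' \<otimes> a) = u \<otimes> (s \<otimes> a')"
      using m(1) by (auto simp: fraction_def)
    obtain v where v: "v \<in> S" "v \<otimes> (t' \<otimes> b) = v \<otimes> (t \<otimes> b')"
      using m(2) by (auto simp: fraction_def)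
    have "(u \<otimes> v) \<otimes> ((s \<otimes> t) \<otimes> (t' \<otimes> a' \<oplus> s' \<otimes> b'))
        = (u \<otimes> (s \<otimes> a')) \<otimes> (v \<otimes> t \<otimes> t') \<oplus> (v \<otimes> (t \<otimes> b')) \<otimes> (u \<otimes> s \<otimes> s')"
      using c S cc u(1) v(1) by (simp add: m_ac r_distr)
    also have "\<dots> = (u \<otimes> v) \<otimes> ((s' \<otimes> t') \<otimes> (t \<otimes> a \<oplus> s \<otimes> b))"
      unfolding u(2)[symmetric] v(2)[symmetric]
      using c S cc u(1) v(1) by (simp add: m_ac r_distr)
    finally show ?thesis
      using c S cc u(1) v(1) mult_in_S by (subst fraction_eq_iff) (auto intro!: bexI[of _ "u \<otimes> v"])
  qed
  show ?thesis
    unfolding localization_def ring.simps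
    by (rule UN_const_pair[OF mem_fraction[OF c(1) S(1)]], rule UN_const_pair[OF mem_fraction[OF c(2) S(2)]])
      (rule eq)
qed

lemma localization_carrier:
  "x \<in> carrier (localization A S) \<longleftrightarrow> (\<exists>a\<in>carrier A. \<exists>s\<in>S. x = fraction A S a s)"
  by (auto simp: localization_def)

lemma localization_one: "\<one>\<^bsub>localization A S\<^esub> = fraction A S \<one> \<one>"
  and localization_zero: "\<zero>\<^bsub>localization A S\<^esub> = fraction A S \<zero> \<one>"
  by (simp_all add: localization_def)

lemma fraction_in_localization:
  "\<lbrakk>a \<in> carrier A; s \<in> S\<rbrakk> \<Longrightarrow> fraction A S a s \<in> carrier (localization A S)"
  unfolding localization_carrier by blast

lemma fraction_zero: "s \<in> S \<Longrightarrow> fraction A S \<zero> s = \<zero>\<^bsub>localization A S\<^esub>"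
  unfolding localization_zero using one_in_S by (intro fraction_eqI) auto

lemma localization_neg:
  assumes "a \<in> carrier A" "s \<in> S"
  shows "fraction A S (\<ominus> a) s \<oplus>\<^bsub>localization A S\<^esub> fraction A S a s = \<zero>\<^bsub>localization A S\<^esub>"
  using assms mult_in_S by (subst localization_add) (auto simp: r_minus l_neg fraction_zero)

lemma cring_localization: "cring (localization A S)"
proof (rule cringI)
  let ?L = "localization A S"
  show "abelian_group ?L"
  proof (rule abelian_groupI)
    fix x y z assume "x \<in> carrier ?L" "y \<in> carrier ?L" "z \<in> carrier ?L"
    then obtain a s b t c r where x: "x = fraction A S a s" "a \<in> carrier A" "s \<in> S"
      and y: "y = fraction A S b t" "b \<in> carrier A" "t \<in> S"
      and z: "z = fraction A S c r" "c \<in> carrier A" "r \<in> S"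
      unfolding localization_carrier by blast
    show "x \<oplus>\<^bsub>?L\<^esub> y \<in> carrier ?L"
      using x y by (simp add: localization_add fraction_in_localization)
    show "x \<oplus>\<^bsub>?L\<^esub> y \<oplus>\<^bsub>?L\<^esub> z = x \<oplus>\<^bsub>?L\<^esub> (y \<oplus>\<^bsub>?L\<^esub> z)"
      using x y z
      by (simp add: localization_add) (intro fraction_eqI sum_fractions_assoc, auto)
    show "x \<oplus>\<^bsub>?L\<^esub> y = y \<oplus>\<^bsub>?L\<^esub> x"
      using x y by (simp add: localization_add a_comm m_comm)
  next
    show "\<zero>\<^bsub>?L\<^esub> \<in> carrier ?L"
      by (simp add: localization_zero fraction_in_localization)
  next
    fix x assume "x \<in> carrier ?L"
    then obtain a s where x: "x = fraction A S a s" "a \<in> carrier A" "s \<in> S"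
      unfolding localization_carrier by blast
    show "\<zero>\<^bsub>?L\<^esub> \<oplus>\<^bsub>?L\<^esub> x = x"
      using x by (simp add: localization_zero localization_add)
    show "\<exists>y\<in>carrier ?L. y \<oplus>\<^bsub>?L\<^esub> x = \<zero>\<^bsub>?L\<^esub>"
      using x localization_neg[of a s] fraction_in_localization[of "\<ominus> a" s] by auto
  qed
  show "comm_monoid ?L"
  proof (rule comm_monoidI)
    fix x y z assume "x \<in> carrier ?L" "y \<in> carrier ?L" "z \<in> carrier ?L"
    then obtain a s b t c r where x: "x = fraction A S a s" "a \<in> carrier A" "s \<in> S"
      and y: "y = fraction A S b t" "b \<in> carrier A" "t \<in> S"
      and z: "z = fraction A S c r" "c \<in> carrier A" "r \<in> S"
      unfolding localization_carrier by blast
    show "x \<otimes>\<^bsub>?L\<^esub> y \<in> carrier ?L"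
      using x y by (simp add: localization_mult fraction_in_localization)
    show "x \<otimes>\<^bsub>?L\<^esub> y \<otimes>\<^bsub>?L\<^esub> z = x \<otimes>\<^bsub>?L\<^esub> (y \<otimes>\<^bsub>?L\<^esub> z)"
      using x y z by (simp add: localization_mult m_assoc)
    show "x \<otimes>\<^bsub>?L\<^esub> y = y \<otimes>\<^bsub>?L\<^esub> x"
      using x y by (simp add: localization_mult m_comm)
  next
    show "\<one>\<^bsub>?L\<^esub> \<in> carrier ?L"
      by (simp add: localization_one fraction_in_localization)
  next
    fix x assume "x \<in> carrier ?L"
    then obtain a s where x: "x = fraction A S a s" "a \<in> carrier A" "s \<in> S"
      unfolding localization_carrier by blast
    show "\<one>\<^bsub>?L\<^esub> \<otimes>\<^bsub>?L\<^esub> x = x"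
      using x by (simp add: localization_one localization_mult)
  qed
  fix x y z assume "x \<in> carrier ?L" "y \<in> carrier ?L" "z \<in> carrier ?L"
  then obtain a s b t c r where x: "x = fraction A S a s" "a \<in> carrier A" "s \<in> S"
    and y: "y = fraction A S b t" "b \<in> carrier A" "t \<in> S"
    and z: "z = fraction A S c r" "c \<in> carrier A" "r \<in> S"
    unfolding localization_carrier by blast
  show "(x \<oplus>\<^bsub>?L\<^esub> y) \<otimes>\<^bsub>?L\<^esub> z = x \<otimes>\<^bsub>?L\<^esub> z \<oplus>\<^bsub>?L\<^esub> y \<otimes>\<^bsub>?L\<^esub> z"
    using x y z
    by (simp add: localization_add localization_mult)
      (intro fraction_eqI sum_fractions_distr, auto)
qed

end

section \<open>Local rings\<close>

text \<open>The elementwise criterion for a local ring. It mentions no ideals, so it passes easily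
  along isomorphisms. The zero ring has no nonunits and would satisfy the last clause vacuously;
  \<one> \<noteq> \<zero> excludes it.\<close>

definition nonunits_additive :: "('a, 'm) ring_scheme \<Rightarrow> bool" where
  "nonunits_additive A \<longleftrightarrow> cring A \<and> \<one>\<^bsub>A\<^esub> \<noteq> \<zero>\<^bsub>A\<^esub> \<and>
     (\<forall>x\<in>carrier A - Units A. \<forall>y\<in>carrier A - Units A. x \<oplus>\<^bsub>A\<^esub> y \<notin> Units A)"

text \<open>A proper ideal contains no unit. Once the nonunits form an ideal, it contains every
  proper ideal and is the only maximal one, which also resolves the \<open>THE\<close> in
  \<open>max_ideal\<close>.\<close>

lemma nonunits_additive_imp_local:
  fixes A (structure)
  assumes "nonunits_additive A"
  shows "local_ring A" "max_ideal A = carrier A - Units A"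
proof -
  interpret cring A using assms by (simp add: nonunits_additive_def)
  let ?M = "carrier A - Units A"
  have ne: "\<one> \<noteq> \<zero>" and add: "\<And>x y. x \<in> ?M \<Longrightarrow> y \<in> ?M \<Longrightarrow> x \<oplus> y \<in> ?M"
    using assms a_closed unfolding nonunits_additive_def by blast+
  have mult: "x \<otimes> a \<in> ?M" if "x \<in> carrier A" "a \<in> ?M" for a x
    using that unit_factor[of a x] m_comm[of a x] by auto
  have mult': "a \<otimes> x \<in> ?M" if "x \<in> carrier A" "a \<in> ?M" for a x
    using mult[OF that] that m_comm[of a x] by simp
  have zero: "\<zero> \<in> ?M"
    using ne by (auto simp: Units_def)
  have I: "ideal ?M A"
  proof (rule idealI[OF ring_axioms])
    show "subgroup ?M (add_monoid A)"
    proof (rule add.subgroupI)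
      fix a assume "a \<in> ?M"
      then show "\<ominus> a \<in> ?M"
        using mult[of "\<ominus> \<one>" a] by (simp add: l_minus)
    qed (use zero add in auto)
  qed (use mult mult' in blast)+
  have le: "J \<subseteq> ?M" if J: "ideal J A" "J \<noteq> carrier A" for J
  proof
    fix x assume x: "x \<in> J"
    have "x \<notin> Units A"
    proof
      assume "x \<in> Units A"
      then have "\<one> \<in> J"
        using ideal.I_l_closed[OF J(1) x, of "inv x"] by simp
      then show False
        using ideal.one_imp_carrier[OF J(1)] J(2) by simp
    qed
    then show "x \<in> ?M"
      using x J by (auto dest: ideal.Icarr)
  qed
  have pr: "?M \<noteq> carrier A"
    using Units_one_closed by blast
  have M: "maximalideal ?M A"
    using I le pr by (intro maximalidealI) auto
  have uniq: "J = ?M" if "maximalideal J A" for J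
    using le[of J] maximalideal.I_maximal[OF that I] maximalideal.I_notcarr[OF that]
      maximalideal.axioms(1)[OF that] pr by auto
  show "local_ring A"
    unfolding local_ring_def using M uniq cring_axioms by blast
  show "max_ideal A = ?M"
    unfolding max_ideal_def using M uniq by (rule the_equality)
qed

lemma ring_hom_Units:
  assumes h: "h \<in> ring_hom A B" and A: "cring A" and B: "cring B" and x: "x \<in> Units A"
  shows "h x \<in> Units B"
proof -
  interpret A: cring A by fact
  interpret B: cring B by fact
  have "h x \<otimes>\<^bsub>B\<^esub> h (inv\<^bsub>A\<^esub> x) = \<one>\<^bsub>B\<^esub>"
    using x h by (metis A.Units_closed A.Units_inv_closed A.Units_r_inv ring_hom_mult ring_hom_one)
  moreover have "h x \<in> carrier B" "h (inv\<^bsub>A\<^esub> x) \<in> carrier B"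
    using x h by (auto simp: ring_hom_closed)
  ultimately show ?thesis
    using B.m_comm by (fastforce simp: Units_def)
qed

text \<open>Since h preserves units and undoes k, k sends nonunits to nonunits. A sum of nonunits of
  B that is a unit would give such a sum in A.\<close>

lemma nonunits_additive_iso:
  assumes A: "nonunits_additive A" and B: "cring B"
    and h: "h \<in> ring_hom A B" and k: "k \<in> ring_hom B A"
    and kh: "\<And>y. y \<in> carrier B \<Longrightarrow> h (k y) = y"
  shows "nonunits_additive B"
proof -
  interpret A: cring A using A by (simp add: nonunits_additive_def)
  interpret B: cring B by fact
  note k' = ring_hom_Units[OF k B A.cring_axioms] and h' = ring_hom_Units[OF h A.cring_axioms B]
  have nu: "k y \<in> carrier A - Units A" if "y \<in> carrier B - Units B" for y
    using that ring_hom_closed[OF k, of y] h'[of "k y"] kh[of y] by auto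
  have "\<one>\<^bsub>B\<^esub> \<noteq> \<zero>\<^bsub>B\<^esub>"
    using A ring_hom_one[OF k] ring_hom_zero[OF k B.ring_axioms A.ring_axioms]
    by (auto simp: nonunits_additive_def)
  moreover have "y \<oplus>\<^bsub>B\<^esub> z \<notin> Units B" if "y \<in> carrier B - Units B" "z \<in> carrier B - Units B" for y z
  proof
    assume "y \<oplus>\<^bsub>B\<^esub> z \<in> Units B"
    then have "k y \<oplus>\<^bsub>A\<^esub> k z \<in> Units A"
      using k'[of "y \<oplus>\<^bsub>B\<^esub> z"] ring_hom_add[OF k, of y z] that by simp
    then show False
      using A nu that unfolding nonunits_additive_def by blast
  qed
  ultimately show ?thesis
    unfolding nonunits_additive_def using B by blast
qed

section \<open>Sheaves of functions\<close>

text \<open>\<open>F V s\<close> says that s is given on V by one formula. The last two axioms make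
  the stalk at x equal to \<open>L x\<close>: \<open>F_through\<close> yields surjectivity and
  \<open>F_agree\<close> injectivity of evaluation at x. The equation for sections is required on
  open sets only, because an open subspace keeps the sections of the ambient space and changes just
  the topology.\<close>

locale function_sheaf =
  fixes X :: "('x, 'x \<Rightarrow> 'b) rspace" and L :: "'x \<Rightarrow> 'b ring"
    and F :: "'x set \<Rightarrow> ('x \<Rightarrow> 'b) \<Rightarrow> bool"
  assumes res_eq: "rs_res X = (\<lambda>U V s. restrict s V)"
    and sec_eq: "openin (rs_top X) U \<Longrightarrow> rs_sec X U = local_sections (rs_top X) L F U"
    and local: "x \<in> topspace (rs_top X) \<Longrightarrow> nonunits_additive (L x)"
    and F_cong: "\<lbrakk>F V s; \<And>x. x \<in> V \<Longrightarrow> t x = s x\<rbrakk> \<Longrightarrow> F V t"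
    and F_mono: "\<lbrakk>F V s; W \<subseteq> V\<rbrakk> \<Longrightarrow> F W s"
    and F_carrier: "\<lbrakk>openin (rs_top X) V; F V s; x \<in> V\<rbrakk> \<Longrightarrow> s x \<in> carrier (L x)"
    and F_zero: "openin (rs_top X) V \<Longrightarrow> F V (\<lambda>x. \<zero>\<^bsub>L x\<^esub>)"
    and F_one: "openin (rs_top X) V \<Longrightarrow> F V (\<lambda>x. \<one>\<^bsub>L x\<^esub>)"
    and F_neg: "\<lbrakk>openin (rs_top X) V; F V s\<rbrakk> \<Longrightarrow> F V (\<lambda>x. \<ominus>\<^bsub>L x\<^esub> s x)"
    and F_add: "\<lbrakk>openin (rs_top X) V; F V s; F V t\<rbrakk> \<Longrightarrow> F V (\<lambda>x. s x \<oplus>\<^bsub>L x\<^esub> t x)"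
    and F_mult: "\<lbrakk>openin (rs_top X) V; F V s; F V t\<rbrakk> \<Longrightarrow> F V (\<lambda>x. s x \<otimes>\<^bsub>L x\<^esub> t x)"
    and F_through: "\<lbrakk>x \<in> topspace (rs_top X); v \<in> carrier (L x)\<rbrakk>
      \<Longrightarrow> \<exists>V s. openin (rs_top X) V \<and> x \<in> V \<and> F V s \<and> s x = v"
    and F_agree: "\<lbrakk>openin (rs_top X) V; x \<in> V; F V s; F V t; s x = t x\<rbrakk>
      \<Longrightarrow> \<exists>W. openin (rs_top X) W \<and> x \<in> W \<and> W \<subseteq> V \<and> (\<forall>y\<in>W. s y = t y)"
begin

abbreviation T where "T \<equiv> rs_top X"

lemma local_cring: "x \<in> topspace T \<Longrightarrow> cring (L x)"
  using local by (simp add: nonunits_additive_def)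

lemma open_cring: "\<lbrakk>openin T U; x \<in> U\<rbrakk> \<Longrightarrow> cring (L x)"
  using local_cring openin_subset by blast

lemma sec_carrier:
  assumes "openin T U"
  shows "s \<in> carrier (rs_sec X U) \<longleftrightarrow> s \<in> extensional U \<and>
    (\<forall>x\<in>U. \<exists>V. openin T V \<and> x \<in> V \<and> V \<subseteq> U \<and> F V s)"
  unfolding sec_eq[OF assms] local_sections_def
  using F_carrier by (fastforce simp: PiE_iff)

lemma sec_value: "\<lbrakk>openin T U; s \<in> carrier (rs_sec X U); x \<in> U\<rbrakk> \<Longrightarrow> s x \<in> carrier (L x)"
  using sec_carrier[of U s] F_carrier by blast

lemma sec_ops:
  assumes "openin T U"
  shows "s \<otimes>\<^bsub>rs_sec X U\<^esub> t = (\<lambda>x\<in>U. s x \<otimes>\<^bsub>L x\<^esub> t x)"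
    and "s \<oplus>\<^bsub>rs_sec X U\<^esub> t = (\<lambda>x\<in>U. s x \<oplus>\<^bsub>L x\<^esub> t x)"
    and "\<one>\<^bsub>rs_sec X U\<^esub> = (\<lambda>x\<in>U. \<one>\<^bsub>L x\<^esub>)"
    and "\<zero>\<^bsub>rs_sec X U\<^esub> = (\<lambda>x\<in>U. \<zero>\<^bsub>L x\<^esub>)"
  by (simp_all add: sec_eq[OF assms] local_sections_def)

lemma restrict_sec:
  assumes U: "openin T U"
    and F: "\<And>x. x \<in> U \<Longrightarrow> \<exists>V. openin T V \<and> x \<in> V \<and> V \<subseteq> U \<and> F V s"
  shows "restrict s U \<in> carrier (rs_sec X U)"
  unfolding sec_carrier[OF U]
proof (intro conjI ballI)
  fix x assume "x \<in> U"
  then obtain V where V: "openin T V" "x \<in> V" "V \<subseteq> U" "F V s"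
    using F by blast
  have "F V (restrict s U)"
    by (rule F_cong[OF V(4)]) (use V(3) in auto)
  with V show "\<exists>V. openin T V \<and> x \<in> V \<and> V \<subseteq> U \<and> F V (restrict s U)"
    by blast
qed simp

lemma sec_common_nbhd:
  assumes U: "openin T U" and s: "s \<in> carrier (rs_sec X U)" and t: "t \<in> carrier (rs_sec X U)"
    and x: "x \<in> U"
  shows "\<exists>V. openin T V \<and> x \<in> V \<and> V \<subseteq> U \<and> F V s \<and> F V t"
proof -
  obtain V W where V: "openin T V" "x \<in> V" "V \<subseteq> U" "F V s"
    and W: "openin T W" "x \<in> W" "W \<subseteq> U" "F W t"
    using s t x unfolding sec_carrier[OF U] by blast
  then have "F (V \<inter> W) s" "F (V \<inter> W) t"
    using F_mono by blast+
  then show ?thesis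
    using V W by (intro exI[of _ "V \<inter> W"]) auto
qed

lemma res_sec:
  assumes U: "openin T U" and V: "openin T V" "V \<subseteq> U" and s: "s \<in> carrier (rs_sec X U)"
  shows "restrict s V \<in> carrier (rs_sec X V)"
proof (rule restrict_sec[OF V(1)])
  fix x assume x: "x \<in> V"
  then obtain W where W: "openin T W" "x \<in> W" "W \<subseteq> U" "F W s"
    using s V(2) unfolding sec_carrier[OF U] by blast
  then have "F (W \<inter> V) s"
    using F_mono by blast
  then show "\<exists>V'. openin T V' \<and> x \<in> V' \<and> V' \<subseteq> V \<and> F V' s"
    using W x V by (intro exI[of _ "W \<inter> V"]) auto
qed

lemma sec_closed:
  assumes U: "openin T U" and s: "s \<in> carrier (rs_sec X U)" and t: "t \<in> carrier (rs_sec X U)"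
  shows "(\<lambda>x\<in>U. s x \<otimes>\<^bsub>L x\<^esub> t x) \<in> carrier (rs_sec X U)"
    and "(\<lambda>x\<in>U. s x \<oplus>\<^bsub>L x\<^esub> t x) \<in> carrier (rs_sec X U)"
    and "(\<lambda>x\<in>U. \<ominus>\<^bsub>L x\<^esub> s x) \<in> carrier (rs_sec X U)"
proof -
  have "\<exists>V. openin T V \<and> x \<in> V \<and> V \<subseteq> U \<and> F V (\<lambda>x. s x \<otimes>\<^bsub>L x\<^esub> t x) \<and>
      F V (\<lambda>x. s x \<oplus>\<^bsub>L x\<^esub> t x) \<and> F V (\<lambda>x. \<ominus>\<^bsub>L x\<^esub> s x)" if x: "x \<in> U" for x
  proof -
    obtain V where V: "openin T V" "x \<in> V" "V \<subseteq> U" "F V s" "F V t"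
      using sec_common_nbhd[OF U s t x] by blast
    with F_mult[OF V(1,4,5)] F_add[OF V(1,4,5)] F_neg[OF V(1,4)] show ?thesis
      by blast
  qed
  then show "(\<lambda>x\<in>U. s x \<otimes>\<^bsub>L x\<^esub> t x) \<in> carrier (rs_sec X U)"
    and "(\<lambda>x\<in>U. s x \<oplus>\<^bsub>L x\<^esub> t x) \<in> carrier (rs_sec X U)"
    and "(\<lambda>x\<in>U. \<ominus>\<^bsub>L x\<^esub> s x) \<in> carrier (rs_sec X U)"
    by (meson restrict_sec[OF U])+
qed

lemma sec_closed_const:
  assumes U: "openin T U"
  shows "(\<lambda>x\<in>U. \<one>\<^bsub>L x\<^esub>) \<in> carrier (rs_sec X U)"
    and "(\<lambda>x\<in>U. \<zero>\<^bsub>L x\<^esub>) \<in> carrier (rs_sec X U)"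
  by (rule restrict_sec[OF U], rule exI[of _ U], simp add: U F_one F_zero)+

lemma sec_eqI:
  assumes U: "openin T U" and "s \<in> carrier (rs_sec X U)" "t \<in> carrier (rs_sec X U)"
    and "\<And>x. x \<in> U \<Longrightarrow> s x = t x"
  shows "s = t"
  using assms by (auto simp: sec_carrier[OF U] intro: extensionalityI)

lemma cring_sec:
  assumes U: "openin T U"
  shows "cring (rs_sec X U)"
proof -
  let ?S = "rs_sec X U"
  note ops = sec_ops[OF U] and closed = sec_closed[OF U] sec_closed_const[OF U]
  note val = sec_value[OF U]
  show ?thesis
  proof (rule cringI)
    show "abelian_group ?S"
    proof (rule abelian_groupI)
      fix s t r assume c: "s \<in> carrier ?S" "t \<in> carrier ?S" "r \<in> carrier ?S"
      show "s \<oplus>\<^bsub>?S\<^esub> t \<in> carrier ?S"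
        unfolding ops using c closed by blast
      show "s \<oplus>\<^bsub>?S\<^esub> t \<oplus>\<^bsub>?S\<^esub> r = s \<oplus>\<^bsub>?S\<^esub> (t \<oplus>\<^bsub>?S\<^esub> r)"
        unfolding ops
        by (intro restrict_ext) (simp add: c val abelian_monoid.a_assoc ring.is_abelian_group
            cring.axioms(1) open_cring[OF U] abelian_group.axioms(1))
      show "s \<oplus>\<^bsub>?S\<^esub> t = t \<oplus>\<^bsub>?S\<^esub> s"
        unfolding ops
        by (intro restrict_ext) (simp add: c val abelian_monoid.a_comm ring.is_abelian_group
            cring.axioms(1) open_cring[OF U] abelian_group.axioms(1))
    next
      show "\<zero>\<^bsub>?S\<^esub> \<in> carrier ?S"
        unfolding ops by (rule closed)
    next
      fix s assume c: "s \<in> carrier ?S"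
      show "\<zero>\<^bsub>?S\<^esub> \<oplus>\<^bsub>?S\<^esub> s = s"
        unfolding ops
        by (rule sec_eqI[OF U closed(2)[OF closed(5) c] c])
          (simp add: val[OF c] open_cring[OF U] cring.cring_simprules(8))
      show "\<exists>t\<in>carrier ?S. t \<oplus>\<^bsub>?S\<^esub> s = \<zero>\<^bsub>?S\<^esub>"
        unfolding ops
        by (rule bexI[OF _ closed(3)[OF c c]], intro restrict_ext)
          (simp add: val[OF c] open_cring[OF U] cring.cring_simprules(9))
    qed
    show "comm_monoid ?S"
    proof (rule comm_monoidI)
      fix s t r assume c: "s \<in> carrier ?S" "t \<in> carrier ?S" "r \<in> carrier ?S"
      show "s \<otimes>\<^bsub>?S\<^esub> t \<in> carrier ?S"
        unfolding ops using c closed by blast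
      show "s \<otimes>\<^bsub>?S\<^esub> t \<otimes>\<^bsub>?S\<^esub> r = s \<otimes>\<^bsub>?S\<^esub> (t \<otimes>\<^bsub>?S\<^esub> r)"
        unfolding ops
        by (intro restrict_ext) (simp add: c val open_cring[OF U] cring.cring_simprules(11))
      show "s \<otimes>\<^bsub>?S\<^esub> t = t \<otimes>\<^bsub>?S\<^esub> s"
        unfolding ops
        by (intro restrict_ext) (simp add: c val open_cring[OF U] cring.cring_simprules(14))
    next
      show "\<one>\<^bsub>?S\<^esub> \<in> carrier ?S"
        unfolding ops by (rule closed)
    next
      fix s assume c: "s \<in> carrier ?S"
      show "\<one>\<^bsub>?S\<^esub> \<otimes>\<^bsub>?S\<^esub> s = s"
        unfolding ops
        by (rule sec_eqI[OF U closed(1)[OF closed(4) c] c])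
          (simp add: val[OF c] open_cring[OF U] cring.cring_simprules(12))
    qed
    fix s t r assume c: "s \<in> carrier ?S" "t \<in> carrier ?S" "r \<in> carrier ?S"
    show "(s \<oplus>\<^bsub>?S\<^esub> t) \<otimes>\<^bsub>?S\<^esub> r = s \<otimes>\<^bsub>?S\<^esub> r \<oplus>\<^bsub>?S\<^esub> t \<otimes>\<^bsub>?S\<^esub> r"
      unfolding ops
      by (intro restrict_ext) (simp add: c val open_cring[OF U] cring.cring_simprules(13))
  qed
qed

lemma ring_presheaf: "ring_presheaf X"
  unfolding ring_presheaf_def res_eq
proof (intro conjI allI impI ballI; (elim conjE)?)
  fix U V assume U: "openin T U" and V: "openin T V" and le: "V \<subseteq> U"
  show "(\<lambda>s. restrict s V) \<in> ring_hom (rs_sec X U) (rs_sec X V)"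
    by (rule ring_hom_memI)
      (use le in \<open>auto simp: sec_ops[OF U] sec_ops[OF V] res_sec[OF U V le] fun_eq_iff\<close>)
next
  fix U s assume U: "openin T U" and "s \<in> carrier (rs_sec X U)"
  then show "restrict s U = s"
    by (simp add: sec_carrier[OF U] extensional_restrict)
next
  fix U V W s assume "W \<subseteq> V"
  then show "restrict (restrict s V) W = restrict s W"
    by (auto simp: restrict_def fun_eq_iff)
qed (rule cring_sec)

lemma ringed_space: "ringed_space X"
  unfolding ringed_space_def res_eq
proof (intro conjI allI impI ballI; (elim conjE)?)
  show "ring_presheaf X" by (rule ring_presheaf)
next
  fix \<U> s t assume \<U>: "\<forall>U\<in>\<U>. openin T U" and s: "s \<in> carrier (rs_sec X (\<Union>\<U>))"
    and t: "t \<in> carrier (rs_sec X (\<Union>\<U>))" and eq: "\<forall>U\<in>\<U>. restrict s U = restrict t U"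
  show "s = t"
  proof (rule sec_eqI[OF _ s t])
    show "openin T (\<Union>\<U>)"
      using \<U> by blast
    show "s x = t x" if "x \<in> \<Union>\<U>" for x
      using eq that by (metis UnionE restrict_apply')
  qed
next
  fix \<U> \<sigma> assume \<U>: "\<forall>U\<in>\<U>. openin T U" and \<sigma>: "\<forall>U\<in>\<U>. \<sigma> U \<in> carrier (rs_sec X U)"
    and eq: "\<forall>U\<in>\<U>. \<forall>V\<in>\<U>. restrict (\<sigma> U) (U \<inter> V) = restrict (\<sigma> V) (U \<inter> V)"
  \<comment> \<open>The glued function reads its value at x off an arbitrary member of the cover
    that contains x; agreement on overlaps makes the choice immaterial.\<close>
  define s where "s = (\<lambda>x. \<sigma> (SOME U. U \<in> \<U> \<and> x \<in> U) x)"
  have s: "s x = \<sigma> U x" if "U \<in> \<U>" "x \<in> U" for U x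
  proof -
    define V where "V = (SOME U. U \<in> \<U> \<and> x \<in> U)"
    have V: "V \<in> \<U>" "x \<in> V"
      using someI[of "\<lambda>U. U \<in> \<U> \<and> x \<in> U" U] that unfolding V_def by auto
    have "restrict (\<sigma> V) (V \<inter> U) = restrict (\<sigma> U) (V \<inter> U)"
      using eq that(1) V(1) by blast
    then have "restrict (\<sigma> V) (V \<inter> U) x = restrict (\<sigma> U) (V \<inter> U) x"
      by simp
    then show ?thesis
      using V(2) that(2) by (simp add: s_def V_def)
  qed
  have op: "openin T (\<Union>\<U>)"
    using \<U> by blast
  show "\<exists>s\<in>carrier (rs_sec X (\<Union>\<U>)). \<forall>U\<in>\<U>. restrict s U = \<sigma> U"
  proof (intro bexI ballI)
    show "restrict s (\<Union>\<U>) \<in> carrier (rs_sec X (\<Union>\<U>))"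
    proof (rule restrict_sec[OF op])
      fix x assume "x \<in> \<Union>\<U>"
      then obtain U where U: "U \<in> \<U>" "x \<in> U" by blast
      then have "openin T U" "\<sigma> U \<in> carrier (rs_sec X U)"
        using \<U> \<sigma> by auto
      then obtain V where V: "openin T V" "x \<in> V" "V \<subseteq> U" "F V (\<sigma> U)"
        using sec_carrier[of U "\<sigma> U"] U(2) by blast
      have "F V s"
        by (rule F_cong[OF V(4)]) (use s[OF U(1)] V(3) in blast)
      then show "\<exists>V. openin T V \<and> x \<in> V \<and> V \<subseteq> \<Union>\<U> \<and> F V s"
        using V U by blast
    qed
  next
    fix U assume U: "U \<in> \<U>"
    have "\<sigma> U \<in> extensional U"
      using U \<U> \<sigma> sec_carrier[of U "\<sigma> U"] by simp
    then show "restrict (restrict s (\<Union>\<U>)) U = \<sigma> U"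
      using U by (intro extensionalityI[of _ U]) (auto simp: s)
  qed
qed

section \<open>Stalks of a function sheaf are its rings \<open>L x\<close>\<close>

definition germs_of_value where
  "germs_of_value x v = {(V, t). openin T V \<and> x \<in> V \<and> t \<in> carrier (rs_sec X V) \<and> t x = v}"

text \<open>By \<open>F_agree\<close> two sections with the same value at x coincide near x, so a
  germ is determined by that value and contains every section taking it.\<close>

lemma germ_eq:
  assumes U: "openin T U" and x: "x \<in> U" and s: "s \<in> carrier (rs_sec X U)"
  shows "germ X x U s = germs_of_value x (s x)"
proof -
  have "(\<exists>W. openin T W \<and> x \<in> W \<and> W \<subseteq> U \<inter> V \<and> restrict s W = restrict t W) \<longleftrightarrow> t x = s x"
    if V: "openin T V" "x \<in> V" and t: "t \<in> carrier (rs_sec X V)" for V t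
  proof
    show "t x = s x" if "\<exists>W. openin T W \<and> x \<in> W \<and> W \<subseteq> U \<inter> V \<and> restrict s W = restrict t W"
      using that by (metis restrict_apply')
  next
    assume eq: "t x = s x"
    obtain W where W: "openin T W" "x \<in> W" "W \<subseteq> U \<inter> V" "F W (restrict s (U \<inter> V))" "F W (restrict t (U \<inter> V))"
      using sec_common_nbhd[OF _ res_sec[OF U _ _ s] res_sec[OF V(1) _ _ t], of "U \<inter> V" x]
        U V x by (auto simp: openin_Int)
    then obtain W' where W': "openin T W'" "x \<in> W'" "W' \<subseteq> W"
        "\<forall>y\<in>W'. restrict s (U \<inter> V) y = restrict t (U \<inter> V) y"
      using F_agree[OF W(1,2,4,5)] eq x V(2) by auto
    moreover have "restrict s W' = restrict t W'"
    proof (rule restrict_ext)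
      fix y assume "y \<in> W'"
      moreover from this have "y \<in> U \<inter> V"
        using W'(3) W(3) by blast
      ultimately show "s y = t y"
        using W'(4) by (metis restrict_apply')
    qed
    ultimately show "\<exists>W. openin T W \<and> x \<in> W \<and> W \<subseteq> U \<inter> V \<and> restrict s W = restrict t W"
      using W(3) by blast
  qed
  then show ?thesis
    unfolding germ_def germs_of_value_def res_eq by blast
qed

lemma section_through:
  assumes "x \<in> topspace T" "v \<in> carrier (L x)"
  shows "\<exists>U s. openin T U \<and> x \<in> U \<and> s \<in> carrier (rs_sec X U) \<and> s x = v"
proof -
  obtain V s where V: "openin T V" "x \<in> V" "F V s" "s x = v"
    using F_through[OF assms] by blast
  then have "restrict s V \<in> carrier (rs_sec X V)"
    by (intro restrict_sec) auto
  with V show ?thesis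
    by (intro exI[of _ V] exI[of _ "restrict s V"]) auto
qed

lemma germs_of_value_nonempty:
  "\<lbrakk>x \<in> topspace T; v \<in> carrier (L x)\<rbrakk> \<Longrightarrow> \<exists>p. p \<in> germs_of_value x v"
  using section_through unfolding germs_of_value_def by blast

lemma UN_germs:
  assumes "x \<in> topspace T" "v \<in> carrier (L x)"
    and "\<And>V t. (V, t) \<in> germs_of_value x v \<Longrightarrow> f V t = c"
  shows "(\<Union>(V, t)\<in>germs_of_value x v. f V t) = c"
proof -
  obtain p where p: "p \<in> germs_of_value x v"
    using germs_of_value_nonempty[OF assms(1,2)] by blast
  show ?thesis
    by (rule UN_const_pair[OF p assms(3)])
qed

lemma stalk_carrier:
  assumes x: "x \<in> topspace T"
  shows "carrier (stalk X x) = germs_of_value x ` carrier (L x)"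
proof (intro equalityI subsetI)
  fix g assume "g \<in> carrier (stalk X x)"
  then obtain U s where "g = germ X x U s" "openin T U" "x \<in> U" "s \<in> carrier (rs_sec X U)"
    by (auto simp: stalk_def)
  then show "g \<in> germs_of_value x ` carrier (L x)"
    using germ_eq sec_value by blast
next
  fix g assume "g \<in> germs_of_value x ` carrier (L x)"
  then obtain U s where "openin T U" "x \<in> U" "s \<in> carrier (rs_sec X U)" "g = germs_of_value x (s x)"
    using section_through[OF x] by blast
  then have "g = germ X x U s" "openin T U" "x \<in> U" "s \<in> carrier (rs_sec X U)"
    using germ_eq by blast+
  then show "g \<in> carrier (stalk X x)"
    by (auto simp: stalk_def)
qed

lemma stalk_iso:
  assumes x: "x \<in> topspace T"
  shows "germs_of_value x \<in> ring_iso (L x) (stalk X x)"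
proof (rule ring_iso_memI)
  fix v assume v: "v \<in> carrier (L x)"
  then show "germs_of_value x v \<in> carrier (stalk X x)"
    by (simp add: stalk_carrier[OF x])
  fix w assume w: "w \<in> carrier (L x)"
  have mult: "germ X x (U \<inter> V) (rs_res X U (U \<inter> V) s \<otimes>\<^bsub>rs_sec X (U \<inter> V)\<^esub> rs_res X V (U \<inter> V) t)
      = germs_of_value x (v \<otimes>\<^bsub>L x\<^esub> w)"
   and add: "germ X x (U \<inter> V) (rs_res X U (U \<inter> V) s \<oplus>\<^bsub>rs_sec X (U \<inter> V)\<^esub> rs_res X V (U \<inter> V) t)
      = germs_of_value x (v \<oplus>\<^bsub>L x\<^esub> w)"
    if "(U, s) \<in> germs_of_value x v" "(V, t) \<in> germs_of_value x w" for U s V t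
  proof -
    have U: "openin T U" "x \<in> U" "s \<in> carrier (rs_sec X U)" "s x = v"
      and V: "openin T V" "x \<in> V" "t \<in> carrier (rs_sec X V)" "t x = w"
      using that by (auto simp: germs_of_value_def)
    have UV: "openin T (U \<inter> V)" "x \<in> U \<inter> V"
      using U V by auto
    have r: "restrict s (U \<inter> V) \<in> carrier (rs_sec X (U \<inter> V))"
        "restrict t (U \<inter> V) \<in> carrier (rs_sec X (U \<inter> V))"
      using U V UV res_sec by auto
    show "germ X x (U \<inter> V) (rs_res X U (U \<inter> V) s \<otimes>\<^bsub>rs_sec X (U \<inter> V)\<^esub> rs_res X V (U \<inter> V) t)
      = germs_of_value x (v \<otimes>\<^bsub>L x\<^esub> w)"
      using UV U V sec_closed(1)[OF UV(1) r]
      by (simp add: res_eq sec_ops[OF UV(1)] germ_eq[OF UV])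
    show "germ X x (U \<inter> V) (rs_res X U (U \<inter> V) s \<oplus>\<^bsub>rs_sec X (U \<inter> V)\<^esub> rs_res X V (U \<inter> V) t)
      = germs_of_value x (v \<oplus>\<^bsub>L x\<^esub> w)"
      using UV U V sec_closed(2)[OF UV(1) r]
      by (simp add: res_eq sec_ops[OF UV(1)] germ_eq[OF UV])
  qed
  show "germs_of_value x (v \<otimes>\<^bsub>L x\<^esub> w) =
      germs_of_value x v \<otimes>\<^bsub>stalk X x\<^esub> germs_of_value x w"
    unfolding stalk_def monoid.simps
    by (rule sym, rule UN_germs[OF x v], rule UN_germs[OF x w], rule mult)
  show "germs_of_value x (v \<oplus>\<^bsub>L x\<^esub> w) =
      germs_of_value x v \<oplus>\<^bsub>stalk X x\<^esub> germs_of_value x w"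
    unfolding stalk_def ring.simps
    by (rule sym, rule UN_germs[OF x v], rule UN_germs[OF x w], rule add)
next
  show "germs_of_value x \<one>\<^bsub>L x\<^esub> = \<one>\<^bsub>stalk X x\<^esub>"
    using germ_eq[OF openin_topspace x] sec_closed_const(1)[OF openin_topspace] x
    by (simp add: stalk_def sec_ops)
next
  \<comment> \<open>The set of germs is nonempty, and each of its members takes the value v at x, so
    v can be read off from the set.\<close>
  have "inj_on (germs_of_value x) (carrier (L x))"
  proof (rule inj_onI)
    fix v w assume "v \<in> carrier (L x)" "germs_of_value x v = germs_of_value x w"
    then show "v = w"
      using germs_of_value_nonempty[OF x, of v] by (auto simp: germs_of_value_def)
  qed
  then show "bij_betw (germs_of_value x) (carrier (L x)) (carrier (stalk X x))"
    by (simp add: stalk_carrier[OF x] bij_betw_def)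
qed

text \<open>A ring isomorphism in the sense of \<open>ring_iso\<close> says nothing about zero:
  transport along \<open>stalk_iso\<close> yields a ring whose zero is replaced by the image of
  zero. This equation identifies that element with the zero of the stalk.\<close>

lemma stalk_zero:
  assumes "x \<in> topspace T"
  shows "germs_of_value x \<zero>\<^bsub>L x\<^esub> = \<zero>\<^bsub>stalk X x\<^esub>"
  using germ_eq[OF openin_topspace assms] sec_closed_const(2)[OF openin_topspace] assms
  by (simp add: stalk_def sec_ops)

lemma cring_stalk:
  assumes x: "x \<in> topspace T"
  shows "cring (stalk X x)"
  using cring.ring_iso_imp_img_cring[OF local_cring[OF x] stalk_iso[OF x]] stalk_zero[OF x] by simp

lemma nonunits_additive_stalk:
  assumes x: "x \<in> topspace T"
  shows "nonunits_additive (stalk X x)"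
proof -
  interpret ring "L x"
    using local_cring[OF x] by (rule cring.axioms(1))
  have h: "germs_of_value x \<in> ring_hom (L x) (stalk X x)"
    and k: "inv_into (carrier (L x)) (germs_of_value x) \<in> ring_hom (stalk X x) (L x)"
    using stalk_iso[OF x] ring_iso_set_sym[OF ring_axioms stalk_iso[OF x]] by (auto simp: ring_iso_def)
  show ?thesis
    using ring_iso_memE(5)[OF stalk_iso[OF x]]
    by (intro nonunits_additive_iso[OF local[OF x] cring_stalk[OF x] h k])
      (simp add: bij_betw_inv_into_right)
qed

lemma locally_ringed_space: "locally_ringed_space X"
  unfolding locally_ringed_space_def
  using ringed_space nonunits_additive_stalk nonunits_additive_imp_local by blast

text \<open>Charts and the punctured spectrum are open subspaces, so they have to fall under the
  same locale, with the same rings and the same local condition.\<close>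

lemma function_sheaf_open_subspace:
  assumes U: "openin T U"
  shows "function_sheaf (open_subspace X U) L F"
proof -
  have op: "openin (rs_top (open_subspace X U)) V \<longleftrightarrow> openin T V \<and> V \<subseteq> U" for V
    using U by (simp add: open_subspace_def openin_open_subtopology)
  have top: "topspace (rs_top (open_subspace X U)) = U"
    using openin_subset[OF U] by (auto simp: open_subspace_def)
  show ?thesis
  proof
    fix V assume V: "openin (rs_top (open_subspace X U)) V"
    \<comment> \<open>Sections of the subspace were defined with the topology of the whole space;
      within V, which lies in the open set U, both topologies offer the same neighbourhoods.\<close>
    have "(openin T W \<and> x \<in> W \<and> W \<subseteq> V \<and> F W s) = ((openin T W \<and> W \<subseteq> U) \<and> x \<in> W \<and> W \<subseteq> V \<and> F W s)" for W x s
      using V op by blast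
    then show "rs_sec (open_subspace X U) V = local_sections (rs_top (open_subspace X U)) L F V"
      using V op sec_eq[of V] by (simp add: local_sections_def) (simp add: open_subspace_def)
  next
    fix x v assume "x \<in> topspace (rs_top (open_subspace X U))" "v \<in> carrier (L x)"
    then obtain V s where V: "openin T V" "x \<in> V" "F V s" "s x = v" and "x \<in> U"
      using F_through[of x v] openin_subset[OF U] top by blast
    then show "\<exists>V s. openin (rs_top (open_subspace X U)) V \<and> x \<in> V \<and> F V s \<and> s x = v"
      unfolding op using F_mono[OF V(3), of "V \<inter> U"] U by (intro exI[of _ "V \<inter> U"] exI[of _ s]) auto
  next
    show "nonunits_additive (L x)" if "x \<in> topspace (rs_top (open_subspace X U))" for x
      using that top local openin_subset[OF U] by blast
  next
    fix V x s t assume "openin (rs_top (open_subspace X U)) V" "x \<in> V" "F V s" "F V t" "s x = t x"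
    then show "\<exists>W. openin (rs_top (open_subspace X U)) W \<and> x \<in> W \<and> W \<subseteq> V \<and> (\<forall>y\<in>W. s y = t y)"
      unfolding op using F_agree[of V x s t] by blast
  next
    show "rs_res (open_subspace X U) = (\<lambda>U V s. restrict s V)"
      by (simp add: open_subspace_def res_eq)
    fix V assume "openin (rs_top (open_subspace X U)) V"
    then have V: "openin T V"
      by (simp add: op)
    note F_zero[OF V] F_one[OF V]
    then show "F V (\<lambda>x. \<zero>\<^bsub>L x\<^esub>)" "F V (\<lambda>x. \<one>\<^bsub>L x\<^esub>)" .
    fix s assume s: "F V s"
    show "s x \<in> carrier (L x)" if "x \<in> V" for x
      using V s that by (rule F_carrier)
    show "F V (\<lambda>x. \<ominus>\<^bsub>L x\<^esub> s x)"
      using V s by (rule F_neg)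
    fix t assume t: "F V t"
    show "F V (\<lambda>x. s x \<oplus>\<^bsub>L x\<^esub> t x)"
      using V s t by (rule F_add)
    show "F V (\<lambda>x. s x \<otimes>\<^bsub>L x\<^esub> t x)"
      using V s t by (rule F_mult)
  qed (fact F_cong F_mono)+
qed

end

section \<open>Isomorphisms of function sheaves\<close>

abbreviation points where "points X \<equiv> topspace (rs_top X)"

text \<open>A morphism recorded by its effect on points and on the rings at the points. The maps
  \<theta> run backwards, from the ring at \<open>g x\<close> to the ring at x, and the last clause
  is what makes pulled back sections sections again; \<open>pullback_map\<close> then produces the
  maps on sections.\<close>

definition sheaf_pullback ::
    "('x, 'x \<Rightarrow> 'b) rspace \<Rightarrow> ('x \<Rightarrow> 'b ring) \<Rightarrow> ('x set \<Rightarrow> ('x \<Rightarrow> 'b) \<Rightarrow> bool) \<Rightarrow>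
     ('y, 'y \<Rightarrow> 'c) rspace \<Rightarrow> ('y \<Rightarrow> 'c ring) \<Rightarrow> ('y set \<Rightarrow> ('y \<Rightarrow> 'c) \<Rightarrow> bool) \<Rightarrow>
     ('x \<Rightarrow> 'y) \<Rightarrow> ('x \<Rightarrow> 'c \<Rightarrow> 'b) \<Rightarrow> bool" where
  "sheaf_pullback X L F Y L' F' g \<theta> \<longleftrightarrow>
     continuous_map (rs_top X) (rs_top Y) g \<and>
     (\<forall>x\<in>points X. \<theta> x \<in> ring_hom (L' (g x)) (L x)) \<and>
     (\<forall>V t x. openin (rs_top Y) V \<and> F' V t \<and> x \<in> points X \<and> g x \<in> V \<longrightarrow>
        (\<exists>W. openin (rs_top X) W \<and> x \<in> W \<and> g ` W \<subseteq> V \<and> F W (\<lambda>x. \<theta> x (t (g x)))))"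

lemma sheaf_pullback_point:
  "\<lbrakk>sheaf_pullback X L F Y L' F' g \<theta>; x \<in> points X\<rbrakk> \<Longrightarrow> g x \<in> points Y"
  unfolding sheaf_pullback_def continuous_map_def by blast

lemma sheaf_pullback_continuous:
  "sheaf_pullback X L F Y L' F' g \<theta> \<Longrightarrow> continuous_map (rs_top X) (rs_top Y) g"
  unfolding sheaf_pullback_def by blast

lemma sheaf_pullback_local:
  "\<lbrakk>sheaf_pullback X L F Y L' F' g \<theta>; openin (rs_top Y) V; F' V t; x \<in> points X; g x \<in> V\<rbrakk>
    \<Longrightarrow> \<exists>W. openin (rs_top X) W \<and> x \<in> W \<and> g ` W \<subseteq> V \<and> F W (\<lambda>x. \<theta> x (t (g x)))"
  unfolding sheaf_pullback_def by blast

lemma sheaf_pullback_hom: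
  "\<lbrakk>sheaf_pullback X L F Y L' F' g \<theta>; x \<in> points X\<rbrakk>
    \<Longrightarrow> \<theta> x \<in> ring_hom (L' (g x)) (L x)"
  unfolding sheaf_pullback_def by blast

definition pullback_map ::
    "('x, 'x \<Rightarrow> 'b) rspace \<Rightarrow> ('x \<Rightarrow> 'y) \<Rightarrow> ('x \<Rightarrow> 'c \<Rightarrow> 'b) \<Rightarrow> ('x, 'x \<Rightarrow> 'b, 'y, 'y \<Rightarrow> 'c) rs_map" where
  "pullback_map X g \<theta> =
     \<lparr>pt_map = g, sec_map = (\<lambda>V t. \<lambda>x\<in>g -` V \<inter> points X. \<theta> x (t (g x)))\<rparr>"

lemma pullback_map_simps:
  "pt_map (pullback_map X g \<theta>) = g"
  "sec_map (pullback_map X g \<theta>) V t = (\<lambda>x\<in>g -` V \<inter> points X. \<theta> x (t (g x)))"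
  "rs_preimage X (pullback_map X g \<theta>) V = g -` V \<inter> points X"
  by (simp_all add: pullback_map_def rs_preimage_def)

text \<open>The stalk map sends the germs of value v to the germs of value
  \<open>\<theta> x v\<close>, so the homomorphism laws come from \<theta>. Maximal ideals consist
  of the nonunits, hence locality of the stalk maps is the assumption that \<theta> reflects
  units.\<close>

lemma pullback_map_morphism:
  assumes X: "function_sheaf X L F" and Y: "function_sheaf Y L' F'"
    and pb: "sheaf_pullback X L F Y L' F' g \<theta>"
    and refl: "\<And>x v. \<lbrakk>x \<in> points X; v \<in> carrier (L' (g x)); \<theta> x v \<in> Units (L x)\<rbrakk>
      \<Longrightarrow> v \<in> Units (L' (g x))"
  shows "lrs_morphism X Y (pullback_map X g \<theta>)"
proof -
  interpret X: function_sheaf X L F by fact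
  interpret Y: function_sheaf Y L' F' by fact
  let ?pre = "\<lambda>V. g -` V \<inter> points X"
  let ?\<phi> = "pullback_map X g \<theta>"
  have cont: "continuous_map (rs_top X) (rs_top Y) g"
    and hom: "\<And>x. x \<in> points X \<Longrightarrow> \<theta> x \<in> ring_hom (L' (g x)) (L x)"
    and loc: "\<And>V t x. \<lbrakk>openin (rs_top Y) V; F' V t; x \<in> points X; g x \<in> V\<rbrakk> \<Longrightarrow>
      \<exists>W. openin (rs_top X) W \<and> x \<in> W \<and> g ` W \<subseteq> V \<and> F W (\<lambda>x. \<theta> x (t (g x)))"
    using pb unfolding sheaf_pullback_def by blast+
  have gY: "g x \<in> points Y" if "x \<in> points X" for x
    using cont that by (auto simp: continuous_map_def)
  have pre: "openin (rs_top X) (?pre V)" if "openin (rs_top Y) V" for V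
    using openin_continuous_map_preimage[OF cont that] by (simp add: Collect_conj_eq vimage_def Int_commute)
  have mem: "(\<lambda>x\<in>?pre V. \<theta> x (t (g x))) \<in> carrier (rs_sec X (?pre V))"
    if V: "openin (rs_top Y) V" and t: "t \<in> carrier (rs_sec Y V)" for V t
  proof (rule X.restrict_sec[OF pre[OF V]])
    fix x assume x: "x \<in> ?pre V"
    then obtain V' where V': "openin (rs_top Y) V'" "g x \<in> V'" "V' \<subseteq> V" "F' V' t"
      using t unfolding Y.sec_carrier[OF V] by blast
    then obtain W where W: "openin (rs_top X) W" "x \<in> W" "g ` W \<subseteq> V'" "F W (\<lambda>x. \<theta> x (t (g x)))"
      using loc[OF V'(1,4) _ V'(2)] x by blast
    then have "W \<subseteq> ?pre V"
      using openin_subset[OF W(1)] V'(3) by blast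
    with W show "\<exists>V'. openin (rs_top X) V' \<and> x \<in> V' \<and> V' \<subseteq> ?pre V \<and> F V' (\<lambda>x. \<theta> x (t (g x)))"
      by blast
  qed
  have sec_hom: "(\<lambda>t. \<lambda>x\<in>?pre V. \<theta> x (t (g x))) \<in> ring_hom (rs_sec Y V) (rs_sec X (?pre V))"
    if V: "openin (rs_top Y) V" for V
  proof (rule ring_hom_memI)
    fix s assume s: "s \<in> carrier (rs_sec Y V)"
    show "(\<lambda>x\<in>?pre V. \<theta> x (s (g x))) \<in> carrier (rs_sec X (?pre V))"
      using V s by (rule mem)
    fix t assume t: "t \<in> carrier (rs_sec Y V)"
    note v = Y.sec_value[OF V s] Y.sec_value[OF V t]
    show "(\<lambda>x\<in>?pre V. \<theta> x ((s \<otimes>\<^bsub>rs_sec Y V\<^esub> t) (g x))) =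
        (\<lambda>x\<in>?pre V. \<theta> x (s (g x))) \<otimes>\<^bsub>rs_sec X (?pre V)\<^esub> (\<lambda>x\<in>?pre V. \<theta> x (t (g x)))"
      unfolding X.sec_ops[OF pre[OF V]] Y.sec_ops[OF V]
      by (rule restrict_ext) (auto simp: v ring_hom_mult[OF hom])
    show "(\<lambda>x\<in>?pre V. \<theta> x ((s \<oplus>\<^bsub>rs_sec Y V\<^esub> t) (g x))) =
        (\<lambda>x\<in>?pre V. \<theta> x (s (g x))) \<oplus>\<^bsub>rs_sec X (?pre V)\<^esub> (\<lambda>x\<in>?pre V. \<theta> x (t (g x)))"
      unfolding X.sec_ops[OF pre[OF V]] Y.sec_ops[OF V]
      by (rule restrict_ext) (auto simp: v ring_hom_add[OF hom])
  next
    show "(\<lambda>x\<in>?pre V. \<theta> x (\<one>\<^bsub>rs_sec Y V\<^esub> (g x))) = \<one>\<^bsub>rs_sec X (?pre V)\<^esub>"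
      unfolding X.sec_ops[OF pre[OF V]] Y.sec_ops[OF V]
      by (rule restrict_ext) (auto simp: ring_hom_one[OF hom])
  qed
  have stalk: "stalk_map X ?\<phi> x (Y.germs_of_value (g x) v) = X.germs_of_value x (\<theta> x v)"
    if x: "x \<in> points X" and v: "v \<in> carrier (L' (g x))" for x v
    unfolding stalk_map_def
  proof (rule Y.UN_germs[OF gY[OF x] v])
    fix V t assume "(V, t) \<in> Y.germs_of_value (g x) v"
    then have V: "openin (rs_top Y) V" "g x \<in> V" "t \<in> carrier (rs_sec Y V)" "t (g x) = v"
      by (auto simp: Y.germs_of_value_def)
    show "germ X x (rs_preimage X ?\<phi> V) (sec_map ?\<phi> V t) = X.germs_of_value x (\<theta> x v)"
      using X.germ_eq[OF pre[OF V(1)] _ mem[OF V(1,3)], of x] x V(2,4)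
      by (simp add: pullback_map_simps)
  qed
  have stalk_carr: "\<exists>v\<in>carrier (L' (g x)). c = Y.germs_of_value (g x) v"
    if "x \<in> points X" "c \<in> carrier (stalk Y (g x))" for x c
    using that Y.stalk_carrier[OF gY[OF that(1)]] by auto
  have iX: "X.germs_of_value x \<in> ring_hom (L x) (stalk X x)" if "x \<in> points X" for x
    using X.stalk_iso[OF that] by (simp add: ring_iso_def)
  have iY: "Y.germs_of_value (g x) \<in> ring_hom (L' (g x)) (stalk Y (g x))"
    if "x \<in> points X" for x
    using Y.stalk_iso[OF gY[OF that]] by (simp add: ring_iso_def)
  have stalk_hom: "stalk_map X ?\<phi> x \<in> ring_hom (stalk Y (g x)) (stalk X x)"
    if x: "x \<in> points X" for x
  proof (rule ring_hom_memI)
    note LY = Y.local_cring[OF gY[OF x]]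
    note iX' = ring_hom_closed[OF iX[OF x]] ring_hom_mult[OF iX[OF x]] ring_hom_add[OF iX[OF x]]
      ring_hom_one[OF iX[OF x]]
    note h = ring_hom_closed[OF hom[OF x]] ring_hom_mult[OF hom[OF x]] ring_hom_add[OF hom[OF x]]
      ring_hom_one[OF hom[OF x]]
    fix c assume "c \<in> carrier (stalk Y (g x))"
    then obtain v where v: "v \<in> carrier (L' (g x))" "c = Y.germs_of_value (g x) v"
      using stalk_carr[OF x] by blast
    then show "stalk_map X ?\<phi> x c \<in> carrier (stalk X x)"
      by (simp add: stalk[OF x] iX' h)
    fix d assume "d \<in> carrier (stalk Y (g x))"
    then obtain w where w: "w \<in> carrier (L' (g x))" "d = Y.germs_of_value (g x) w"
      using stalk_carr[OF x] by blast
    show "stalk_map X ?\<phi> x (c \<otimes>\<^bsub>stalk Y (g x)\<^esub> d) =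
        stalk_map X ?\<phi> x c \<otimes>\<^bsub>stalk X x\<^esub> stalk_map X ?\<phi> x d"
      using v(1) w(1) unfolding v(2) w(2)
      by (simp add: stalk[OF x] iX' h cring.cring_simprules(5)[OF LY]
          flip: ring_hom_mult[OF iY[OF x]])
    show "stalk_map X ?\<phi> x (c \<oplus>\<^bsub>stalk Y (g x)\<^esub> d) =
        stalk_map X ?\<phi> x c \<oplus>\<^bsub>stalk X x\<^esub> stalk_map X ?\<phi> x d"
      using v(1) w(1) unfolding v(2) w(2)
      by (simp add: stalk[OF x] iX' h cring.cring_simprules(1)[OF LY]
          flip: ring_hom_add[OF iY[OF x]])
  next
    show "stalk_map X ?\<phi> x \<one>\<^bsub>stalk Y (g x)\<^esub> = \<one>\<^bsub>stalk X x\<^esub>"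
      using ring_hom_one[OF iX[OF x]] ring_hom_one[OF hom[OF x]]
        cring.cring_simprules(6)[OF Y.local_cring[OF gY[OF x]]]
      by (simp add: stalk[OF x] flip: ring_hom_one[OF iY[OF x]])
  qed
  have stalk_local: "stalk_map X ?\<phi> x ` max_ideal (stalk Y (g x)) \<subseteq> max_ideal (stalk X x)"
    if x: "x \<in> points X" for x
  proof
    fix d assume "d \<in> stalk_map X ?\<phi> x ` max_ideal (stalk Y (g x))"
    then obtain c where c: "c \<in> carrier (stalk Y (g x))" "c \<notin> Units (stalk Y (g x))"
      and d: "d = stalk_map X ?\<phi> x c"
      by (auto simp: nonunits_additive_imp_local(2)[OF Y.nonunits_additive_stalk[OF gY[OF x]]])
    obtain v where v: "v \<in> carrier (L' (g x))" "c = Y.germs_of_value (g x) v"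
      using stalk_carr[OF x c(1)] by blast
    have "d = X.germs_of_value x (\<theta> x v)"
      using d v by (simp add: stalk[OF x])
    moreover have v': "\<theta> x v \<in> carrier (L x)"
      using ring_hom_closed[OF hom[OF x] v(1)] .
    \<comment> \<open>Being a unit is carried from the stalk of X to \<open>L x\<close>, across
      \<theta> by \<open>refl\<close>, and on to the stalk of Y, where c is a nonunit.\<close>
    moreover have "X.germs_of_value x (\<theta> x v) \<notin> Units (stalk X x)"
    proof
      interpret LX: ring "L x"
        using X.local_cring[OF x] by (rule cring.axioms(1))
      have k: "inv_into (carrier (L x)) (X.germs_of_value x) \<in> ring_hom (stalk X x) (L x)"
        using ring_iso_set_sym[OF LX.ring_axioms X.stalk_iso[OF x]] by (simp add: ring_iso_def)
      assume "X.germs_of_value x (\<theta> x v) \<in> Units (stalk X x)"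
      from ring_hom_Units[OF k X.cring_stalk[OF x] X.local_cring[OF x] this]
      have "\<theta> x v \<in> Units (L x)"
        using ring_iso_memE(5)[OF X.stalk_iso[OF x]] v'
        by (simp add: bij_betw_inv_into_left)
      then have "v \<in> Units (L' (g x))"
        using refl[OF x v(1)] by blast
      then have "c \<in> Units (stalk Y (g x))"
        unfolding v(2) using ring_hom_Units[OF iY[OF x] Y.local_cring[OF gY[OF x]] Y.cring_stalk[OF gY[OF x]]]
        by blast
      then show False using c(2) by contradiction
    qed
    ultimately show "d \<in> max_ideal (stalk X x)"
      using ring_hom_closed[OF iX[OF x] v']
      by (simp add: nonunits_additive_imp_local(2)[OF X.nonunits_additive_stalk[OF x]])
  qed
  have sec: "sec_map ?\<phi> V = (\<lambda>t. \<lambda>x\<in>?pre V. \<theta> x (t (g x)))" for V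
    by (simp add: pullback_map_def)
  show ?thesis
    unfolding lrs_morphism_def local_ring_hom_def pullback_map_simps(1,3) sec
  proof (intro conjI allI impI ballI cont sec_hom stalk_hom stalk_local; (elim conjE)?)
    fix V W t assume "openin (rs_top Y) V" "openin (rs_top Y) W" and W: "W \<subseteq> V"
    then have "?pre V \<inter> ?pre W = ?pre W"
      by blast
    then show "(\<lambda>x\<in>?pre W. \<theta> x (rs_res Y V W t (g x))) =
        rs_res X (?pre V) (?pre W) (\<lambda>x\<in>?pre V. \<theta> x (t (g x)))"
      unfolding X.res_eq Y.res_eq restrict_restrict by (auto intro!: restrict_ext)
  qed
qed

text \<open>In contrast to \<open>lrs_isomorphic\<close> this relation is composed and reversed on
  points and rings alone, as the charts require. The map \<eta> is indexed by points of Y, so the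
  inverse of \<open>\<theta> x\<close> is \<open>\<eta> (g x)\<close>.\<close>

definition sheaf_iso ::
    "('x, 'x \<Rightarrow> 'b) rspace \<Rightarrow> ('x \<Rightarrow> 'b ring) \<Rightarrow> ('x set \<Rightarrow> ('x \<Rightarrow> 'b) \<Rightarrow> bool) \<Rightarrow>
     ('y, 'y \<Rightarrow> 'c) rspace \<Rightarrow> ('y \<Rightarrow> 'c ring) \<Rightarrow> ('y set \<Rightarrow> ('y \<Rightarrow> 'c) \<Rightarrow> bool) \<Rightarrow> bool" where
  "sheaf_iso X L F Y L' F' \<longleftrightarrow> (\<exists>g h \<theta> \<eta>.
     sheaf_pullback X L F Y L' F' g \<theta> \<and> sheaf_pullback Y L' F' X L F h \<eta> \<and>
     (\<forall>x\<in>points X. h (g x) = x) \<and>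
     (\<forall>y\<in>points Y. g (h y) = y) \<and>
     (\<forall>x\<in>points X. \<forall>v\<in>carrier (L' (g x)). \<eta> (g x) (\<theta> x v) = v) \<and>
     (\<forall>x\<in>points X. \<forall>v\<in>carrier (L x). \<theta> x (\<eta> (g x) v) = v))"

text \<open>Each \<open>\<theta> x\<close> has an inverse homomorphism and therefore reflects units,
  and so does each \<eta>; this makes both pullbacks morphisms of locally ringed spaces.\<close>

lemma sheaf_iso_imp_lrs_isomorphic:
  assumes X: "function_sheaf X L F" and Y: "function_sheaf Y L' F'"
    and "sheaf_iso X L F Y L' F'"
  shows "lrs_isomorphic X Y"
proof -
  interpret X: function_sheaf X L F by fact
  interpret Y: function_sheaf Y L' F' by fact
  obtain g h \<theta> \<eta> where g: "sheaf_pullback X L F Y L' F' g \<theta>"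
    and h: "sheaf_pullback Y L' F' X L F h \<eta>"
    and hg: "\<And>x. x \<in> points X \<Longrightarrow> h (g x) = x"
    and gh: "\<And>y. y \<in> points Y \<Longrightarrow> g (h y) = y"
    and \<eta>\<theta>: "\<And>x v. \<lbrakk>x \<in> points X; v \<in> carrier (L' (g x))\<rbrakk> \<Longrightarrow> \<eta> (g x) (\<theta> x v) = v"
    and \<theta>\<eta>: "\<And>x v. \<lbrakk>x \<in> points X; v \<in> carrier (L x)\<rbrakk> \<Longrightarrow> \<theta> x (\<eta> (g x) v) = v"
    using assms(3) unfolding sheaf_iso_def by blast
  have gX: "g x \<in> points Y" if "x \<in> points X" for x
    using g that by (rule sheaf_pullback_point)
  have hY: "h y \<in> points X" if "y \<in> points Y" for y
    using h that by (rule sheaf_pullback_point)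
  have hom\<theta>: "\<theta> x \<in> ring_hom (L' (g x)) (L x)" if "x \<in> points X" for x
    using g that by (rule sheaf_pullback_hom)
  have hom\<eta>: "\<eta> (g x) \<in> ring_hom (L x) (L' (g x))" if "x \<in> points X" for x
    using sheaf_pullback_hom[OF h gX[OF that]] hg[OF that] by simp
  note cr = X.local_cring Y.local_cring[OF gX]
  have M1: "lrs_morphism X Y (pullback_map X g \<theta>)"
  proof (rule pullback_map_morphism[OF X Y g])
    fix x v assume x: "x \<in> points X" "v \<in> carrier (L' (g x))" "\<theta> x v \<in> Units (L x)"
    show "v \<in> Units (L' (g x))"
      using ring_hom_Units[OF hom\<eta> cr x(3)] \<eta>\<theta> x by simp
  qed
  have M2: "lrs_morphism Y X (pullback_map Y h \<eta>)"
  proof (rule pullback_map_morphism[OF Y X h])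
    fix y v assume y: "y \<in> points Y" "v \<in> carrier (L (h y))" "\<eta> y v \<in> Units (L' y)"
    \<comment> \<open>The inverse laws are stated at points of X, so y is rewritten as
      \<open>g x\<close>.\<close>
    define x where "x = h y"
    have x: "x \<in> points X" "y = g x" "v \<in> carrier (L x)"
      using y hY gh by (simp_all add: x_def)
    have "\<theta> x (\<eta> (g x) v) \<in> Units (L x)"
      by (rule ring_hom_Units[OF hom\<theta>[OF x(1)] cr(2,1)[OF x(1)]]) (use y(3) x in simp)
    then show "v \<in> Units (L (h y))"
      using \<theta>\<eta>[OF x(1,3)] by (simp add: x_def)
  qed
  show ?thesis
    unfolding lrs_isomorphic_def
  proof (rule exI[of _ "pullback_map X g \<theta>"], rule exI[of _ "pullback_map Y h \<eta>"],
      unfold pullback_map_simps, intro conjI M1 M2 ballI allI impI)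
    fix U s assume U: "openin (rs_top X) U" and s: "s \<in> carrier (rs_sec X U)"
    have "g -` (h -` U \<inter> points Y) \<inter> points X = U"
      using openin_subset[OF U] gX hg by auto
    moreover have "(\<lambda>x\<in>U. \<theta> x ((\<lambda>y\<in>h -` U \<inter> points Y. \<eta> y (s (h y))) (g x))) = s"
    proof (rule extensionalityI[of _ U])
      show "s \<in> extensional U"
        using s by (simp add: X.sec_carrier[OF U])
      fix x assume x: "x \<in> U"
      then have "x \<in> points X"
        using openin_subset[OF U] by blast
      then show "(\<lambda>x\<in>U. \<theta> x ((\<lambda>y\<in>h -` U \<inter> points Y. \<eta> y (s (h y))) (g x))) x = s x"
        using x gX hg \<theta>\<eta> X.sec_value[OF U s x] by simp
    qed simp
    ultimately show "(\<lambda>x\<in>g -` (h -` U \<inter> points Y) \<inter> points X.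
        \<theta> x ((\<lambda>y\<in>h -` U \<inter> points Y. \<eta> y (s (h y))) (g x))) = s"
      by simp
  next
    fix V t assume V: "openin (rs_top Y) V" and t: "t \<in> carrier (rs_sec Y V)"
    have "h -` (g -` V \<inter> points X) \<inter> points Y = V"
      using openin_subset[OF V] hY gh by auto
    moreover have "(\<lambda>y\<in>V. \<eta> y ((\<lambda>x\<in>g -` V \<inter> points X. \<theta> x (t (g x))) (h y))) = t"
    proof (rule extensionalityI[of _ V])
      show "t \<in> extensional V"
        using t by (simp add: Y.sec_carrier[OF V])
      fix y assume y: "y \<in> V"
      then have yY: "y \<in> points Y"
        using openin_subset[OF V] by blast
      have "\<eta> (g (h y)) (\<theta> (h y) (t y)) = t y"
        by (rule \<eta>\<theta>[OF hY[OF yY]]) (use Y.sec_value[OF V t y] gh[OF yY] in simp)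
      then show "(\<lambda>y\<in>V. \<eta> y ((\<lambda>x\<in>g -` V \<inter> points X. \<theta> x (t (g x))) (h y))) y = t y"
        using y yY hY gh by simp
    qed simp
    ultimately show "(\<lambda>y\<in>h -` (g -` V \<inter> points X) \<inter> points Y.
        \<eta> y ((\<lambda>x\<in>g -` V \<inter> points X. \<theta> x (t (g x))) (h y))) = t"
      by simp
  qed (use hg gh in auto)
qed

section \<open>Reversing and composing isomorphisms of function sheaves\<close>

lemma sheaf_iso_sym:
  assumes "sheaf_iso X L F Y L' F'"
  shows "sheaf_iso Y L' F' X L F"
proof -
  obtain g h \<theta> \<eta> where g: "sheaf_pullback X L F Y L' F' g \<theta>"
    and h: "sheaf_pullback Y L' F' X L F h \<eta>"
    and hg: "\<And>x. x \<in> points X \<Longrightarrow> h (g x) = x"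
    and gh: "\<And>y. y \<in> points Y \<Longrightarrow> g (h y) = y"
    and \<eta>\<theta>: "\<And>x v. \<lbrakk>x \<in> points X; v \<in> carrier (L' (g x))\<rbrakk> \<Longrightarrow> \<eta> (g x) (\<theta> x v) = v"
    and \<theta>\<eta>: "\<And>x v. \<lbrakk>x \<in> points X; v \<in> carrier (L x)\<rbrakk> \<Longrightarrow> \<theta> x (\<eta> (g x) v) = v"
    using assms unfolding sheaf_iso_def by blast
  have hY: "h y \<in> points X" if "y \<in> points Y" for y
    using h that by (rule sheaf_pullback_point)
  have "\<theta> (h y) (\<eta> y v) = v" if "y \<in> points Y" "v \<in> carrier (L (h y))" for y v
    using \<theta>\<eta>[OF hY that(2)] that gh by simp
  moreover have "\<eta> y (\<theta> (h y) v) = v" if "y \<in> points Y" "v \<in> carrier (L' y)" for y v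
    using \<eta>\<theta>[OF hY, of y v] that gh by simp
  ultimately show ?thesis
    unfolding sheaf_iso_def using g h hg gh by blast
qed

lemma sheaf_pullback_comp:
  assumes Y: "function_sheaf Y L' F'"
    and 1: "sheaf_pullback X L F Y L' F' g \<theta>" and 2: "sheaf_pullback Y L' F' Z L'' F'' g' \<theta>'"
  shows "sheaf_pullback X L F Z L'' F'' (g' \<circ> g) (\<lambda>x. \<theta> x \<circ> \<theta>' (g x))"
  unfolding sheaf_pullback_def
proof (intro conjI ballI allI impI; (elim conjE)?)
  have gX: "g x \<in> points Y" if "x \<in> points X" for x
    using assms(2) that by (rule sheaf_pullback_point)
  show "continuous_map (rs_top X) (rs_top Z) (g' \<circ> g)"
    using 1 2 by (intro continuous_map_compose[of _ "rs_top Y"] sheaf_pullback_continuous)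
  fix x assume x: "x \<in> points X"
  show "\<theta> x \<circ> \<theta>' (g x) \<in> ring_hom (L'' ((g' \<circ> g) x)) (L x)"
    using ring_hom_trans[OF sheaf_pullback_hom[OF 2 gX[OF x]] sheaf_pullback_hom[OF 1 x]] by simp
  fix V t assume V: "openin (rs_top Z) V" "F'' V t" "(g' \<circ> g) x \<in> V"
  then obtain W where W: "openin (rs_top Y) W" "g x \<in> W" "g' ` W \<subseteq> V" "F' W (\<lambda>y. \<theta>' y (t (g' y)))"
    using sheaf_pullback_local[OF 2 V(1,2) gX[OF x]] by auto
  then obtain U where "openin (rs_top X) U" "x \<in> U" "g ` U \<subseteq> W"
      "F U (\<lambda>x. \<theta> x (\<theta>' (g x) (t (g' (g x)))))"
    using sheaf_pullback_local[OF 1 W(1,4) x W(2)] by auto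
  then show "\<exists>W. openin (rs_top X) W \<and> x \<in> W \<and> (g' \<circ> g) ` W \<subseteq> V \<and>
      F W (\<lambda>x. (\<theta> x \<circ> \<theta>' (g x)) (t ((g' \<circ> g) x)))"
    using W(3) by (intro exI[of _ U]) (auto simp: o_def)
qed

lemma sheaf_iso_trans:
  assumes X: "function_sheaf X L F" and Y: "function_sheaf Y L' F'" and Z: "function_sheaf Z L'' F''"
    and XY: "sheaf_iso X L F Y L' F'" and YZ: "sheaf_iso Y L' F' Z L'' F''"
  shows "sheaf_iso X L F Z L'' F''"
proof -
  obtain g h \<theta> \<eta> where g: "sheaf_pullback X L F Y L' F' g \<theta>"
    and h: "sheaf_pullback Y L' F' X L F h \<eta>"
    and i: "\<And>x. x \<in> points X \<Longrightarrow> h (g x) = x"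
     "\<And>y. y \<in> points Y \<Longrightarrow> g (h y) = y"
     "\<And>x v. \<lbrakk>x \<in> points X; v \<in> carrier (L' (g x))\<rbrakk> \<Longrightarrow> \<eta> (g x) (\<theta> x v) = v"
     "\<And>x v. \<lbrakk>x \<in> points X; v \<in> carrier (L x)\<rbrakk> \<Longrightarrow> \<theta> x (\<eta> (g x) v) = v"
    using XY unfolding sheaf_iso_def by blast
  obtain g' h' \<theta>' \<eta>' where g': "sheaf_pullback Y L' F' Z L'' F'' g' \<theta>'"
    and h': "sheaf_pullback Z L'' F'' Y L' F' h' \<eta>'"
    and i': "\<And>x. x \<in> points Y \<Longrightarrow> h' (g' x) = x"
     "\<And>y. y \<in> points Z \<Longrightarrow> g' (h' y) = y"
     "\<And>x v. \<lbrakk>x \<in> points Y; v \<in> carrier (L'' (g' x))\<rbrakk> \<Longrightarrow> \<eta>' (g' x) (\<theta>' x v) = v"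
     "\<And>x v. \<lbrakk>x \<in> points Y; v \<in> carrier (L' x)\<rbrakk> \<Longrightarrow> \<theta>' x (\<eta>' (g' x) v) = v"
    using YZ unfolding sheaf_iso_def by blast
  have gX: "g x \<in> points Y" if "x \<in> points X" for x
    using g that by (rule sheaf_pullback_point)
  have hZ: "h' z \<in> points Y" if "z \<in> points Z" for z
    using h' that by (rule sheaf_pullback_point)
  have \<theta>': "\<theta>' (g x) v \<in> carrier (L' (g x))"
    if "x \<in> points X" "v \<in> carrier (L'' (g' (g x)))" for x v
    using sheaf_pullback_hom[OF g' gX[OF that(1)]] that(2) by (rule ring_hom_closed)
  have \<eta>: "\<eta> (g x) v \<in> carrier (L' (g x))" if "x \<in> points X" "v \<in> carrier (L x)" for x v
    using sheaf_pullback_hom[OF h gX[OF that(1)]] that(2) i(1)[OF that(1)]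
    by (simp add: ring_hom_closed)
  have 1: "(h \<circ> h') ((g' \<circ> g) x) = x" if "x \<in> points X" for x
    using that gX i(1) i'(1) by simp
  have 2: "(g' \<circ> g) ((h \<circ> h') z) = z" if "z \<in> points Z" for z
    using that hZ i(2) i'(2) by simp
  have 3: "(\<eta>' ((g' \<circ> g) x) \<circ> \<eta> (h' ((g' \<circ> g) x))) ((\<theta> x \<circ> \<theta>' (g x)) v) = v"
    if "x \<in> points X" "v \<in> carrier (L'' ((g' \<circ> g) x))" for x v
    using that gX i i' \<theta>' by simp
  have 4: "(\<theta> x \<circ> \<theta>' (g x)) ((\<eta>' ((g' \<circ> g) x) \<circ> \<eta> (h' ((g' \<circ> g) x))) v) = v"
    if "x \<in> points X" "v \<in> carrier (L x)" for x v
    using that gX i i' \<eta> by simp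
  show ?thesis
    unfolding sheaf_iso_def
    using sheaf_pullback_comp[OF Y g g'] sheaf_pullback_comp[OF Y h' h] 1 2 3 4 by blast
qed

section \<open>Homogeneous localizations\<close>

locale graded_cring = cring A for A :: "('a, 'm) ring_scheme" (structure) +
  fixes G :: "nat \<Rightarrow> 'a set"
  assumes piece_sub: "G n \<subseteq> carrier A"
    and piece_zero: "\<zero> \<in> G n"
    and piece_one: "\<one> \<in> G 0"
    and piece_neg: "a \<in> G n \<Longrightarrow> \<ominus> a \<in> G n"
    and piece_add: "\<lbrakk>a \<in> G n; b \<in> G n\<rbrakk> \<Longrightarrow> a \<oplus> b \<in> G n"
    and piece_mult: "\<lbrakk>a \<in> G m; b \<in> G n\<rbrakk> \<Longrightarrow> a \<otimes> b \<in> G (m + n)"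
begin

lemma piece_carrier [simp]: "a \<in> G n \<Longrightarrow> a \<in> carrier A"
  using piece_sub by blast

abbreviation outside where "outside P \<equiv> homogeneous_outside G P"
abbreviation hfrac where "hfrac P a f \<equiv> fraction A (outside P) a f"
abbreviation L where "L P \<equiv> homogeneous_localization A G P"

lemma mem_outside: "\<lbrakk>f \<in> G n; f \<notin> P\<rbrakk> \<Longrightarrow> f \<in> outside P"
  by (auto simp: homogeneous_outside_def)

lemma outsideD: "u \<in> outside P \<Longrightarrow> u \<notin> P \<and> (\<exists>n. u \<in> G n)"
  by (auto simp: homogeneous_outside_def)

lemma one_notin_prime: "primeideal P A \<Longrightarrow> \<one> \<notin> P"
  using ideal.one_imp_carrier primeideal.I_notcarr primeideal.axioms(1) by metis

lemma mult_notin_prime: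
  assumes "primeideal P A" "a \<in> carrier A" "b \<in> carrier A" "a \<notin> P" "b \<notin> P"
  shows "a \<otimes> b \<notin> P"
  using assms primeideal.I_prime by metis

lemma mult_system_outside:
  assumes P: "primeideal P A"
  shows "mult_system A (outside P)"
proof
  show "outside P \<subseteq> carrier A"
    using piece_sub by (auto simp: homogeneous_outside_def)
  show "\<one> \<in> outside P"
    using one_notin_prime[OF P] piece_one mem_outside by blast
  fix s t assume "s \<in> outside P" "t \<in> outside P"
  then obtain m n where "s \<in> G m" "t \<in> G n" "s \<notin> P" "t \<notin> P"
    using outsideD by blast
  then show "s \<otimes> t \<in> outside P"
    using mult_notin_prime[OF P, of s t] by (intro mem_outside[of _ "m + n"] piece_mult) auto
qed

lemma hfrac_eq_iff:
  assumes P: "primeideal P A" and "a \<in> carrier A" "b \<in> carrier A"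
    and "f \<in> G m" "f \<notin> P" "g \<in> G n" "g \<notin> P"
  shows "hfrac P a f = hfrac P b g \<longleftrightarrow> (\<exists>u\<in>outside P. u \<otimes> (g \<otimes> a) = u \<otimes> (f \<otimes> b))"
  using mult_system.fraction_eq_iff[OF mult_system_outside[OF P]] assms mem_outside by simp

lemma hfrac_eqI:
  assumes P: "primeideal P A" and "a \<in> carrier A" "b \<in> carrier A"
    and "f \<in> G m" "f \<notin> P" "g \<in> G n" "g \<notin> P" and "g \<otimes> a = f \<otimes> b"
  shows "hfrac P a f = hfrac P b g"
  using mult_system.fraction_eqI[OF mult_system_outside[OF P]] assms mem_outside by simp

lemma L_carrier: "x \<in> carrier (L P) \<longleftrightarrow> (\<exists>n. \<exists>a\<in>G n. \<exists>f\<in>G n. f \<notin> P \<and> x = hfrac P a f)"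
  unfolding homogeneous_localization_def by auto

lemma hfrac_in_L: "\<lbrakk>a \<in> G n; f \<in> G n; f \<notin> P\<rbrakk> \<Longrightarrow> hfrac P a f \<in> carrier (L P)"
  unfolding L_carrier by blast

lemma L_mult:
  assumes P: "primeideal P A" and "a \<in> carrier A" "b \<in> carrier A"
    and "f \<in> G m" "f \<notin> P" "g \<in> G n" "g \<notin> P"
  shows "hfrac P a f \<otimes>\<^bsub>L P\<^esub> hfrac P b g = hfrac P (a \<otimes> b) (f \<otimes> g)"
  using mult_system.localization_mult[OF mult_system_outside[OF P]] assms mem_outside
  by (simp add: homogeneous_localization_def)

lemma L_add:
  assumes P: "primeideal P A" and "a \<in> carrier A" "b \<in> carrier A"
    and "f \<in> G m" "f \<notin> P" "g \<in> G n" "g \<notin> P"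
  shows "hfrac P a f \<oplus>\<^bsub>L P\<^esub> hfrac P b g = hfrac P (g \<otimes> a \<oplus> f \<otimes> b) (f \<otimes> g)"
  using mult_system.localization_add[OF mult_system_outside[OF P]] assms mem_outside
  by (simp add: homogeneous_localization_def)

lemma L_one: "primeideal P A \<Longrightarrow> \<one>\<^bsub>L P\<^esub> = hfrac P \<one> \<one>"
  and L_zero: "primeideal P A \<Longrightarrow> \<zero>\<^bsub>L P\<^esub> = hfrac P \<zero> \<one>"
  by (simp_all add: homogeneous_localization_def mult_system.localization_one
      mult_system.localization_zero mult_system_outside)

lemma numerator_add: "\<lbrakk>a \<in> G m; f \<in> G m; b \<in> G n; g \<in> G n\<rbrakk> \<Longrightarrow> g \<otimes> a \<oplus> f \<otimes> b \<in> G (m + n)"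
  using piece_add piece_mult by (metis add.commute)

text \<open>The ring \<open>L P\<close> restricts the carrier of a full localization, so it suffices
  to find a subring: for a/f and b/g of degree zero, the numerator g a + f b has the degree of the
  denominator f g.\<close>

lemma cring_L:
  assumes P: "primeideal P A"
  shows "cring (L P)"
proof -
  interpret S: mult_system A "outside P"
    using mult_system_outside[OF P] .
  interpret Loc: cring "localization A (outside P)"
    by (rule S.cring_localization)
  have "subring (carrier (L P)) (localization A (outside P))"
  proof (rule Loc.subringI)
    show "carrier (L P) \<subseteq> carrier (localization A (outside P))"
    proof
      fix x assume "x \<in> carrier (L P)"
      then obtain n a f where "a \<in> G n" "f \<in> outside P" "x = hfrac P a f"
        unfolding L_carrier using mem_outside by blast
      then show "x \<in> carrier (localization A (outside P))"
        by (simp add: S.fraction_in_localization)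
    qed
    show "\<one>\<^bsub>localization A (outside P)\<^esub> \<in> carrier (L P)"
      unfolding S.localization_one using hfrac_in_L piece_one one_notin_prime[OF P] by blast
  next
    fix x y assume "x \<in> carrier (L P)" "y \<in> carrier (L P)"
    then obtain m a f n b g where x: "x = hfrac P a f" "a \<in> G m" "f \<in> G m" "f \<notin> P"
      and y: "y = hfrac P b g" "b \<in> G n" "g \<in> G n" "g \<notin> P"
      unfolding L_carrier by blast
    have m: "f \<in> outside P" "g \<in> outside P"
      using x y mem_outside by blast+
    have fg: "f \<otimes> g \<in> G (m + n)" "f \<otimes> g \<notin> P"
      using piece_mult x y mult_notin_prime[OF P] by simp_all
    show "x \<otimes>\<^bsub>localization A (outside P)\<^esub> y \<in> carrier (L P)"
      using x y m fg piece_mult[OF x(2) y(2)] by (simp add: S.localization_mult hfrac_in_L[of _ "m + n"])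
    show "x \<oplus>\<^bsub>localization A (outside P)\<^esub> y \<in> carrier (L P)"
      using x y m fg numerator_add[OF x(2,3) y(2,3)]
      by (simp add: S.localization_add hfrac_in_L[of _ "m + n"])
    have "\<ominus>\<^bsub>localization A (outside P)\<^esub> x = hfrac P (\<ominus> a) f"
      using S.localization_neg[of a f] x m S.fraction_in_localization
      by (intro Loc.minus_equality) auto
    then show "\<ominus>\<^bsub>localization A (outside P)\<^esub> x \<in> carrier (L P)"
      using hfrac_in_L[OF piece_neg[OF x(2)] x(3,4)] by simp
  qed
  then have "subcring (carrier (L P)) (localization A (outside P))"
    by (rule Loc.subcringI')
  moreover have "L P = localization A (outside P)\<lparr>carrier := carrier (L P)\<rparr>"
    by (simp add: homogeneous_localization_def)
  ultimately show ?thesis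
    using Loc.subcring_iff[of "carrier (L P)"] subcringE(1) by metis
qed

lemma L_neg:
  assumes P: "primeideal P A" and a: "a \<in> G n" "f \<in> G n" "f \<notin> P"
  shows "\<ominus>\<^bsub>L P\<^esub> hfrac P a f = hfrac P (\<ominus> a) f"
proof -
  interpret L: cring "L P"
    using P by (rule cring_L)
  have "hfrac P (\<ominus> a) f \<oplus>\<^bsub>L P\<^esub> hfrac P a f = \<zero>\<^bsub>L P\<^esub>"
    using mult_system.localization_neg[OF mult_system_outside[OF P], of a f] a mem_outside
    by (simp add: homogeneous_localization_def)
  then show ?thesis
    using hfrac_in_L[OF a] hfrac_in_L[OF piece_neg[OF a(1)] a(2,3)] by (intro L.minus_equality)
qed

text \<open>If a is outside P, then f/a is again a fraction of degree zero and inverts a/f.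
  Conversely, an inverse b/g gives u a b = u f g for some u outside P; the right-hand side is
  outside P, so a is too.\<close>

lemma hfrac_Units:
  assumes P: "primeideal P A" and a: "a \<in> G n" "f \<in> G n" "f \<notin> P"
  shows "hfrac P a f \<in> Units (L P) \<longleftrightarrow> a \<notin> P"
proof
  interpret L: cring "L P"
    using P by (rule cring_L)
  note one = one_notin_prime[OF P]
  show "hfrac P a f \<in> Units (L P)" if "a \<notin> P"
  proof -
    have "hfrac P a f \<otimes>\<^bsub>L P\<^esub> hfrac P f a = \<one>\<^bsub>L P\<^esub>"
      unfolding L_mult[OF P piece_carrier[OF a(1)] piece_carrier[OF a(2)] a(2,3,1) that] L_one[OF P]
      using a that piece_mult[OF a(2,1)] piece_one one mult_notin_prime[OF P]
      by (intro hfrac_eqI[OF P]) (auto simp: m_comm)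
    moreover have "hfrac P a f \<in> carrier (L P)" "hfrac P f a \<in> carrier (L P)"
      using hfrac_in_L a that by blast+
    ultimately show ?thesis
      using L.m_comm[of "hfrac P a f" "hfrac P f a"] by (auto simp: Units_def)
  qed
  assume "hfrac P a f \<in> Units (L P)"
  then obtain y where "y \<in> carrier (L P)" "hfrac P a f \<otimes>\<^bsub>L P\<^esub> y = \<one>\<^bsub>L P\<^esub>"
    unfolding Units_def by blast
  then obtain m b g where y: "b \<in> G m" "g \<in> G m" "g \<notin> P"
      and eq: "hfrac P a f \<otimes>\<^bsub>L P\<^esub> hfrac P b g = \<one>\<^bsub>L P\<^esub>"
    unfolding L_carrier by blast
  have fg: "f \<otimes> g \<in> G (n + m)" "f \<otimes> g \<notin> P"
    using piece_mult a y mult_notin_prime[OF P] by simp_all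
  have "hfrac P (a \<otimes> b) (f \<otimes> g) = hfrac P \<one> \<one>"
    using eq a y by (simp add: L_mult[OF P] L_one[OF P])
  then obtain u where u: "u \<in> outside P" "u \<otimes> (\<one> \<otimes> (a \<otimes> b)) = u \<otimes> (f \<otimes> g \<otimes> \<one>)"
    using hfrac_eq_iff[OF P _ _ fg piece_one one] a y by auto
  obtain k where u': "u \<notin> P" "u \<in> G k"
    using outsideD[OF u(1)] by blast
  show "a \<notin> P"
  proof
    assume "a \<in> P"
    then have "u \<otimes> (\<one> \<otimes> (a \<otimes> b)) \<in> P"
      using a y u' ideal.I_l_closed[OF primeideal.axioms(1)[OF P], of "a \<otimes> b" u]
        ideal.I_r_closed[OF primeideal.axioms(1)[OF P], of a b] by simp
    then show False
      unfolding u(2) using mult_notin_prime[OF P _ _ u'(1) fg(2)] u' a y by simp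
  qed
qed

text \<open>By \<open>hfrac_Units\<close> the nonunits are the fractions with numerator in P, and
  the numerator g a + f b of a sum of two of them stays in P.\<close>

lemma nonunits_additive_L:
  assumes P: "primeideal P A"
  shows "nonunits_additive (L P)"
  unfolding nonunits_additive_def
proof (intro conjI ballI cring_L P)
  note one = one_notin_prime[OF P]
  interpret P: primeideal P A by fact
  interpret L: cring "L P"
    using P by (rule cring_L)
  have "\<zero>\<^bsub>L P\<^esub> \<notin> Units (L P)"
    using hfrac_Units[OF P piece_zero piece_one one] P.zero_closed by (simp add: L_zero[OF P])
  then show "\<one>\<^bsub>L P\<^esub> \<noteq> \<zero>\<^bsub>L P\<^esub>"
    using L.Units_one_closed by metis
  fix x y assume x: "x \<in> carrier (L P) - Units (L P)" and y: "y \<in> carrier (L P) - Units (L P)"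
  then obtain m a f n b g where x': "x = hfrac P a f" "a \<in> G m" "f \<in> G m" "f \<notin> P"
    and y': "y = hfrac P b g" "b \<in> G n" "g \<in> G n" "g \<notin> P"
    unfolding Diff_iff L_carrier by blast
  have "a \<in> P" "b \<in> P"
    using x y x' y' hfrac_Units[OF P] by auto
  then have "g \<otimes> a \<oplus> f \<otimes> b \<in> P"
    using x' y' by (intro P.a_closed P.I_l_closed) auto
  moreover have "f \<otimes> g \<in> G (m + n)" "f \<otimes> g \<notin> P"
    using piece_mult x' y' mult_notin_prime[OF P] by simp_all
  ultimately show "x \<oplus>\<^bsub>L P\<^esub> y \<notin> Units (L P)"
    using x' y' numerator_add[OF x'(2,3) y'(2,3)] by (simp add: L_add[OF P] hfrac_Units[OF P])
qed

section \<open>The structure sheaves\<close>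

lemma openin_zariski:
  "openin (zariski A) U \<longleftrightarrow> (\<exists>J. ideal J A \<and> U = {P. primeideal P A \<and> \<not> J \<subseteq> P})"
  unfolding zariski_def using topology_inverse'[OF istopology_zariski[OF ring_axioms]] by simp

lemma proj_points_prime: "P \<in> proj_points A G \<Longrightarrow> primeideal P A"
  by (simp add: proj_points_def)

lemma openin_Proj:
  "openin (rs_top (Proj A G)) U \<longleftrightarrow> (\<exists>J. ideal J A \<and> U = {P \<in> proj_points A G. \<not> J \<subseteq> P})"
proof -
  have "{P. primeideal P A \<and> \<not> J \<subseteq> P} \<inter> proj_points A G = {P \<in> proj_points A G. \<not> J \<subseteq> P}" for J
    using proj_points_prime by blast
  then show ?thesis
    unfolding Proj_def function_space_def rspace.simps openin_subtopology openin_zariski by auto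
qed

lemma Idl_singleton_subset: "\<lbrakk>ideal P A; u \<in> carrier A\<rbrakk> \<Longrightarrow> Idl {u} \<subseteq> P \<longleftrightarrow> u \<in> P"
  using genideal_self[of "{u}"] genideal_minimal[of P "{u}"] by auto

lemma openin_Proj_basic:
  assumes "u \<in> carrier A"
  shows "openin (rs_top (Proj A G)) {P \<in> proj_points A G. u \<notin> P}"
proof -
  have "{P \<in> proj_points A G. u \<notin> P} = {P \<in> proj_points A G. \<not> Idl {u} \<subseteq> P}"
    using Idl_singleton_subset[OF primeideal.axioms(1)[OF proj_points_prime]] assms by blast
  then show ?thesis
    unfolding openin_Proj using genideal_ideal[of "{u}"] assms by blast
qed

lemma topspace_Proj: "topspace (rs_top (Proj A G)) = proj_points A G"
proof
  have "{P \<in> proj_points A G. \<one> \<notin> P} = proj_points A G"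
    using proj_points_prime one_notin_prime by blast
  then show "proj_points A G \<subseteq> topspace (rs_top (Proj A G))"
    using openin_subset[OF openin_Proj_basic[OF one_closed]] by simp
  show "topspace (rs_top (Proj A G)) \<subseteq> proj_points A G"
    using openin_topspace[of "rs_top (Proj A G)"] unfolding openin_Proj by blast
qed

definition is_fraction where
  "is_fraction V s \<longleftrightarrow> (\<exists>n. \<exists>a\<in>G n. \<exists>f\<in>G n. \<forall>Q\<in>V. f \<notin> Q \<and> s Q = hfrac Q a f)"

text \<open>The axiom that needs a geometric argument is \<open>F_agree\<close>: an equality a/f =
  b/g at P is witnessed by a homogeneous u outside P, and the same u proves it at every point of the
  neighbourhood that does not contain u.\<close>

lemma function_sheaf_Proj: "function_sheaf (Proj A G) L is_fraction"
proof
  have Proj: "Proj A G = function_space (rs_top (Proj A G)) L is_fraction"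
    unfolding Proj_def is_fraction_def function_space_def by simp
  show "rs_res (Proj A G) = (\<lambda>U V s. restrict s V)"
    by (simp add: Proj_def function_space_def)
  show "rs_sec (Proj A G) U = local_sections (rs_top (Proj A G)) L is_fraction U" for U
    by (subst Proj) (simp add: function_space_def)
next
  fix V s t assume s: "is_fraction V s"
  show "is_fraction V t" if "\<And>Q. Q \<in> V \<Longrightarrow> t Q = s Q"
    using s that unfolding is_fraction_def by metis
  show "is_fraction W s" if "W \<subseteq> V" for W
    using s that unfolding is_fraction_def by (meson subsetD)
next
  fix P v assume P: "P \<in> topspace (rs_top (Proj A G))"
  then have prime: "primeideal P A"
    using proj_points_prime by (simp add: topspace_Proj)
  then show "nonunits_additive (L P)"
    by (rule nonunits_additive_L)
  assume "v \<in> carrier (L P)"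
  then obtain n a f where v: "a \<in> G n" "f \<in> G n" "f \<notin> P" "v = hfrac P a f"
    unfolding L_carrier by blast
  let ?V = "{P \<in> proj_points A G. f \<notin> P}"
  have "openin (rs_top (Proj A G)) ?V"
    using v by (intro openin_Proj_basic) simp
  moreover have "P \<in> ?V"
    using P v by (simp add: topspace_Proj)
  moreover have "is_fraction ?V (\<lambda>Q. hfrac Q a f)"
    unfolding is_fraction_def using v by blast
  ultimately show "\<exists>V s. openin (rs_top (Proj A G)) V \<and> P \<in> V \<and> is_fraction V s \<and> s P = v"
    using v by blast
next
  fix V assume "openin (rs_top (Proj A G)) V"
  then have V: "primeideal Q A" if "Q \<in> V" for Q
    using openin_subset proj_points_prime that topspace_Proj by blast
  have one: "\<one> \<notin> Q" if "Q \<in> V" for Q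
    using V[OF that] one_notin_prime by blast
  show "is_fraction V (\<lambda>Q. \<zero>\<^bsub>L Q\<^esub>)"
    unfolding is_fraction_def
    by (rule exI, rule bexI[OF _ piece_zero], rule bexI[OF _ piece_one])
      (use one L_zero[OF V] in auto)
  show "is_fraction V (\<lambda>Q. \<one>\<^bsub>L Q\<^esub>)"
    unfolding is_fraction_def
    by (rule exI, rule bexI[OF _ piece_one], rule bexI[OF _ piece_one])
      (use one L_one[OF V] in auto)
  fix s assume "is_fraction V s"
  then obtain m a f where s: "a \<in> G m" "f \<in> G m" "\<And>Q. Q \<in> V \<Longrightarrow> f \<notin> Q \<and> s Q = hfrac Q a f"
    unfolding is_fraction_def by blast
  show "s Q \<in> carrier (L Q)" if "Q \<in> V" for Q
    using s that hfrac_in_L by auto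
  show "is_fraction V (\<lambda>Q. \<ominus>\<^bsub>L Q\<^esub> s Q)"
    unfolding is_fraction_def
    by (rule exI, rule bexI[OF _ piece_neg[OF s(1)]], rule bexI[OF _ s(2)])
      (use s L_neg[OF V] in auto)
  fix t assume "is_fraction V t"
  then obtain n b g where t: "b \<in> G n" "g \<in> G n" "\<And>Q. Q \<in> V \<Longrightarrow> g \<notin> Q \<and> t Q = hfrac Q b g"
    unfolding is_fraction_def by blast
  have fg: "f \<otimes> g \<in> G (m + n)" "f \<otimes> g \<notin> Q" if "Q \<in> V" for Q
    using piece_mult s t mult_notin_prime[OF V[OF that]] that by simp_all
  show "is_fraction V (\<lambda>Q. s Q \<oplus>\<^bsub>L Q\<^esub> t Q)"
    unfolding is_fraction_def
  proof (rule exI, rule bexI[OF _ numerator_add[OF s(1,2) t(1,2)]],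
      rule bexI[OF _ piece_mult[OF s(2) t(2)]], intro ballI conjI)
    fix Q assume Q: "Q \<in> V"
    show "f \<otimes> g \<notin> Q"
      using fg Q by blast
    show "s Q \<oplus>\<^bsub>L Q\<^esub> t Q = hfrac Q (g \<otimes> a \<oplus> f \<otimes> b) (f \<otimes> g)"
      using s t Q by (simp add: L_add[OF V[OF Q]])
  qed
  show "is_fraction V (\<lambda>Q. s Q \<otimes>\<^bsub>L Q\<^esub> t Q)"
    unfolding is_fraction_def
  proof (rule exI, rule bexI[OF _ piece_mult[OF s(1) t(1)]],
      rule bexI[OF _ piece_mult[OF s(2) t(2)]], intro ballI conjI)
    fix Q assume Q: "Q \<in> V"
    show "f \<otimes> g \<notin> Q"
      using fg Q by blast
    show "s Q \<otimes>\<^bsub>L Q\<^esub> t Q = hfrac Q (a \<otimes> b) (f \<otimes> g)"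
      using s t Q by (simp add: L_mult[OF V[OF Q]])
  qed
  fix P assume P: "P \<in> V" and eq: "s P = t P"
  then obtain u where u: "u \<in> outside P" "u \<otimes> (g \<otimes> a) = u \<otimes> (f \<otimes> b)"
    using s t hfrac_eq_iff[OF V[OF P], of a b f m g n] by auto
  obtain k where u': "u \<notin> P" "u \<in> G k"
    using outsideD[OF u(1)] by blast
  have "s Q = t Q" if "Q \<in> V" "u \<notin> Q" for Q
  proof -
    have "hfrac Q a f = hfrac Q b g"
      using hfrac_eq_iff[OF V[OF that(1)], of a b f m g n] s t u(2) mem_outside[OF u'(2) that(2)] that
      by auto
    then show ?thesis
      using s t that by simp
  qed
  moreover have "openin (rs_top (Proj A G)) (V \<inter> {P \<in> proj_points A G. u \<notin> P})"
    using \<open>openin (rs_top (Proj A G)) V\<close> u' by (intro openin_Int openin_Proj_basic) auto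
  moreover have "P \<in> proj_points A G"
    using openin_subset[OF \<open>openin (rs_top (Proj A G)) V\<close>] P by (auto simp: topspace_Proj)
  ultimately show "\<exists>W. openin (rs_top (Proj A G)) W \<and> P \<in> W \<and> W \<subseteq> V \<and> (\<forall>Q\<in>W. s Q = t Q)"
    using P u' by (intro exI[of _ "V \<inter> {P \<in> proj_points A G. u \<notin> P}"]) auto
qed

end

lemma graded_cring_trivial:
  assumes "cring A"
  shows "graded_cring A (\<lambda>_. carrier A)"
proof -
  interpret cring A by fact
  show ?thesis
    by unfold_locales auto
qed

text \<open>When every piece is the whole ring, each ideal is generated by its homogeneous elements,
  the irrelevant ideal contains \<one>, and the degree condition on fractions is void; so all primes
  are points and the local rings are the usual ones.\<close>

lemma Spec_eq_Proj:
  assumes "cring A"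
  shows "Spec A = Proj A (\<lambda>_. carrier A)"
    and "proj_points A (\<lambda>_. carrier A) = {P. primeideal P A}"
proof -
  interpret graded_cring A "\<lambda>_. carrier A"
    using assms by (rule graded_cring_trivial)
  have Idl: "Idl\<^bsub>A\<^esub> P = P" if "ideal P A" for P
    using genideal_self[of P] genideal_minimal[OF that, of P] ideal.Icarr[OF that] by blast
  show pts: "proj_points A (\<lambda>_. carrier A) = {P. primeideal P A}"
  proof -
    have "P \<inter> carrier A = P" if "ideal P A" for P
      using ideal.Icarr[OF that] by blast
    moreover have "\<not> irrelevant_ideal A (\<lambda>_. carrier A) \<subseteq> P" if "primeideal P A" for P
      using one_notin_prime[OF that] genideal_self[of "carrier A"]
      by (auto simp: irrelevant_ideal_def)
    moreover have "Idl\<^bsub>A\<^esub> (P \<inter> carrier A) = P" if "primeideal P A" for P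
      using Idl[OF primeideal.axioms(1)[OF that]] calculation(1)[OF primeideal.axioms(1)[OF that]]
      by simp
    ultimately have "P \<in> proj_points A (\<lambda>_. carrier A)" if "primeideal P A" for P
      using that by (simp add: proj_points_def)
    then show ?thesis
      by (auto simp: proj_points_prime)
  qed
  have out: "homogeneous_outside (\<lambda>_. carrier A) P = carrier A - P" for P
    by (auto simp: homogeneous_outside_def)
  have loc: "homogeneous_localization A (\<lambda>_. carrier A) = (\<lambda>P. localization A (carrier A - P))"
    unfolding homogeneous_localization_def out by (rule ext) (auto simp: localization_def)
  have "topspace (zariski A) = {P. primeideal P A}"
  proof
    show "topspace (zariski A) \<subseteq> {P. primeideal P A}"
      using openin_topspace[of "zariski A"] unfolding openin_zariski by blast
    have "openin (zariski A) {P. primeideal P A}"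
      unfolding openin_zariski using oneideal one_notin_prime by blast
    then show "{P. primeideal P A} \<subseteq> topspace (zariski A)"
      by (rule openin_subset)
  qed
  then have top: "subtopology (zariski A) {P. primeideal P A} = zariski A"
    using subtopology_topspace by metis
  show "Spec A = Proj A (\<lambda>_. carrier A)"
    unfolding Spec_def Proj_def pts out loc top by simp
qed

section \<open>Contraction to the spectrum of a ring of degree zero elements\<close>

text \<open>The morphism from Proj A to Spec R induced by a ring homomorphism into degree zero. It
  is used for R -> R[I] and, with the constant grading on A, for R -> R_f.\<close>

locale contraction = graded_cring A G + R: cring R
  for A :: "('a, 'm) ring_scheme" (structure) and G and R :: "('r, 'n) ring_scheme" +
  fixes \<alpha> :: "'r \<Rightarrow> 'a"
  assumes \<alpha>_hom: "\<alpha> \<in> ring_hom R A"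
    and \<alpha>_degree: "r \<in> carrier R \<Longrightarrow> \<alpha> r \<in> G 0"
begin

sublocale R: graded_cring R "\<lambda>_. carrier R"
  by (rule graded_cring_trivial[OF R.cring_axioms])

text \<open>For the constant grading this rule reads
  \<open>a \<in> carrier R \<Longrightarrow> a \<in> carrier R\<close>, which would send the
  simplifier in circles.\<close>

declare R.piece_carrier [simp del]

sublocale \<alpha>: ring_hom_cring R A \<alpha>
  by unfold_locales (rule \<alpha>_hom)

definition contract where
  "contract P = {r \<in> carrier R. \<alpha> r \<in> P}"

lemma prime_contract:
  assumes "primeideal P A"
  shows "primeideal (contract P) R"
  unfolding contract_def using \<alpha>.ring.primeideal_vimage[OF R.cring_axioms assms] .

lemma mem_contract: "r \<in> carrier R \<Longrightarrow> r \<in> contract P \<longleftrightarrow> \<alpha> r \<in> P"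
  by (simp add: contract_def)

lemma mem_R_outside: "u \<in> R.outside (contract P) \<longleftrightarrow> u \<in> carrier R \<and> \<alpha> u \<notin> P"
  by (auto simp: homogeneous_outside_def contract_def)

definition pull where
  "pull P x = (\<Union>(b, k)\<in>x. hfrac P (\<alpha> b) (\<alpha> k))"

lemma pull_fraction:
  assumes P: "primeideal P A" and b: "b \<in> carrier R" and k: "k \<in> carrier R" "\<alpha> k \<notin> P"
  shows "pull P (R.hfrac (contract P) b k) = hfrac P (\<alpha> b) (\<alpha> k)"
proof -
  note S = R.mult_system_outside[OF prime_contract[OF P]]
  have k': "k \<in> R.outside (contract P)"
    using k by (simp add: mem_R_outside)
  show ?thesis
    unfolding pull_def
  proof (rule UN_const_pair[OF mult_system.mem_fraction[OF S b k']])
    fix c l assume cl: "(c, l) \<in> R.hfrac (contract P) b k"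
    note m = mult_system.mem_fractionD[OF S cl b k']
    have l: "l \<in> carrier R" "\<alpha> l \<notin> P"
      using m(2) by (simp_all add: mem_R_outside)
    obtain u where u: "u \<in> R.outside (contract P)" "u \<otimes>\<^bsub>R\<^esub> (k \<otimes>\<^bsub>R\<^esub> c) = u \<otimes>\<^bsub>R\<^esub> (l \<otimes>\<^bsub>R\<^esub> b)"
      using m(3) mult_system.fraction_eq_iff[OF S m(1) b m(2) k'] by blast
    have u': "u \<in> carrier R" "\<alpha> u \<notin> P"
      using u(1) by (simp_all add: mem_R_outside)
    have "\<alpha> u \<otimes> (\<alpha> k \<otimes> \<alpha> c) = \<alpha> u \<otimes> (\<alpha> l \<otimes> \<alpha> b)"
      using arg_cong[OF u(2), of \<alpha>] u' m(1) l b k by simp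
    moreover have "\<alpha> u \<in> outside P"
      using mem_outside[OF \<alpha>_degree[OF u'(1)] u'(2)] .
    ultimately show "hfrac P (\<alpha> c) (\<alpha> l) = hfrac P (\<alpha> b) (\<alpha> k)"
      using hfrac_eq_iff[OF P _ _ \<alpha>_degree[OF l(1)] l(2) \<alpha>_degree[OF k(1)] k(2)] m(1) b by auto
  qed
qed

lemma R_L_cases:
  assumes "x \<in> carrier (R.L (contract P))"
  obtains b k where "b \<in> carrier R" "k \<in> carrier R" "\<alpha> k \<notin> P" "x = R.hfrac (contract P) b k"
  using assms mem_contract unfolding R.L_carrier by blast

lemma pull_hom:
  assumes P: "primeideal P A"
  shows "pull P \<in> ring_hom (R.L (contract P)) (L P)"
proof (rule ring_hom_memI)
  note cP = prime_contract[OF P]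
  fix x assume "x \<in> carrier (R.L (contract P))"
  then obtain b k where x: "b \<in> carrier R" "k \<in> carrier R" "\<alpha> k \<notin> P" "x = R.hfrac (contract P) b k"
    by (rule R_L_cases)
  show "pull P x \<in> carrier (L P)"
    unfolding x(4) pull_fraction[OF P x(1-3)]
    using hfrac_in_L[OF \<alpha>_degree \<alpha>_degree] x by blast
  fix y assume "y \<in> carrier (R.L (contract P))"
  then obtain c l where y: "c \<in> carrier R" "l \<in> carrier R" "\<alpha> l \<notin> P" "y = R.hfrac (contract P) c l"
    by (rule R_L_cases)
  have kl: "\<alpha> (k \<otimes>\<^bsub>R\<^esub> l) \<notin> P" "k \<notin> contract P" "l \<notin> contract P"
    using mult_notin_prime[OF P, of "\<alpha> k" "\<alpha> l"] x y by (simp_all add: mem_contract)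
  note d = \<alpha>_degree[OF x(2)] x(3) \<alpha>_degree[OF y(2)] y(3)
  show "pull P (x \<otimes>\<^bsub>R.L (contract P)\<^esub> y) = pull P x \<otimes>\<^bsub>L P\<^esub> pull P y"
    unfolding x(4) y(4) R.L_mult[OF cP x(1) y(1) x(2) kl(2) y(2) kl(3)] pull_fraction[OF P x(1-3)]
      pull_fraction[OF P y(1-3)]
    using x y kl(1) by (subst pull_fraction[OF P]) (simp_all add: L_mult[OF P _ _ d])
  show "pull P (x \<oplus>\<^bsub>R.L (contract P)\<^esub> y) = pull P x \<oplus>\<^bsub>L P\<^esub> pull P y"
    unfolding x(4) y(4) R.L_add[OF cP x(1) y(1) x(2) kl(2) y(2) kl(3)] pull_fraction[OF P x(1-3)]
      pull_fraction[OF P y(1-3)]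
    using x y kl(1) by (subst pull_fraction[OF P]) (simp_all add: L_add[OF P _ _ d])
next
  show "pull P \<one>\<^bsub>R.L (contract P)\<^esub> = \<one>\<^bsub>L P\<^esub>"
    using pull_fraction[OF P, of "\<one>\<^bsub>R\<^esub>" "\<one>\<^bsub>R\<^esub>"] one_notin_prime[OF P]
    by (simp add: R.L_one[OF prime_contract[OF P]] L_one[OF P])
qed

text \<open>Containment of J in the contraction of P means containment of the extended ideal in P,
  so the extension of J serves as K.\<close>

lemma contract_continuous:
  assumes "ideal J R"
  shows "\<exists>K. ideal K A \<and> {P \<in> proj_points A G. \<not> J \<subseteq> contract P} = {P \<in> proj_points A G. \<not> K \<subseteq> P}"
proof (intro exI conjI)
  have J: "J \<subseteq> carrier R"
    using ideal.Icarr[OF assms] by blast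
  then have \<alpha>J: "\<alpha> ` J \<subseteq> carrier A"
    by auto
  then show "ideal (Idl (\<alpha> ` J)) A"
    by (rule genideal_ideal)
  have "J \<subseteq> contract P \<longleftrightarrow> Idl (\<alpha> ` J) \<subseteq> P" if "P \<in> proj_points A G" for P
  proof -
    have "ideal P A"
      using that proj_points_prime primeideal.axioms(1) by blast
    then have "Idl (\<alpha> ` J) \<subseteq> P \<longleftrightarrow> \<alpha> ` J \<subseteq> P"
      using genideal_self[OF \<alpha>J] genideal_minimal[of P "\<alpha> ` J"] by blast
    then show ?thesis
      using J by (auto simp: contract_def)
  qed
  then show "{P \<in> proj_points A G. \<not> J \<subseteq> contract P} = {P \<in> proj_points A G. \<not> Idl (\<alpha> ` J) \<subseteq> P}"
    by blast
qed

end

text \<open>A criterion for contraction to restrict to an isomorphism from an open part U of Proj A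
  to an open part W of Spec R. \<open>clear_denominator\<close> rewrites a/f with numerator and
  denominator from R and gives surjectivity of \<open>pull P\<close>; \<open>torsion\<close>
  replaces a homogeneous annihilator by one from R and gives injectivity; \<open>open_image\<close>
  makes the inverse map on points continuous.\<close>

locale contraction_iso = contraction A G R \<alpha>
  for A :: "('a, 'm) ring_scheme" (structure) and G and R :: "('r, 'n) ring_scheme" and \<alpha> +
  fixes U :: "'a set set" and W :: "'r set set"
  assumes U_open: "openin (rs_top (Proj A G)) U"
    and W_open: "openin (rs_top (Spec R)) W"
    and bij: "bij_betw contract U W"
    and open_image: "\<lbrakk>openin (rs_top (Proj A G)) V; V \<subseteq> U\<rbrakk> \<Longrightarrow> openin (rs_top (Spec R)) (contract ` V)"
    and clear_denominator: "\<lbrakk>P \<in> U; a \<in> G n; f \<in> G n; f \<notin> P\<rbrakk>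
      \<Longrightarrow> \<exists>b\<in>carrier R. \<exists>k\<in>carrier R. \<alpha> k \<notin> P \<and> \<alpha> k \<otimes> a = \<alpha> b \<otimes> f"
    and torsion: "\<lbrakk>P \<in> U; z \<in> carrier R; u \<in> G n; u \<notin> P; u \<otimes> \<alpha> z = \<zero>\<rbrakk>
      \<Longrightarrow> \<exists>w\<in>carrier R. \<alpha> w \<notin> P \<and> w \<otimes>\<^bsub>R\<^esub> z = \<zero>\<^bsub>R\<^esub>"
begin

lemma U_prime: "P \<in> U \<Longrightarrow> primeideal P A"
  using openin_subset[OF U_open] proj_points_prime by (auto simp: topspace_Proj)

lemma pull_iso:
  assumes PU: "P \<in> U"
  shows "pull P \<in> ring_iso (R.L (contract P)) (L P)"
  unfolding ring_iso_def
proof (intro CollectI conjI bij_betw_imageI)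
  have P: "primeideal P A"
    using U_prime[OF PU] .
  show hom: "pull P \<in> ring_hom (R.L (contract P)) (L P)"
    by (rule pull_hom[OF P])
  show "inj_on (pull P) (carrier (R.L (contract P)))"
  proof (rule inj_onI)
    fix x y assume xy: "x \<in> carrier (R.L (contract P))" "y \<in> carrier (R.L (contract P))"
      "pull P x = pull P y"
    obtain b k where x: "b \<in> carrier R" "k \<in> carrier R" "\<alpha> k \<notin> P" "x = R.hfrac (contract P) b k"
      using xy(1) by (rule R_L_cases)
    obtain c l where y: "c \<in> carrier R" "l \<in> carrier R" "\<alpha> l \<notin> P" "y = R.hfrac (contract P) c l"
      using xy(2) by (rule R_L_cases)
    have "hfrac P (\<alpha> b) (\<alpha> k) = hfrac P (\<alpha> c) (\<alpha> l)"
      using xy(3) x y by (simp add: pull_fraction[OF P])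
    then obtain u where u: "u \<in> outside P" "u \<otimes> (\<alpha> l \<otimes> \<alpha> b) = u \<otimes> (\<alpha> k \<otimes> \<alpha> c)"
      using hfrac_eq_iff[OF P _ _ \<alpha>_degree[OF x(2)] x(3) \<alpha>_degree[OF y(2)] y(3)] x y by auto
    obtain n where u': "u \<notin> P" "u \<in> G n"
      using outsideD[OF u(1)] by blast
    \<comment> \<open>The cross difference of b/k and c/l. Equality of the images means that u kills
      its image in A, and \<open>torsion\<close> turns u into an annihilator from R.\<close>
    let ?z = "l \<otimes>\<^bsub>R\<^esub> b \<ominus>\<^bsub>R\<^esub> k \<otimes>\<^bsub>R\<^esub> c"
    have "u \<otimes> \<alpha> ?z = u \<otimes> (\<alpha> l \<otimes> \<alpha> b) \<ominus> u \<otimes> (\<alpha> k \<otimes> \<alpha> c)"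
      using x y u'(2) by (simp add: minus_eq r_distr r_minus R.minus_eq)
    also have "\<dots> = \<zero>"
      unfolding u(2) using x y u'(2) by (simp add: minus_eq r_neg)
    finally have "u \<otimes> \<alpha> ?z = \<zero>" .
    then obtain w where w: "w \<in> carrier R" "\<alpha> w \<notin> P" "w \<otimes>\<^bsub>R\<^esub> ?z = \<zero>\<^bsub>R\<^esub>"
      using torsion[OF PU _ u'(2,1), of ?z] x y by auto
    have "w \<otimes>\<^bsub>R\<^esub> (l \<otimes>\<^bsub>R\<^esub> b) \<ominus>\<^bsub>R\<^esub> w \<otimes>\<^bsub>R\<^esub> (k \<otimes>\<^bsub>R\<^esub> c) = \<zero>\<^bsub>R\<^esub>"
      using w x y by (simp add: R.minus_eq R.r_distr R.r_minus)
    then have "w \<otimes>\<^bsub>R\<^esub> (l \<otimes>\<^bsub>R\<^esub> b) = w \<otimes>\<^bsub>R\<^esub> (k \<otimes>\<^bsub>R\<^esub> c)"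
      using w(1) x y by simp
    moreover have "w \<in> R.outside (contract P)"
      using w by (simp add: mem_R_outside)
    ultimately show "x = y"
      using R.hfrac_eq_iff[OF prime_contract[OF P] x(1) y(1) x(2) _ y(2)] x y
      by (auto simp: mem_contract)
  qed
  show "pull P ` carrier (R.L (contract P)) = carrier (L P)"
  proof (intro equalityI subsetI)
    fix v assume "v \<in> pull P ` carrier (R.L (contract P))"
    then show "v \<in> carrier (L P)"
      using ring_hom_closed[OF hom] by blast
  next
    fix v assume "v \<in> carrier (L P)"
    then obtain n a f where v: "a \<in> G n" "f \<in> G n" "f \<notin> P" "v = hfrac P a f"
      unfolding L_carrier by blast
    obtain b k where bk: "b \<in> carrier R" "k \<in> carrier R" "\<alpha> k \<notin> P" "\<alpha> k \<otimes> a = \<alpha> b \<otimes> f"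
      using clear_denominator[OF PU v(1-3)] by blast
    have "hfrac P a f = hfrac P (\<alpha> b) (\<alpha> k)"
      using v bk by (intro hfrac_eqI[OF P _ _ v(2,3) \<alpha>_degree[OF bk(2)] bk(3)]) (auto simp: m_comm)
    then have "v = pull P (R.hfrac (contract P) b k)"
      using v(4) pull_fraction[OF P bk(1-3)] by simp
    moreover have "R.hfrac (contract P) b k \<in> carrier (R.L (contract P))"
      using bk by (intro R.hfrac_in_L) (auto simp: mem_contract)
    ultimately show "v \<in> pull P ` carrier (R.L (contract P))"
      by blast
  qed
qed

definition expand where "expand = inv_into U contract"

lemma expand_contract: "P \<in> U \<Longrightarrow> expand (contract P) = P"
  using bij by (simp add: expand_def bij_betw_inv_into_left)

lemma contract_expand: "Q \<in> W \<Longrightarrow> contract (expand Q) = Q"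
  using bij by (simp add: expand_def bij_betw_inv_into_right)

lemma expand_mem: "Q \<in> W \<Longrightarrow> expand Q \<in> U"
  using bij unfolding expand_def by (metis bij_betw_def inv_into_into)

lemma contract_mem: "P \<in> U \<Longrightarrow> contract P \<in> W"
  using bij bij_betwE by blast

definition push where
  "push Q = inv_into (carrier (R.L Q)) (pull (expand Q))"

lemma push_hom:
  assumes "Q \<in> W"
  shows "push Q \<in> ring_hom (L (expand Q)) (R.L Q)"
proof -
  have "ring (R.L (contract (expand Q)))"
    using R.cring_L[OF prime_contract[OF U_prime[OF expand_mem[OF assms]]]] by (rule cring.axioms(1))
  from ring_iso_set_sym[OF this pull_iso[OF expand_mem[OF assms]]] show ?thesis
    by (simp add: push_def contract_expand[OF assms] ring_iso_def)
qed

lemma push_pull: "\<lbrakk>P \<in> U; v \<in> carrier (R.L (contract P))\<rbrakk> \<Longrightarrow> push (contract P) (pull P v) = v"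
  using bij_betw_inv_into_left[OF ring_iso_memE(5)[OF pull_iso]]
  by (simp add: push_def expand_contract)

lemma pull_push: "\<lbrakk>P \<in> U; v \<in> carrier (L P)\<rbrakk> \<Longrightarrow> pull P (push (contract P) v) = v"
  using bij_betw_inv_into_right[OF ring_iso_memE(5)[OF pull_iso]]
  by (simp add: push_def expand_contract)

abbreviation X where "X \<equiv> open_subspace (Proj A G) U"
abbreviation Y where "Y \<equiv> open_subspace (Spec R) W"

lemma openin_X: "openin (rs_top X) V \<longleftrightarrow> openin (rs_top (Proj A G)) V \<and> V \<subseteq> U"
  using U_open by (simp add: open_subspace_def openin_open_subtopology)

lemma openin_Y: "openin (rs_top Y) V \<longleftrightarrow> openin (rs_top (Spec R)) V \<and> V \<subseteq> W"
  using W_open by (simp add: open_subspace_def openin_open_subtopology)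

lemma topspace_X: "topspace (rs_top X) = U"
  using openin_subset[OF U_open] by (auto simp: open_subspace_def)

lemma topspace_Y: "topspace (rs_top Y) = W"
  using openin_subset[OF W_open] by (auto simp: open_subspace_def)

lemma openin_contract_vimage:
  assumes "openin (rs_top Y) V"
  shows "openin (rs_top X) {P \<in> U. contract P \<in> V}"
proof -
  obtain J where J: "ideal J R" "V = {Q. primeideal Q R \<and> \<not> J \<subseteq> Q}"
    using assms unfolding openin_Y unfolding Spec_eq_Proj(1)[OF R.cring_axioms] R.openin_Proj
      Spec_eq_Proj(2)[OF R.cring_axioms] by auto
  obtain K where K: "ideal K A"
      "{P \<in> proj_points A G. \<not> J \<subseteq> contract P} = {P \<in> proj_points A G. \<not> K \<subseteq> P}"
    using contract_continuous[OF J(1)] by blast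
  have "{P \<in> U. contract P \<in> V} = U \<inter> {P \<in> proj_points A G. \<not> K \<subseteq> P}"
    unfolding J(2) K(2)[symmetric] using prime_contract U_prime openin_subset[OF U_open]
    by (auto simp: topspace_Proj)
  moreover have "openin (rs_top (Proj A G)) {P \<in> proj_points A G. \<not> K \<subseteq> P}"
    unfolding openin_Proj using K(1) by blast
  ultimately show ?thesis
    unfolding openin_X using U_open by auto
qed

lemma pull_sheaf_pullback:
  "sheaf_pullback X L is_fraction Y R.L R.is_fraction contract pull"
  unfolding sheaf_pullback_def topspace_X
proof (intro conjI ballI allI impI; (elim conjE)?)
  show "continuous_map (rs_top X) (rs_top Y) contract"
    unfolding continuous_map_def topspace_X topspace_Y
    using contract_mem openin_contract_vimage by auto
  show "pull P \<in> ring_hom (R.L (contract P)) (L P)" if "P \<in> U" for P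
    using that by (intro pull_hom U_prime)
  fix V t P assume V: "openin (rs_top Y) V" and t: "R.is_fraction V t" and P: "P \<in> U" "contract P \<in> V"
  obtain b k where bk: "b \<in> carrier R" "k \<in> carrier R"
    "\<And>Q. Q \<in> V \<Longrightarrow> k \<notin> Q \<and> t Q = R.hfrac Q b k"
    using t unfolding R.is_fraction_def by blast
  have eq: "\<alpha> k \<notin> P \<and> pull P (t (contract P)) = hfrac P (\<alpha> b) (\<alpha> k)"
    if P: "P \<in> {P \<in> U. contract P \<in> V}" for P
  proof -
    have "\<alpha> k \<notin> P"
      using P bk(2) bk(3)[of "contract P"] by (simp add: mem_contract)
    then show ?thesis
      using P bk(3)[of "contract P"] pull_fraction[OF U_prime bk(1,2)] by simp
  qed
  have "is_fraction {P \<in> U. contract P \<in> V} (\<lambda>P. pull P (t (contract P)))"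
    unfolding is_fraction_def
    by (rule exI, rule bexI[OF _ \<alpha>_degree[OF bk(1)]], rule bexI[OF _ \<alpha>_degree[OF bk(2)]])
      (use eq in blast)
  then show "\<exists>W. openin (rs_top X) W \<and> P \<in> W \<and> contract ` W \<subseteq> V \<and>
      is_fraction W (\<lambda>P. pull P (t (contract P)))"
    using openin_contract_vimage[OF V] P by (intro exI[of _ "{P \<in> U. contract P \<in> V}"]) auto
qed

lemma push_sheaf_pullback:
  "sheaf_pullback Y R.L R.is_fraction X L is_fraction expand push"
  unfolding sheaf_pullback_def topspace_Y
proof (intro conjI ballI allI impI; (elim conjE)?)
  have image: "openin (rs_top Y) (contract ` V)" if "openin (rs_top X) V" for V
    using that open_image[of V] contract_mem unfolding openin_X openin_Y by blast
  have vimage: "{Q \<in> W. expand Q \<in> V} = contract ` V" if "openin (rs_top X) V" for V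
  proof -
    have "V \<subseteq> U"
      using that openin_X by blast
    then show ?thesis
      using contract_mem expand_contract contract_expand by (force simp: image_iff)
  qed
  show "continuous_map (rs_top Y) (rs_top X) expand"
    unfolding continuous_map_def topspace_X topspace_Y using expand_mem vimage image by auto
  show "push Q \<in> ring_hom (L (expand Q)) (R.L Q)" if "Q \<in> W" for Q
    using that by (rule push_hom)
  fix V s Q assume V: "openin (rs_top X) V" and s: "is_fraction V s" and Q: "Q \<in> W" "expand Q \<in> V"
  obtain n a f where af: "a \<in> G n" "f \<in> G n" "\<And>P. P \<in> V \<Longrightarrow> f \<notin> P \<and> s P = hfrac P a f"
    using s unfolding is_fraction_def by blast
  have VU: "V \<subseteq> U"
    using V openin_X by blast
  obtain b k where bk: "b \<in> carrier R" "k \<in> carrier R" "\<alpha> k \<notin> expand Q" "\<alpha> k \<otimes> a = \<alpha> b \<otimes> f"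
    using clear_denominator[OF _ af(1,2), of "expand Q"] af(3)[OF Q(2)] Q VU by blast
  \<comment> \<open>The identity relating b, k to a, f holds in A itself, not only at one point.
    Hence b/k represents the section wherever the image of k stays outside the prime, which gives
    the neighbourhood of Q.\<close>
  let ?V = "V \<inter> {P \<in> proj_points A G. \<alpha> k \<notin> P}"
  have V': "openin (rs_top X) ?V"
    using V bk(2) unfolding openin_X by (auto intro!: openin_Int openin_Proj_basic)
  have "expand Q \<in> ?V"
    using Q bk(3) openin_subset[OF U_open] VU by (auto simp: topspace_Proj)
  then have "Q \<in> contract ` ?V"
    using contract_expand[OF Q(1)] by (metis imageI)
  moreover have "expand ` contract ` ?V \<subseteq> V"
    using VU expand_contract by auto
  moreover have "R.is_fraction (contract ` ?V) (\<lambda>Q. push Q (s (expand Q)))"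
    unfolding R.is_fraction_def
  proof (rule exI, rule bexI[OF _ bk(1)], rule bexI[OF _ bk(2)], intro ballI)
    fix Q' assume "Q' \<in> contract ` ?V"
    then obtain P where P: "P \<in> V" "\<alpha> k \<notin> P" "Q' = contract P"
      by blast
    then have PU: "P \<in> U"
      using VU by blast
    have "s P = hfrac P (\<alpha> b) (\<alpha> k)"
      using af P bk
      by (simp, intro hfrac_eqI[OF U_prime[OF PU] _ _ af(2) _ \<alpha>_degree[OF bk(2)] P(2)])
        (auto simp: m_comm)
    also have "\<dots> = pull P (R.hfrac Q' b k)"
      using pull_fraction[OF U_prime[OF PU] bk(1,2) P(2)] P(3) by simp
    finally have "push Q' (s (expand Q')) = R.hfrac Q' b k"
      using push_pull[OF PU, of "R.hfrac Q' b k"] R.hfrac_in_L[OF bk(1,2), of Q'] P bk(2)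
      by (simp add: expand_contract[OF PU] mem_contract)
    then show "k \<notin> Q' \<and> push Q' (s (expand Q')) = R.hfrac Q' b k"
      using P bk(2) by (simp add: mem_contract)
  qed
  ultimately show "\<exists>W. openin (rs_top Y) W \<and> Q \<in> W \<and> expand ` W \<subseteq> V \<and>
      R.is_fraction W (\<lambda>Q. push Q (s (expand Q)))"
    using image[OF V'] by blast
qed

lemma contraction_sheaf_iso: "sheaf_iso X L is_fraction Y R.L R.is_fraction"
  unfolding sheaf_iso_def
  by (rule exI[of _ contract], rule exI[of _ expand], rule exI[of _ pull], rule exI[of _ push])
    (simp add: pull_sheaf_pullback push_sheaf_pullback topspace_X topspace_Y expand_contract
      contract_expand push_pull pull_push)

end

section \<open>Open sets and structure sheaf of Spec, read off from Proj\<close>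

lemma openin_Spec:
  assumes "cring R"
  shows "openin (rs_top (Spec R)) U \<longleftrightarrow> (\<exists>J. ideal J R \<and> U = {P. primeideal P R \<and> \<not> J \<subseteq> P})"
  using graded_cring.openin_Proj[OF graded_cring_trivial[OF assms]]
  by (simp add: Spec_eq_Proj[OF assms])

lemma topspace_Spec:
  assumes "cring R"
  shows "topspace (rs_top (Spec R)) = {P. primeideal P R}"
  using graded_cring.topspace_Proj[OF graded_cring_trivial[OF assms]]
  by (simp add: Spec_eq_Proj[OF assms])

lemma openin_Spec_basic:
  assumes "cring R" "f \<in> carrier R"
  shows "openin (rs_top (Spec R)) {P. primeideal P R \<and> f \<notin> P}"
  using graded_cring.openin_Proj_basic[OF graded_cring_trivial[OF assms(1)] assms(2)]
  by (simp add: Spec_eq_Proj[OF assms(1)])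

lemma function_sheaf_Spec:
  assumes "cring R"
  shows "function_sheaf (Spec R) (homogeneous_localization R (\<lambda>_. carrier R))
    (graded_cring.is_fraction R (\<lambda>_. carrier R))"
  using graded_cring.function_sheaf_Proj[OF graded_cring_trivial[OF assms]]
  by (simp add: Spec_eq_Proj[OF assms])

section \<open>Noetherian spectra\<close>

text \<open>A nonempty chain of ideals in a Noetherian ring contains its own union; Zorn's lemma
  turns this into the maximum condition.\<close>

lemma (in noetherian_ring) exists_maximal_member:
  assumes "\<A> \<noteq> {}" "\<And>J. J \<in> \<A> \<Longrightarrow> ideal J R"
  shows "\<exists>M\<in>\<A>. \<forall>J\<in>\<A>. M \<subseteq> J \<longrightarrow> J = M"
proof (rule subset_Zorn_nonempty[OF assms(1)])
  fix C assume C: "C \<noteq> {}" "subset.chain \<A> C"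
  have sub: "C \<subseteq> \<A>"
    using C(2) by (rule subset_chain_def[THEN iffD1, THEN conjunct1])
  have "subset.chain {J. ideal J R} C"
    using C(2) sub assms(2) by (auto simp: subset_chain_def)
  then have "\<Union>C \<in> C"
    by (rule ideal_chain_is_trivial[OF C(1)])
  then show "\<Union>C \<in> \<A>"
    using sub by blast
qed

text \<open>The finite subfamily is one whose defining ideals generate a maximal ideal among all
  those arising from finite subfamilies. Stated for an arbitrary union, this says that every open
  subset of Spec R is quasi-compact.\<close>

lemma noetherian_open_subcover:
  assumes "cring R" and "noetherian_ring R" and \<U>: "\<forall>U\<in>\<U>. openin (rs_top (Spec R)) U"
  shows "\<exists>\<F>. finite \<F> \<and> \<F> \<subseteq> \<U> \<and> \<Union>\<F> = \<Union>\<U>"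
proof -
  interpret cring R by fact
  interpret noetherian_ring R by fact
  obtain J where J: "\<And>U. U \<in> \<U> \<Longrightarrow> ideal (J U) R"
      "\<And>U. U \<in> \<U> \<Longrightarrow> U = {P. primeideal P R \<and> \<not> J U \<subseteq> P}"
    using \<U> unfolding openin_Spec[OF \<open>cring R\<close>] by metis
  define N where "N \<F> = Idl\<^bsub>R\<^esub> (\<Union>U\<in>\<F>. J U)" for \<F>
  have sub: "(\<Union>U\<in>\<F>. J U) \<subseteq> carrier R" if "\<F> \<subseteq> \<U>" for \<F>
    using ideal.Icarr[OF J(1)] that by blast
  define \<A> where "\<A> = {N \<F> | \<F>. finite \<F> \<and> \<F> \<subseteq> \<U>}"
  have "N {} \<in> \<A>"
    by (auto simp: \<A>_def)
  then have "\<A> \<noteq> {}"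
    by blast
  moreover have "ideal K R" if "K \<in> \<A>" for K
    using that genideal_ideal[OF sub] by (auto simp: \<A>_def N_def)
  ultimately obtain M where M: "M \<in> \<A>" "\<And>K. K \<in> \<A> \<Longrightarrow> M \<subseteq> K \<Longrightarrow> K = M"
    using exists_maximal_member[of \<A>] by blast
  obtain \<F> where \<F>: "finite \<F>" "\<F> \<subseteq> \<U>" "M = N \<F>"
    using M(1) by (auto simp: \<A>_def)
  \<comment> \<open>Adding V to the finite subfamily produces another member of \<A> above M, which
    equals M by maximality.\<close>
  have JM: "J V \<subseteq> M" if V: "V \<in> \<U>" for V
  proof -
    have ins: "insert V \<F> \<subseteq> \<U>"
      using V \<F>(2) by blast
    have self: "(\<Union>U\<in>insert V \<F>. J U) \<subseteq> N (insert V \<F>)"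
      unfolding N_def by (rule genideal_self[OF sub[OF ins]])
    have "ideal (N (insert V \<F>)) R"
      unfolding N_def by (rule genideal_ideal[OF sub[OF ins]])
    then have "M \<subseteq> N (insert V \<F>)"
      unfolding \<F>(3) N_def[of \<F>] using self by (intro genideal_minimal) auto
    moreover have "N (insert V \<F>) \<in> \<A>"
      unfolding \<A>_def by (intro CollectI exI[of _ "insert V \<F>"]) (use ins \<F>(1) in simp)
    ultimately have "N (insert V \<F>) = M"
      using M(2) by blast
    then show ?thesis
      using self by blast
  qed
  have cover: "P \<in> \<Union>\<F>" if P: "P \<in> V" "V \<in> \<U>" for P V
  proof -
    have prime: "primeideal P R" and "\<not> J V \<subseteq> P"
      using P J(2)[OF P(2)] by blast+
    then have "\<not> N \<F> \<subseteq> P"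
      using JM[OF P(2)] \<F>(3) by blast
    then obtain U where "U \<in> \<F>" "\<not> J U \<subseteq> P"
      unfolding N_def using genideal_minimal[OF primeideal.axioms(1)[OF prime]]
      by (metis UN_least)
    then show ?thesis
      using J(2)[of U] \<F>(2) prime by blast
  qed
  have "\<Union>\<F> = \<Union>\<U>"
  proof
    show "\<Union>\<F> \<subseteq> \<Union>\<U>"
      using \<F>(2) by (rule Union_mono)
    show "\<Union>\<U> \<subseteq> \<Union>\<F>"
      using cover by (intro Union_least subsetI)
  qed
  with \<F>(1,2) show ?thesis
    by (intro exI[of _ \<F>]) simp
qed

text \<open>Contraction sends an open cover of U to open sets of Spec R, where a finite subfamily
  with the same union exists; injectivity of contraction on U brings it back.\<close>

lemma (in contraction_iso) compactin_noetherian: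
  assumes "noetherian_ring R"
  shows "compactin (rs_top (Proj A G)) U"
  unfolding compactin_def
proof (intro conjI allI impI; (elim conjE)?)
  show "U \<subseteq> topspace (rs_top (Proj A G))"
    using openin_subset[OF U_open] .
  fix \<U> assume \<U>: "\<forall>V\<in>\<U>. openin (rs_top (Proj A G)) V" and cover: "U \<subseteq> \<Union>\<U>"
  have "\<forall>V\<in>(\<lambda>V. contract ` (V \<inter> U)) ` \<U>. openin (rs_top (Spec R)) V"
    using \<U> U_open open_image by blast
  then obtain \<G> where \<G>: "finite \<G>" "\<G> \<subseteq> (\<lambda>V. contract ` (V \<inter> U)) ` \<U>"
      "\<Union>\<G> = \<Union>((\<lambda>V. contract ` (V \<inter> U)) ` \<U>)"
    using noetherian_open_subcover[OF R.cring_axioms assms] by metis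
  then obtain \<F> where \<F>: "finite \<F>" "\<F> \<subseteq> \<U>" "\<G> = (\<lambda>V. contract ` (V \<inter> U)) ` \<F>"
    by (metis finite_subset_image)
  have "P \<in> \<Union>\<F>" if "P \<in> U" for P
  proof -
    have "contract P \<in> \<Union>\<G>"
      unfolding \<G>(3) using that cover by blast
    then obtain V P' where V: "V \<in> \<F>" "P' \<in> V \<inter> U" "contract P = contract P'"
      unfolding \<F>(3) by blast
    then have "P = P'"
      using bij that by (auto simp: bij_betw_def inj_on_def)
    then show ?thesis
      using V by blast
  qed
  then show "\<exists>\<F>. finite \<F> \<and> \<F> \<subseteq> \<U> \<and> U \<subseteq> \<Union>\<F>"
    using \<F> by blast
qed

section \<open>Localizations up to isomorphism\<close>

text \<open>A localization up to isomorphism: \<phi> inverts S, every element is a numerator divided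
  by some s, and the kernel is S-torsion. The description is independent of the element type of A,
  as the charts need R_f in another type than that of \<open>localization\<close>.\<close>

locale localization_at = mult_system R S + A: cring A
  for R :: "('r, 'n) ring_scheme" (structure) and S and A :: "('a, 'm) ring_scheme" +
  fixes \<phi> :: "'r \<Rightarrow> 'a"
  assumes \<phi>_hom: "\<phi> \<in> ring_hom R A"
    and \<phi>_units: "s \<in> S \<Longrightarrow> \<phi> s \<in> Units A"
    and \<phi>_surj: "x \<in> carrier A \<Longrightarrow> \<exists>s\<in>S. \<exists>a\<in>carrier R. \<phi> s \<otimes>\<^bsub>A\<^esub> x = \<phi> a"
    and \<phi>_ker: "\<lbrakk>z \<in> carrier R; \<phi> z = \<zero>\<^bsub>A\<^esub>\<rbrakk> \<Longrightarrow> \<exists>s\<in>S. s \<otimes> z = \<zero>"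
begin

sublocale \<phi>: ring_hom_cring R A \<phi>
  by unfold_locales (rule \<phi>_hom)

lemma cancel_unit:
  assumes J: "ideal J A" and s: "s \<in> S" and x: "x \<in> carrier A" "\<phi> s \<otimes>\<^bsub>A\<^esub> x \<in> J"
  shows "x \<in> J"
proof -
  have "inv\<^bsub>A\<^esub> \<phi> s \<otimes>\<^bsub>A\<^esub> (\<phi> s \<otimes>\<^bsub>A\<^esub> x) \<in> J"
    using ideal.I_l_closed[OF J x(2)] \<phi>_units[OF s] by simp
  moreover have "inv\<^bsub>A\<^esub> \<phi> s \<otimes>\<^bsub>A\<^esub> (\<phi> s \<otimes>\<^bsub>A\<^esub> x) = x"
    using \<phi>_units[OF s] x(1) s by (simp flip: A.m_assoc)
  ultimately show ?thesis
    by simp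
qed

text \<open>An ideal J of A is the extension of its contraction: multiplied by the image of some s,
  an element of J becomes the image of an element of the contraction, and the unit is cancelled.
  Generators of the contraction thus generate J.\<close>

lemma noetherian_localization:
  assumes "noetherian_ring R"
  shows "noetherian_ring A"
proof (rule A.noetherian_ringI)
  interpret R: noetherian_ring R by fact
  fix J assume J: "ideal J A"
  let ?I = "{r \<in> carrier R. \<phi> r \<in> J}"
  have "ideal ?I R"
    using \<phi>.ring.ideal_vimage[OF J] .
  then obtain B where B: "B \<subseteq> carrier R" "finite B" "?I = Idl\<^bsub>R\<^esub> B"
    using R.finetely_gen by blast
  have \<phi>B: "\<phi> ` B \<subseteq> carrier A"
    using B(1) by auto
  have "J = Idl\<^bsub>A\<^esub> (\<phi> ` B)"
  proof
    show "Idl\<^bsub>A\<^esub> (\<phi> ` B) \<subseteq> J"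
      using B(3) genideal_self[OF B(1)] by (intro A.genideal_minimal[OF J]) blast
    show "J \<subseteq> Idl\<^bsub>A\<^esub> (\<phi> ` B)"
    proof
      have K: "ideal (Idl\<^bsub>A\<^esub> (\<phi> ` B)) A"
        using \<phi>B by (rule A.genideal_ideal)
      have "B \<subseteq> {r \<in> carrier R. \<phi> r \<in> Idl\<^bsub>A\<^esub> (\<phi> ` B)}"
        using B(1) A.genideal_self[OF \<phi>B] by blast
      then have le: "?I \<subseteq> {r \<in> carrier R. \<phi> r \<in> Idl\<^bsub>A\<^esub> (\<phi> ` B)}"
        unfolding B(3) by (intro genideal_minimal \<phi>.ring.ideal_vimage K)
      fix x assume x: "x \<in> J"
      then have xc: "x \<in> carrier A"
        using ideal.Icarr[OF J] by blast
      then obtain s a where s: "s \<in> S" "a \<in> carrier R" "\<phi> s \<otimes>\<^bsub>A\<^esub> x = \<phi> a"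
        using \<phi>_surj by blast
      then have "\<phi> a \<in> J"
        using ideal.I_l_closed[OF J x, of "\<phi> s"] by simp
      then have "\<phi> s \<otimes>\<^bsub>A\<^esub> x \<in> Idl\<^bsub>A\<^esub> (\<phi> ` B)"
        using le s(2,3) by auto
      then show "x \<in> Idl\<^bsub>A\<^esub> (\<phi> ` B)"
        by (rule cancel_unit[OF K s(1) xc])
    qed
  qed
  then show "\<exists>B \<subseteq> carrier A. finite B \<and> J = Idl\<^bsub>A\<^esub> B"
    using \<phi>B B(2) by blast
qed

lemma contraction_Spec: "contraction A (\<lambda>_. carrier A) R \<phi>"
  using graded_cring_trivial[OF A.cring_axioms] cring_axioms \<phi>_hom
  by (auto simp: contraction_def contraction_axioms_def)

lemma unit_notin_prime:
  assumes Q: "primeideal Q A" and s: "s \<in> S"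
  shows "\<phi> s \<notin> Q"
proof
  assume "\<phi> s \<in> Q"
  then have "\<one>\<^bsub>A\<^esub> \<in> Q"
    using cancel_unit[OF primeideal.axioms(1)[OF Q] s A.one_closed] s by simp
  then show False
    using ideal.one_imp_carrier[OF primeideal.axioms(1)[OF Q]] primeideal.I_notcarr[OF Q] by simp
qed

lemma mem_prime_iff:
  assumes Q: "primeideal Q A" and s: "s \<in> S" and x: "x \<in> carrier A" "a \<in> carrier R"
    and eq: "\<phi> s \<otimes>\<^bsub>A\<^esub> x = \<phi> a"
  shows "x \<in> Q \<longleftrightarrow> \<phi> a \<in> Q"
  unfolding eq[symmetric]
  using cancel_unit[OF primeideal.axioms(1)[OF Q] s x(1)] s
    ideal.I_l_closed[OF primeideal.axioms(1)[OF Q], of x "\<phi> s"] by auto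

text \<open>The set Q is the extension of P. Everything rests on the inner fact \<open>mem\<close>:
  whether x lies in Q can be decided on any presentation of x as a/s, not just on a favourable
  one.\<close>

lemma prime_extension:
  assumes P: "primeideal P R" and PS: "P \<inter> S = {}"
  defines "Q \<equiv> {x \<in> carrier A. \<exists>s\<in>S. \<exists>a\<in>P. \<phi> s \<otimes>\<^bsub>A\<^esub> x = \<phi> a}"
  shows "primeideal Q A" and "{r \<in> carrier R. \<phi> r \<in> Q} = P"
proof -
  interpret P: primeideal P R by fact
  have P_mult: "t \<otimes> r \<in> P \<longleftrightarrow> r \<in> P" if "t \<in> S" "r \<in> carrier R" for t r
    using P.I_prime[of t r] P.I_l_closed[of r t] that PS by auto
  have mem: "x \<in> Q \<longleftrightarrow> a \<in> P"
    if s: "s \<in> S" "a \<in> carrier R" "x \<in> carrier A" "\<phi> s \<otimes>\<^bsub>A\<^esub> x = \<phi> a" for s a x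
  proof
    assume "x \<in> Q"
    then obtain t b where t: "t \<in> S" "b \<in> P" "\<phi> t \<otimes>\<^bsub>A\<^esub> x = \<phi> b"
      by (auto simp: Q_def)
    have bc: "b \<in> carrier R"
      using t(2) by (rule P.Icarr)
    have "\<phi> (t \<otimes> a) = \<phi> t \<otimes>\<^bsub>A\<^esub> (\<phi> s \<otimes>\<^bsub>A\<^esub> x)"
      using s t(1) by simp
    also have "\<dots> = \<phi> s \<otimes>\<^bsub>A\<^esub> (\<phi> t \<otimes>\<^bsub>A\<^esub> x)"
      using s(1,3) t(1) by (simp add: A.m_lcomm)
    also have "\<dots> = \<phi> (s \<otimes> b)"
      using s(1) t(3) bc by simp
    finally have "\<phi> (t \<otimes> a \<ominus> s \<otimes> b) = \<zero>\<^bsub>A\<^esub>"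
      using s(1,2) t(1) bc by (simp add: minus_eq A.r_neg del: \<phi>.hom_mult)
    \<comment> \<open>Two numerators of x differ, after cross-multiplication, by an element killed
      by some u in S; since P misses S, u can be cancelled modulo P.\<close>
    then obtain u where u: "u \<in> S" "u \<otimes> (t \<otimes> a \<ominus> s \<otimes> b) = \<zero>"
      using \<phi>_ker[of "t \<otimes> a \<ominus> s \<otimes> b"] s(1,2) t(1) bc by auto
    have "t \<otimes> a \<ominus> s \<otimes> b \<in> P"
      using P_mult[OF u(1), of "t \<otimes> a \<ominus> s \<otimes> b"] u(2) s(1,2) t(1) bc P.zero_closed by simp
    moreover have "t \<otimes> a = (t \<otimes> a \<ominus> s \<otimes> b) \<oplus> s \<otimes> b"
      using s(1,2) t(1) bc by (simp add: minus_eq a_assoc l_neg)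
    ultimately have "t \<otimes> a \<in> P"
      using P.a_closed[of "t \<otimes> a \<ominus> s \<otimes> b" "s \<otimes> b"] P.I_l_closed[OF t(2), of s] s(1) by simp
    then show "a \<in> P"
      using P_mult t(1) s(2) by blast
  next
    show "x \<in> Q" if "a \<in> P"
      using s that by (auto simp: Q_def)
  qed
  have Q_ideal: "ideal Q A"
  proof (rule idealI[OF A.ring_axioms])
    show "subgroup Q (add_monoid A)"
    proof (rule A.add.subgroupI)
      show "Q \<subseteq> carrier A"
        by (auto simp: Q_def)
      have "\<zero>\<^bsub>A\<^esub> \<in> Q"
        using mem[of \<one> \<zero> "\<zero>\<^bsub>A\<^esub>"] P.zero_closed by simp
      then show "Q \<noteq> {}"
        by blast
      fix x assume "x \<in> Q"
      then obtain s a where s: "s \<in> S" "a \<in> P" "\<phi> s \<otimes>\<^bsub>A\<^esub> x = \<phi> a" "x \<in> carrier A"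
        by (auto simp: Q_def)
      show "\<ominus>\<^bsub>A\<^esub> x \<in> Q"
        using mem[of s "\<ominus> a" "\<ominus>\<^bsub>A\<^esub> x"] s P.a_inv_closed[OF s(2)] P.Icarr[OF s(2)]
        by (simp add: A.r_minus)
      fix y assume "y \<in> Q"
      then obtain t b where t: "t \<in> S" "b \<in> P" "\<phi> t \<otimes>\<^bsub>A\<^esub> y = \<phi> b" "y \<in> carrier A"
        by (auto simp: Q_def)
      have c: "a \<in> carrier R" "b \<in> carrier R"
        using s t P.Icarr by auto
      have "\<phi> (s \<otimes> t) \<otimes>\<^bsub>A\<^esub> (x \<oplus>\<^bsub>A\<^esub> y) = \<phi> t \<otimes>\<^bsub>A\<^esub> (\<phi> s \<otimes>\<^bsub>A\<^esub> x) \<oplus>\<^bsub>A\<^esub> \<phi> s \<otimes>\<^bsub>A\<^esub> (\<phi> t \<otimes>\<^bsub>A\<^esub> y)"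
        using s(1,4) t(1,4) by (simp add: A.r_distr A.m_ac)
      also have "\<dots> = \<phi> (t \<otimes> a \<oplus> s \<otimes> b)"
        using s t c by simp
      finally show "x \<oplus>\<^bsub>A\<^esub> y \<in> Q"
        using mem[of "s \<otimes> t" "t \<otimes> a \<oplus> s \<otimes> b" "x \<oplus>\<^bsub>A\<^esub> y"] s t c
          P.a_closed[OF P.I_l_closed[OF s(2), of t] P.I_l_closed[OF t(2), of s]] by simp
    qed
    fix x y assume "x \<in> Q" and y: "y \<in> carrier A"
    then obtain s a where s: "s \<in> S" "a \<in> P" "\<phi> s \<otimes>\<^bsub>A\<^esub> x = \<phi> a" "x \<in> carrier A"
      by (auto simp: Q_def)
    obtain t b where t: "t \<in> S" "b \<in> carrier R" "\<phi> t \<otimes>\<^bsub>A\<^esub> y = \<phi> b"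
      using \<phi>_surj[OF y] by blast
    have ac: "a \<in> carrier R"
      using s(2) by (rule P.Icarr)
    have "\<phi> (s \<otimes> t) \<otimes>\<^bsub>A\<^esub> (x \<otimes>\<^bsub>A\<^esub> y) = (\<phi> s \<otimes>\<^bsub>A\<^esub> x) \<otimes>\<^bsub>A\<^esub> (\<phi> t \<otimes>\<^bsub>A\<^esub> y)"
      using s(1,4) t(1) y by (simp add: A.m_ac)
    also have "\<dots> = \<phi> (a \<otimes> b)"
      using s t ac by simp
    finally show "x \<otimes>\<^bsub>A\<^esub> y \<in> Q"
      using mem[of "s \<otimes> t" "a \<otimes> b" "x \<otimes>\<^bsub>A\<^esub> y"] s t y ac P.I_r_closed[OF s(2) t(2)] by simp
    then show "y \<otimes>\<^bsub>A\<^esub> x \<in> Q"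
      using A.m_comm[OF s(4) y] by simp
  qed
  have one: "\<one>\<^bsub>A\<^esub> \<notin> Q"
  proof -
    have "\<one> \<notin> P"
      using PS one_in_S by blast
    then show ?thesis
      using mem[of \<one> \<one> "\<one>\<^bsub>A\<^esub>"] by simp
  qed
  show "primeideal Q A"
  proof (rule primeidealI[OF Q_ideal A.cring_axioms])
    show "carrier A \<noteq> Q"
      using one A.one_closed by blast
    fix x y assume x: "x \<in> carrier A" and y: "y \<in> carrier A" and xy: "x \<otimes>\<^bsub>A\<^esub> y \<in> Q"
    obtain s a where s: "s \<in> S" "a \<in> carrier R" "\<phi> s \<otimes>\<^bsub>A\<^esub> x = \<phi> a"
      using \<phi>_surj[OF x] by blast
    obtain t b where t: "t \<in> S" "b \<in> carrier R" "\<phi> t \<otimes>\<^bsub>A\<^esub> y = \<phi> b"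
      using \<phi>_surj[OF y] by blast
    have "\<phi> (s \<otimes> t) \<otimes>\<^bsub>A\<^esub> (x \<otimes>\<^bsub>A\<^esub> y) = (\<phi> s \<otimes>\<^bsub>A\<^esub> x) \<otimes>\<^bsub>A\<^esub> (\<phi> t \<otimes>\<^bsub>A\<^esub> y)"
      using s(1) x t(1) y by (simp add: A.m_ac)
    also have "\<dots> = \<phi> (a \<otimes> b)"
      using s t by simp
    finally have "a \<otimes> b \<in> P"
      using mem[of "s \<otimes> t" "a \<otimes> b" "x \<otimes>\<^bsub>A\<^esub> y"] s t x y xy by simp
    then show "x \<in> Q \<or> y \<in> Q"
      using P.I_prime[OF s(2) t(2)] mem[OF s(1,2) x s(3)] mem[OF t(1,2) y t(3)] by blast
  qed
  show "{r \<in> carrier R. \<phi> r \<in> Q} = P"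
  proof -
    have "\<phi> r \<in> Q \<longleftrightarrow> r \<in> P" if "r \<in> carrier R" for r
      using mem[of \<one> r "\<phi> r"] that by simp
    then show ?thesis
      using P.Icarr by blast
  qed
qed

text \<open>The classical identification of the spectrum of a localization with the primes missing
  S. For a general S these primes need not form an open set, so openness is assumed; for the powers
  of f they form the basic open set of f.\<close>

lemma contraction_iso_Spec:
  assumes W: "openin (rs_top (Spec R)) {P. primeideal P R \<and> P \<inter> S = {}}"
  shows "contraction_iso A (\<lambda>_. carrier A) R \<phi> (topspace (rs_top (Spec A)))
    {P. primeideal P R \<and> P \<inter> S = {}}"
proof -
  interpret C: contraction A "\<lambda>_. carrier A" R \<phi>
    by (rule contraction_Spec)
  let ?W = "{P. primeideal P R \<and> P \<inter> S = {}}"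
  note Spec = Spec_eq_Proj(1)[OF A.cring_axioms, symmetric]
  have in_W: "C.contract Q \<in> ?W" if "primeideal Q A" for Q
    using C.prime_contract[OF that] unit_notin_prime[OF that] by (auto simp: C.contract_def)
  have ext: "\<exists>Q. primeideal Q A \<and> P = C.contract Q" if "P \<in> ?W" for P
    using that prime_extension(1)[of P] prime_extension(2)[of P, symmetric]
    unfolding C.contract_def by (intro exI conjI) auto
  have le: "Q \<subseteq> Q'" if Q: "primeideal Q A" "primeideal Q' A" "C.contract Q = C.contract Q'" for Q Q'
  proof
    fix x assume x: "x \<in> Q"
    then have xc: "x \<in> carrier A"
      using ideal.Icarr[OF primeideal.axioms(1)[OF Q(1)]] by blast
    then obtain s a where s: "s \<in> S" "a \<in> carrier R" "\<phi> s \<otimes>\<^bsub>A\<^esub> x = \<phi> a"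
      using \<phi>_surj by blast
    have "\<phi> a \<in> Q \<longleftrightarrow> \<phi> a \<in> Q'"
      using Q(3) s(2) by (metis C.mem_contract)
    then show "x \<in> Q'"
      using x mem_prime_iff[OF Q(1) s(1) xc s(2,3)] mem_prime_iff[OF Q(2) s(1) xc s(2,3)] by blast
  qed
  show ?thesis
    unfolding contraction_iso_def contraction_iso_axioms_def Spec topspace_Spec[OF A.cring_axioms]
  proof (intro conjI allI impI contraction_Spec W)
    show "openin (rs_top (Spec A)) {Q. primeideal Q A}"
      using openin_topspace topspace_Spec[OF A.cring_axioms] by metis
    show "bij_betw C.contract {Q. primeideal Q A} ?W"
    proof (rule bij_betw_imageI)
      show "inj_on C.contract {Q. primeideal Q A}"
        using le by (intro inj_onI) (metis mem_Collect_eq subset_antisym)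
      show "C.contract ` {Q. primeideal Q A} = ?W"
        using in_W ext by blast
    qed
    fix V assume "openin (rs_top (Spec A)) V"
    then obtain J where J: "ideal J A" "V = {Q. primeideal Q A \<and> \<not> J \<subseteq> Q}"
      unfolding openin_Spec[OF A.cring_axioms] by blast
    let ?I = "{r \<in> carrier R. \<phi> r \<in> J}"
    have I: "ideal ?I R"
      using \<phi>.ring.ideal_vimage[OF J(1)] .
    \<comment> \<open>Containment of J in a prime can be tested on numerators. Hence the image of
      the open set of J is cut out in \<open>?W\<close> by the contraction of J.\<close>
    have JQ: "J \<subseteq> Q \<longleftrightarrow> ?I \<subseteq> C.contract Q" if Q: "primeideal Q A" for Q
    proof
      show "?I \<subseteq> C.contract Q" if "J \<subseteq> Q"
        using that by (auto simp: C.contract_def)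
      assume I: "?I \<subseteq> C.contract Q"
      show "J \<subseteq> Q"
      proof
        fix x assume x: "x \<in> J"
        then have xc: "x \<in> carrier A"
          using ideal.Icarr[OF J(1)] by blast
        then obtain s a where s: "s \<in> S" "a \<in> carrier R" "\<phi> s \<otimes>\<^bsub>A\<^esub> x = \<phi> a"
          using \<phi>_surj by blast
        then have "\<phi> a \<in> J"
          using ideal.I_l_closed[OF J(1) x, of "\<phi> s"] by simp
        then have "\<phi> a \<in> Q"
          using I s(2) by (auto simp: C.contract_def)
        then show "x \<in> Q"
          using mem_prime_iff[OF Q s(1) xc s(2,3)] by blast
      qed
    qed
    have "C.contract ` V = ?W \<inter> {P. primeideal P R \<and> \<not> ?I \<subseteq> P}"
    proof
      show "C.contract ` V \<subseteq> ?W \<inter> {P. primeideal P R \<and> \<not> ?I \<subseteq> P}"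
        unfolding J(2) using in_W JQ by blast
      show "?W \<inter> {P. primeideal P R \<and> \<not> ?I \<subseteq> P} \<subseteq> C.contract ` V"
      proof
        fix P assume P: "P \<in> ?W \<inter> {P. primeideal P R \<and> \<not> ?I \<subseteq> P}"
        then obtain Q where Q: "primeideal Q A" "P = C.contract Q"
          using ext by blast
        then show "P \<in> C.contract ` V"
          unfolding J(2) using P JQ[OF Q(1)] by blast
      qed
    qed
    moreover have "openin (rs_top (Spec R)) {P. primeideal P R \<and> \<not> ?I \<subseteq> P}"
      unfolding openin_Spec[OF cring_axioms] using I by blast
    ultimately show "openin (rs_top (Spec R)) (C.contract ` V)"
      using W by (simp add: openin_Int)
  next
    fix Q a n f assume Q: "Q \<in> {Q. primeideal Q A}" and a: "a \<in> carrier A"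
      and f: "f \<in> carrier A" "f \<notin> Q"
    obtain s b where s: "s \<in> S" "b \<in> carrier R" "\<phi> s \<otimes>\<^bsub>A\<^esub> a = \<phi> b"
      using \<phi>_surj[OF a] by blast
    obtain t k where t: "t \<in> S" "k \<in> carrier R" "\<phi> t \<otimes>\<^bsub>A\<^esub> f = \<phi> k"
      using \<phi>_surj[OF f(1)] by blast
    have k: "\<phi> k \<notin> Q"
      using mem_prime_iff[of Q t f k] Q t f by blast
    \<comment> \<open>With a = b/s and f = k/t the quotient a/f becomes (t b)/(s k).\<close>
    have "\<phi> (s \<otimes> k) \<otimes>\<^bsub>A\<^esub> a = \<phi> k \<otimes>\<^bsub>A\<^esub> (\<phi> s \<otimes>\<^bsub>A\<^esub> a)"
      using s(1) t(2) a by (simp add: A.m_ac)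
    also have "\<dots> = (\<phi> t \<otimes>\<^bsub>A\<^esub> f) \<otimes>\<^bsub>A\<^esub> \<phi> b"
      using s(3) t(3) by simp
    also have "\<dots> = \<phi> (t \<otimes> b) \<otimes>\<^bsub>A\<^esub> f"
      using s(2) t(1) f(1) by (simp add: A.m_ac)
    finally have "\<phi> (s \<otimes> k) \<otimes>\<^bsub>A\<^esub> a = \<phi> (t \<otimes> b) \<otimes>\<^bsub>A\<^esub> f" .
    moreover have "\<phi> (s \<otimes> k) \<notin> Q"
    proof -
      have "\<phi> s \<otimes>\<^bsub>A\<^esub> \<phi> k \<notin> Q"
        using Q k unit_notin_prime[of Q s] s(1) t(2) primeideal.I_prime[of Q A "\<phi> s" "\<phi> k"] by auto
      then show ?thesis
        using s(1) t(2) by simp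
    qed
    ultimately show "\<exists>b\<in>carrier R. \<exists>k\<in>carrier R. \<phi> k \<notin> Q \<and> \<phi> k \<otimes>\<^bsub>A\<^esub> a = \<phi> b \<otimes>\<^bsub>A\<^esub> f"
      using s t by (intro bexI[of _ "t \<otimes> b"] bexI[of _ "s \<otimes> k"]) auto
  next
    fix Q z u n assume Q: "Q \<in> {Q. primeideal Q A}" and z: "z \<in> carrier R"
      and u: "u \<in> carrier A" "u \<notin> Q" "u \<otimes>\<^bsub>A\<^esub> \<phi> z = \<zero>\<^bsub>A\<^esub>"
    obtain s w where s: "s \<in> S" "w \<in> carrier R" "\<phi> s \<otimes>\<^bsub>A\<^esub> u = \<phi> w"
      using \<phi>_surj[OF u(1)] by blast
    have w: "\<phi> w \<notin> Q"
      using mem_prime_iff[of Q s u w] Q s u by blast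
    \<comment> \<open>With u = w/s the image of w z vanishes in A, so some t in S kills w z in R,
      and t w is the required annihilator.\<close>
    have "\<phi> (w \<otimes> z) = \<phi> s \<otimes>\<^bsub>A\<^esub> (u \<otimes>\<^bsub>A\<^esub> \<phi> z)"
      using s z u(1) by (simp flip: s(3) add: A.m_assoc)
    then have "\<phi> (w \<otimes> z) = \<zero>\<^bsub>A\<^esub>"
      using u(3) s(1) by simp
    then obtain t where t: "t \<in> S" "t \<otimes> (w \<otimes> z) = \<zero>"
      using \<phi>_ker[of "w \<otimes> z"] s z by auto
    have "\<phi> t \<otimes>\<^bsub>A\<^esub> \<phi> w \<notin> Q"
      using Q w unit_notin_prime[of Q t] t(1) s(2) primeideal.I_prime[of Q A "\<phi> t" "\<phi> w"] by auto
    then have "\<phi> (t \<otimes> w) \<notin> Q"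
      using t(1) s(2) by simp
    moreover have "(t \<otimes> w) \<otimes> z = \<zero>"
      using t s z by (simp add: m_assoc)
    ultimately show "\<exists>w\<in>carrier R. \<phi> w \<notin> Q \<and> w \<otimes> z = \<zero>"
      using t s by (intro bexI[of _ "t \<otimes> w"]) auto
  qed
qed

end

text \<open>Copying the ring structure along an injection j into another type gives an isomorphic
  ring, so the three properties of a localization are verified for fractions and pushed through
  j.\<close>

lemma (in mult_system) localization_at_image:
  assumes inj: "inj_on j (carrier (localization A S))"
  shows "localization_at A S (image_ring j (localization A S)) (\<lambda>a. j (fraction A S a \<one>))"
proof -
  let ?L = "localization A S" and ?B = "image_ring j (localization A S)"
  interpret L: cring ?L
    by (rule cring_localization)
  have iso: "j \<in> ring_iso ?L ?B"
    using inj by (rule inj_imp_image_ring_iso)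
  have B: "cring ?B"
    using L.ring_iso_imp_img_cring[OF iso] by (simp add: image_ring_zero[symmetric])
  have jhom: "j \<in> ring_hom ?L ?B"
    using iso by (simp add: ring_iso_def)
  have hom: "(\<lambda>a. fraction A S a \<one>) \<in> ring_hom A ?L"
    by (rule ring_hom_memI)
      (simp_all add: fraction_in_localization localization_mult localization_add localization_one)
  have surj: "carrier ?B = j ` carrier ?L"
    by (rule image_ring_carrier)
  show ?thesis
  proof (intro localization_at.intro localization_at_axioms.intro mult_system_axioms B)
    show "(\<lambda>a. j (fraction A S a \<one>)) \<in> ring_hom A ?B"
      using ring_hom_trans[OF hom jhom] by (simp add: comp_def)
  next
    fix s assume s: "s \<in> S"
    have "fraction A S s \<one> \<otimes>\<^bsub>?L\<^esub> fraction A S \<one> s = \<one>\<^bsub>?L\<^esub>"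
      using s unfolding localization_one by (simp add: localization_mult) (rule fraction_eqI, auto)
    then have "fraction A S s \<one> \<in> Units ?L"
      using s L.m_comm[of "fraction A S s \<one>" "fraction A S \<one> s"] fraction_in_localization
      by (auto simp: Units_def)
    then show "j (fraction A S s \<one>) \<in> Units ?B"
      by (rule ring_hom_Units[OF jhom L.cring_axioms B])
  next
    fix x assume "x \<in> carrier ?B"
    then obtain y where "y \<in> carrier ?L" "x = j y"
      unfolding surj by blast
    then obtain a s where x: "x = j (fraction A S a s)" "a \<in> carrier A" "s \<in> S"
      unfolding localization_carrier by blast
    have "fraction A S s \<one> \<otimes>\<^bsub>?L\<^esub> fraction A S a s = fraction A S a \<one>"
      using x(2,3) by (simp add: localization_mult) (rule fraction_eqI, auto simp: m_ac)
    then have "j (fraction A S s \<one>) \<otimes>\<^bsub>?B\<^esub> x = j (fraction A S a \<one>)"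
      unfolding x(1) using x(2,3) ring_hom_mult[OF jhom] fraction_in_localization
      by (metis S_carrier one_in_S)
    then show "\<exists>s\<in>S. \<exists>a\<in>carrier A. j (fraction A S s \<one>) \<otimes>\<^bsub>?B\<^esub> x = j (fraction A S a \<one>)"
      using x(2,3) by blast
  next
    fix z assume z: "z \<in> carrier A" "j (fraction A S z \<one>) = \<zero>\<^bsub>?B\<^esub>"
    then have "fraction A S z \<one> = fraction A S \<zero> \<one>"
      unfolding image_ring_zero localization_zero
      using inj_onD[OF inj, of "fraction A S z \<one>" "fraction A S \<zero> \<one>"] fraction_in_localization
      by simp
    then show "\<exists>s\<in>S. s \<otimes> z = \<zero>"
      using z(1) by (subst (asm) fraction_eq_iff) auto
  qed
qed

lemma (in cring) mult_system_powers:
  assumes "f \<in> carrier R"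
  shows "mult_system R {f [^] (n::nat) | n. True}"
proof
  show "\<one> \<in> {f [^] (n::nat) | n. True}"
    using nat_pow_0[of f] by (metis (mono_tags, lifting) mem_Collect_eq)
  show "s \<otimes> t \<in> {f [^] (n::nat) | n. True}"
    if "s \<in> {f [^] (n::nat) | n. True}" "t \<in> {f [^] (n::nat) | n. True}" for s t
    using that nat_pow_mult[OF assms] by auto
qed (use assms in auto)

lemma prime_inter_powers:
  assumes "cring R" and P: "primeideal P R" and f: "f \<in> carrier R"
  shows "P \<inter> {f [^]\<^bsub>R\<^esub> (n::nat) | n. True} = {} \<longleftrightarrow> f \<notin> P"
proof -
  interpret graded_cring R "\<lambda>_. carrier R"
    using assms(1) by (rule graded_cring_trivial)
  have "f [^]\<^bsub>R\<^esub> n \<notin> P" if "f \<notin> P" for n :: nat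
  proof (induction n)
    case 0
    show ?case
      using one_notin_prime[OF P] by simp
  next
    case (Suc n)
    then show ?case
      using mult_notin_prime[OF P, of "f [^]\<^bsub>R\<^esub> n" f] f that by simp
  qed
  moreover have "f = f [^]\<^bsub>R\<^esub> (1::nat)"
    using f by simp
  ultimately show ?thesis
    by blast
qed

section \<open>Rees algebras\<close>

lemma (in abelian_monoid) finsum_mem:
  assumes "finite B" "\<zero> \<in> K" "K \<subseteq> carrier G" "\<And>x y. \<lbrakk>x \<in> K; y \<in> K\<rbrakk> \<Longrightarrow> x \<oplus> y \<in> K"
    and "\<And>i. i \<in> B \<Longrightarrow> g i \<in> K"
  shows "(\<Oplus>i\<in>B. g i) \<in> K"
  using assms(1,5)
proof (induction B rule: finite_induct)
  case empty
  show ?case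
    using assms(2) by simp
next
  case (insert i B)
  have "(\<Oplus>j\<in>insert i B. g j) = g i \<oplus> (\<Oplus>j\<in>B. g j)"
    using insert assms(3) by (intro finsum_insert) auto
  then show ?case
    using insert assms(4) by simp
qed

locale rees = cring R for R :: "('a, 'm) ring_scheme" (structure) +
  fixes I :: "nat \<Rightarrow> 'a set"
  assumes family: "graded_family R I"
begin

sublocale UP: UP_cring R "UP R"
  by (rule UP_cring.intro) (rule cring_axioms)

abbreviation S where "S \<equiv> rees_algebra R I"
abbreviation G where "G \<equiv> rees_piece R I"
abbreviation mnm where "mnm \<equiv> monom (UP R)"
abbreviation cf where "cf \<equiv> coeff (UP R)"

lemma I_ideal: "ideal (I n) R"
  and I_0: "I 0 = carrier R"
  using family by (auto simp: graded_family_def)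

lemma I_carrier: "a \<in> I n \<Longrightarrow> a \<in> carrier R"
  using ideal.Icarr[OF I_ideal] .

lemma I_mult: "\<lbrakk>a \<in> I m; b \<in> I n\<rbrakk> \<Longrightarrow> a \<otimes> b \<in> I (m + n)"
  using family ideal_prod.prod[of a "I m" b "I n" R] unfolding graded_family_def by blast

lemma I_zero: "\<zero> \<in> I n"
  and I_add: "\<lbrakk>a \<in> I n; b \<in> I n\<rbrakk> \<Longrightarrow> a \<oplus> b \<in> I n"
  and I_neg: "a \<in> I n \<Longrightarrow> \<ominus> a \<in> I n"
proof -
  interpret ideal "I n" R
    by (rule I_ideal)
  show "\<zero> \<in> I n"
    by (rule zero_closed)
  show "a \<oplus> b \<in> I n" if "a \<in> I n" "b \<in> I n"
    using that by (rule a_closed)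
  show "\<ominus> a \<in> I n" if "a \<in> I n"
    using that by (rule a_inv_closed)
qed

lemma S_carrier: "p \<in> carrier S \<longleftrightarrow> p \<in> carrier (UP R) \<and> (\<forall>n. cf p n \<in> I n)"
  by (simp add: rees_algebra_def)

lemma S_ops:
  "x \<otimes>\<^bsub>S\<^esub> y = x \<otimes>\<^bsub>UP R\<^esub> y" "x \<oplus>\<^bsub>S\<^esub> y = x \<oplus>\<^bsub>UP R\<^esub> y" "\<one>\<^bsub>S\<^esub> = \<one>\<^bsub>UP R\<^esub>" "\<zero>\<^bsub>S\<^esub> = \<zero>\<^bsub>UP R\<^esub>"
  by (simp_all add: rees_algebra_def)

lemma cring_S: "cring S"
proof -
  have "subring (carrier S) (UP R)"
  proof (rule UP.P.subringI)
    fix p q assume p: "p \<in> carrier S" and q: "q \<in> carrier S"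
    \<comment> \<open>In the Cauchy product the degrees add up to i + (n - i) = n, so every summand
      lies in \<open>I n\<close>.\<close>
    have "cf p i \<otimes> cf q (n - i) \<in> I n" if "i \<le> n" for i n
      using I_mult[of "cf p i" i "cf q (n - i)" "n - i"] p q that by (simp add: S_carrier)
    then have "(\<Oplus>i\<in>{..n}. cf p i \<otimes> cf q (n - i)) \<in> I n" for n
      by (intro finsum_mem) (auto intro: I_zero I_add I_carrier)
    then show "p \<otimes>\<^bsub>UP R\<^esub> q \<in> carrier S"
      using p q by (simp add: S_carrier)
  qed (auto simp: S_carrier I_0 I_zero I_neg I_add)
  then have "subcring (carrier S) (UP R)"
    by (rule UP.P.subcringI')
  moreover have "S = UP R\<lparr>carrier := carrier S\<rparr>"
    by (simp add: rees_algebra_def)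
  ultimately show ?thesis
    using UP.P.subcring_iff[of "carrier S"] subcringE(1) by metis
qed

sublocale S: cring S
  by (rule cring_S)

lemma mnm_S: "a \<in> I n \<Longrightarrow> mnm a n \<in> carrier S"
  using I_carrier[of a n] by (simp add: S_carrier I_zero)

lemma mnm_mult: "\<lbrakk>a \<in> carrier R; b \<in> carrier R\<rbrakk> \<Longrightarrow> mnm a m \<otimes>\<^bsub>S\<^esub> mnm b n = mnm (a \<otimes> b) (m + n)"
  by (simp add: S_ops)

lemma piece_iff: "x \<in> G n \<longleftrightarrow> (\<exists>a\<in>I n. x = mnm a n)"
  by (auto simp: rees_piece_def)

lemma graded_S: "graded_cring S G"
proof (intro graded_cring.intro graded_cring_axioms.intro cring_S)
  show "G n \<subseteq> carrier S" for n
    using mnm_S by (auto simp: piece_iff)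
  show "\<zero>\<^bsub>S\<^esub> \<in> G n" for n
    using I_zero[of n] UP.monom_zero[of n] by (metis S_ops(4) piece_iff)
  show "\<one>\<^bsub>S\<^esub> \<in> G 0"
    using I_0 UP.monom_one by (metis S_ops(3) one_closed piece_iff)
  fix m n x y assume "x \<in> G n"
  then obtain a where a: "a \<in> I n" "x = mnm a n"
    by (auto simp: piece_iff)
  have "mnm (\<ominus> a) n \<oplus>\<^bsub>S\<^esub> x = \<zero>\<^bsub>S\<^esub>"
    using a I_carrier[OF a(1)] by (simp add: S_ops UP.P.l_neg)
  then have "\<ominus>\<^bsub>S\<^esub> x = mnm (\<ominus> a) n"
    using a mnm_S I_neg by (intro S.minus_equality) auto
  then show "\<ominus>\<^bsub>S\<^esub> x \<in> G n"
    using I_neg[OF a(1)] by (auto simp: piece_iff)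
  show "x \<oplus>\<^bsub>S\<^esub> y \<in> G n" if "y \<in> G n"
  proof -
    obtain b where b: "b \<in> I n" "y = mnm b n"
      using \<open>y \<in> G n\<close> by (auto simp: piece_iff)
    have "x \<oplus>\<^bsub>S\<^esub> y = mnm (a \<oplus> b) n"
      using a b I_carrier by (simp add: S_ops)
    then show ?thesis
      using I_add[OF a(1) b(1)] piece_iff by blast
  qed
next
  fix m n x y assume "x \<in> G m" "y \<in> G n"
  then obtain a b where "a \<in> I m" "x = mnm a m" "b \<in> I n" "y = mnm b n"
    by (auto simp: piece_iff)
  then have "x \<otimes>\<^bsub>S\<^esub> y = mnm (a \<otimes> b) (m + n)" "a \<otimes> b \<in> I (m + n)"
    using mnm_mult I_carrier I_mult by auto
  then show "x \<otimes>\<^bsub>S\<^esub> y \<in> G (m + n)"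
    using piece_iff by blast
qed

sublocale C: contraction S G R "rees_unit R"
proof (intro contraction.intro contraction_axioms.intro graded_S cring_axioms)
  show "rees_unit R \<in> ring_hom R S"
    unfolding rees_unit_def
    by (rule ring_hom_memI) (auto simp: S_ops mnm_S I_0 simp flip: UP.monom_mult)
  show "rees_unit R r \<in> G 0" if "r \<in> carrier R" for r
    using that by (auto simp: rees_unit_def piece_iff I_0)
qed

lemma rees_unit: "rees_unit R a = mnm a 0"
  by (simp add: rees_unit_def)

lemma mem_of_monomials:
  assumes p: "p \<in> carrier S" and K: "K \<subseteq> carrier S" "\<zero>\<^bsub>S\<^esub> \<in> K"
    and add: "\<And>x y. \<lbrakk>x \<in> K; y \<in> K\<rbrakk> \<Longrightarrow> x \<oplus>\<^bsub>S\<^esub> y \<in> K"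
    and mnm: "\<And>n. mnm (cf p n) n \<in> K"
  shows "p \<in> K"
proof -
  have "(\<Oplus>\<^bsub>UP R\<^esub>i\<in>{..deg R p}. mnm (cf p i) i) \<in> K"
    using K add mnm by (intro UP.P.finsum_mem) (auto simp: S_ops S_carrier)
  then show ?thesis
    using UP.up_repr[of p] p by (simp add: S_carrier)
qed

lemma ideal_mem_of_monomials:
  assumes "ideal K S" "p \<in> carrier S" "\<And>n. mnm (cf p n) n \<in> K"
  shows "p \<in> K"
proof -
  interpret K: ideal K S by fact
  show ?thesis
    using assms(2,3) K.Icarr by (intro mem_of_monomials[of p K] K.a_closed K.zero_closed) auto
qed

text \<open>The intersection of q R[t] with the Rees algebra. For a prime q \<noteq> M it turns out
  to be the only point of Proj over q.\<close>

definition coeffs_in :: "'a set \<Rightarrow> (nat \<Rightarrow> 'a) set" where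
  "coeffs_in q = {p \<in> carrier S. \<forall>n. cf p n \<in> q}"

lemma S_neg: "p \<in> carrier S \<Longrightarrow> \<ominus>\<^bsub>S\<^esub> p = \<ominus>\<^bsub>UP R\<^esub> p"
  by (rule S.minus_equality) (auto simp: S_ops S_carrier I_neg UP.P.l_neg)

lemma coeffs_in_ideal:
  assumes q: "ideal q R"
  shows "ideal (coeffs_in q) S"
proof (rule idealI[OF S.ring_axioms])
  interpret q: ideal q R by fact
  show "subgroup (coeffs_in q) (add_monoid S)"
  proof (rule S.add.subgroupI)
    show "coeffs_in q \<noteq> {}"
      using S.zero_closed by (auto simp: coeffs_in_def S_ops)
    show "\<ominus>\<^bsub>S\<^esub> p \<in> coeffs_in q" if "p \<in> coeffs_in q" for p
    proof -
      have "\<ominus>\<^bsub>S\<^esub> p \<in> carrier S"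
        using that by (auto simp: coeffs_in_def)
      then show ?thesis
        using that by (auto simp: coeffs_in_def S_neg S_carrier)
    qed
    show "p \<oplus>\<^bsub>S\<^esub> r \<in> coeffs_in q" if "p \<in> coeffs_in q" "r \<in> coeffs_in q" for p r
    proof -
      have "p \<oplus>\<^bsub>S\<^esub> r \<in> carrier S"
        using that by (auto simp: coeffs_in_def)
      then show ?thesis
        using that by (auto simp: coeffs_in_def S_ops S_carrier)
    qed
  qed (auto simp: coeffs_in_def)
  fix p x assume p: "p \<in> coeffs_in q" and x: "x \<in> carrier S"
  have "(\<Oplus>i\<in>{..n}. cf x i \<otimes> cf p (n - i)) \<in> q" for n
    by (rule finsum_mem) (use p x q.Icarr in \<open>auto simp: coeffs_in_def S_carrier intro: q.I_l_closed q.a_closed\<close>)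
  then show "x \<otimes>\<^bsub>S\<^esub> p \<in> coeffs_in q"
    using p x S.m_closed[of x p] by (auto simp: coeffs_in_def S_ops S_carrier)
  then show "p \<otimes>\<^bsub>S\<^esub> x \<in> coeffs_in q"
    using S.m_comm[of p x] p x by (auto simp: coeffs_in_def)
qed

text \<open>The argument of Gauss's lemma: if neither factor has all its coefficients in q, take the
  first offending indices i and j; modulo q the coefficient of degree i + j of the product is the
  product of the two offending coefficients.\<close>

lemma coeffs_in_prime:
  assumes q: "primeideal q R"
  shows "primeideal (coeffs_in q) S"
proof (rule primeidealI[OF coeffs_in_ideal cring_S])
  interpret q: primeideal q R by fact
  show "ideal q R"
    by (rule q.is_ideal)
  have "\<one>\<^bsub>S\<^esub> \<notin> coeffs_in q"
    using C.R.one_notin_prime[OF q] by (auto simp: coeffs_in_def S_ops)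
  then show "carrier S \<noteq> coeffs_in q"
    using S.one_closed by blast
  fix x y assume x: "x \<in> carrier S" and y: "y \<in> carrier S" and xy: "x \<otimes>\<^bsub>S\<^esub> y \<in> coeffs_in q"
  have c: "cf x i \<in> carrier R" "cf y i \<in> carrier R" for i
    using x y by (simp_all add: S_carrier)
  show "x \<in> coeffs_in q \<or> y \<in> coeffs_in q"
  proof (rule ccontr)
    assume neg: "\<not> (x \<in> coeffs_in q \<or> y \<in> coeffs_in q)"
    define i where "i = (LEAST i. cf x i \<notin> q)"
    define j where "j = (LEAST j. cf y j \<notin> q)"
    have ex: "\<exists>i. cf x i \<notin> q" "\<exists>j. cf y j \<notin> q"
      using neg x y by (auto simp: coeffs_in_def)
    have i: "cf x i \<notin> q" "\<And>k. k < i \<Longrightarrow> cf x k \<in> q"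
      unfolding i_def using LeastI_ex[OF ex(1)] not_less_Least[of _ "\<lambda>i. cf x i \<notin> q"] by blast+
    have j: "cf y j \<notin> q" "\<And>k. k < j \<Longrightarrow> cf y k \<in> q"
      unfolding j_def using LeastI_ex[OF ex(2)] not_less_Least[of _ "\<lambda>j. cf y j \<notin> q"] by blast+
    let ?g = "\<lambda>k. cf x k \<otimes> cf y (i + j - k)"
    let ?rest = "\<Oplus>k\<in>{..i + j} - {i}. ?g k"
    have "cf (x \<otimes>\<^bsub>S\<^esub> y) (i + j) = (\<Oplus>k\<in>insert i ({..i + j} - {i}). ?g k)"
      using x y by (simp add: S_ops S_carrier insert_absorb)
    also have "\<dots> = cf x i \<otimes> cf y j \<oplus> ?rest"
      using c by (subst finsum_insert) auto
    finally have "cf (x \<otimes>\<^bsub>S\<^esub> y) (i + j) = cf x i \<otimes> cf y j \<oplus> ?rest" .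
    moreover have "cf (x \<otimes>\<^bsub>S\<^esub> y) (i + j) \<in> q"
      using xy unfolding coeffs_in_def by blast
    ultimately have sum: "cf x i \<otimes> cf y j \<oplus> ?rest \<in> q"
      by metis
    \<comment> \<open>For k \<noteq> i either k < i, and the first factor lies in q by the choice of
      i, or i + j - k < j, and the second factor does by the choice of j.\<close>
    have "?g k \<in> q" if "k \<in> {..i + j} - {i}" for k
    proof (cases "k < i")
      case True
      then show ?thesis
        using i(2) c q.I_r_closed by blast
    next
      case False
      then have "i + j - k < j"
        using that by auto
      then show ?thesis
        using j(2) c q.I_l_closed by blast
    qed
    then have rest: "?rest \<in> q"
      by (intro finsum_mem) (auto intro: q.a_closed q.Icarr)
    have "cf x i \<otimes> cf y j = (cf x i \<otimes> cf y j \<oplus> ?rest) \<oplus> \<ominus> ?rest"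
      using c q.Icarr[OF rest] by (simp add: a_assoc r_neg)
    then have "cf x i \<otimes> cf y j \<in> q"
      using q.a_closed[OF sum q.a_inv_closed[OF rest]] by simp
    then show False
      using C.R.mult_notin_prime[OF q c i(1) j(1)] by blast
  qed
qed

lemma mnm_coeffs_in: "\<lbrakk>a \<in> I n; ideal q R\<rbrakk> \<Longrightarrow> mnm a n \<in> coeffs_in q \<longleftrightarrow> a \<in> q"
  using mnm_S[of a n] I_carrier[of a n] additive_subgroup.zero_closed[OF ideal.axioms(1)]
  by (auto simp: coeffs_in_def)

lemma proj_point_homogeneous:
  assumes "P \<in> proj_points S G"
  shows "P = Idl\<^bsub>S\<^esub> {x. \<exists>n. \<exists>a\<in>I n. x = mnm a n \<and> mnm a n \<in> P}"
proof -
  have "P \<inter> (\<Union>n. G n) = {x. \<exists>n. \<exists>a\<in>I n. x = mnm a n \<and> mnm a n \<in> P}"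
    unfolding piece_iff[abs_def] set_eq_iff Int_iff UN_iff mem_Collect_eq by blast
  moreover have "P = Idl\<^bsub>S\<^esub> (P \<inter> (\<Union>n. G n))"
    using assms unfolding proj_points_def by blast
  ultimately show ?thesis
    by metis
qed

lemma proj_point_positive:
  assumes "P \<in> proj_points S G"
  shows "\<exists>d>0. \<exists>c\<in>I d. mnm c d \<notin> P"
proof (rule ccontr)
  assume neg: "\<not> (\<exists>d>0. \<exists>c\<in>I d. mnm c d \<notin> P)"
  have "ideal P S"
    using C.proj_points_prime[OF assms] by (rule primeideal.axioms(1))
  moreover have "(\<Union>n\<in>{0<..}. G n) \<subseteq> P"
  proof
    fix x assume "x \<in> (\<Union>n\<in>{0<..}. G n)"
    then obtain d where "d > 0" "x \<in> G d"
      by blast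
    then show "x \<in> P"
      using neg piece_iff[of x d] by metis
  qed
  ultimately have "irrelevant_ideal S G \<subseteq> P"
    unfolding irrelevant_ideal_def by (rule S.genideal_minimal)
  then show False
    using assms unfolding proj_points_def by blast
qed

end

section \<open>Primes of a quotient ring\<close>

text \<open>Representatives of one coset differ by an element of J, hence of P, so passing to cosets
  loses no information about membership in P.\<close>

lemma (in cring) quotient_image_mem_iff:
  assumes J: "ideal J R" and P: "ideal P R" "J \<subseteq> P" and x: "x \<in> carrier R"
  shows "J +> x \<in> (+>) J ` P \<longleftrightarrow> x \<in> P"
proof
  interpret J: ideal J R by fact
  interpret P: ideal P R by fact
  assume "J +> x \<in> (+>) J ` P"
  then obtain y where y: "y \<in> P" "J +> x = J +> y"
    by blast
  then have "x \<in> J +> y"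
    using J.a_rcos_self[OF x] by simp
  then obtain j where "j \<in> J" "x = j \<oplus> y"
    by (auto simp: a_r_coset_def')
  then show "x \<in> P"
    using P(2) y(1) P.a_closed by blast
qed blast

lemma (in cring) primeideal_quotient_image:
  assumes J: "ideal J R" and P: "primeideal P R" "J \<subseteq> P"
  shows "primeideal ((+>) J ` P) (R Quot J)"
proof -
  interpret J: ideal J R by fact
  interpret P: primeideal P R by fact
  note mem = quotient_image_mem_iff[OF J P.is_ideal P(2)]
  have carr: "\<exists>x\<in>carrier R. X = J +> x" if "X \<in> carrier (R Quot J)" for X
    using that by (auto simp: FactRing_def A_RCOSETS_def')
  show ?thesis
  proof (rule primeidealI)
    show "ideal ((+>) J ` P) (R Quot J)"
      by (rule ring_ideal_imp_quot_ideal[OF J P.is_ideal])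
    show "cring (R Quot J)"
      by (rule J.quotient_is_cring[OF cring_axioms])
    have "J +> \<one> \<notin> (+>) J ` P"
      using mem[OF one_closed] P.one_imp_carrier P.I_notcarr by blast
    moreover have "J +> \<one> \<in> carrier (R Quot J)"
      using ring_hom_closed[OF J.rcos_ring_hom] by simp
    ultimately show "carrier (R Quot J) \<noteq> (+>) J ` P"
      by blast
    fix X Y assume "X \<in> carrier (R Quot J)" "Y \<in> carrier (R Quot J)"
      and XY: "X \<otimes>\<^bsub>R Quot J\<^esub> Y \<in> (+>) J ` P"
    from carr[OF this(1)] carr[OF this(2)]
    obtain x y where x: "x \<in> carrier R" "X = J +> x" and y: "y \<in> carrier R" "Y = J +> y"
      by (elim bexE)
    have "J +> (x \<otimes> y) \<in> (+>) J ` P"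
      using XY ring_hom_mult[OF J.rcos_ring_hom x(1) y(1)] x y by simp
    then have "x \<in> P \<or> y \<in> P"
      using mem[of "x \<otimes> y"] x y P.I_prime by simp
    then show "X \<in> (+>) J ` P \<or> Y \<in> (+>) J ` P"
      using x y by blast
  qed
qed

text \<open>The images of P and N form a chain of length one. Its inclusion stays strict because J
  is contained in P, so an element of N outside P has its coset outside the image of P.\<close>

lemma krull_dim_quotient_ge_1:
  assumes A: "cring A" and J: "ideal J A" and P: "primeideal P A" "J \<subseteq> P" and N: "primeideal N A" "P \<subset> N"
  shows "1 \<le> krull_dim (A Quot J)"
proof -
  interpret cring A by fact
  let ?C = "\<lambda>i::nat. (+>\<^bsub>A\<^esub>) J ` (if i = 0 then P else N)"
  obtain x where x: "x \<in> N" "x \<notin> P"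
    using N(2) by blast
  then have "x \<in> carrier A"
    using ideal.Icarr[OF primeideal.axioms(1)[OF N(1)]] by blast
  then have "J +>\<^bsub>A\<^esub> x \<notin> ?C 0"
    using quotient_image_mem_iff[OF J primeideal.axioms(1)[OF P(1)] P(2)] x(2) by simp
  moreover have "J +>\<^bsub>A\<^esub> x \<in> ?C (Suc 0)"
    using x(1) by simp
  moreover have "?C 0 \<subseteq> ?C (Suc 0)"
    using image_mono[of P N "(+>\<^bsub>A\<^esub>) J"] N(2) by simp
  ultimately have strict: "?C 0 \<subset> ?C (Suc 0)"
    by blast
  have "J \<subseteq> N"
    using P(2) N(2) by blast
  then have "primeideal (?C i) (A Quot J)" for i
    using primeideal_quotient_image[OF J P] primeideal_quotient_image[OF J N(1)] by simp
  moreover have "?C i \<subset> ?C (Suc i)" if "i < 1" for i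
    using strict that by simp
  ultimately have "(\<forall>i\<le>1. primeideal (?C i) (A Quot J)) \<and> (\<forall>i<1. ?C i \<subset> ?C (Suc i))"
    by blast
  then have "1 \<in> {n. \<exists>C :: nat \<Rightarrow> 'a set set.
      (\<forall>i\<le>n. primeideal (C i) (A Quot J)) \<and> (\<forall>i<n. C i \<subset> C (Suc i))}"
    by (intro CollectI exI[of _ ?C])
  then have "ereal (real 1) \<le> krull_dim (A Quot J)"
    unfolding krull_dim_def by (rule SUP_upper)
  then show ?thesis
    by (simp add: one_ereal_def)
qed

section \<open>The projection from Proj of the Rees algebra\<close>

locale rees_primary = rees R I for R :: "('a, 'm) ring_scheme" (structure) and I +
  fixes M
  assumes M_max: "maximalideal M R"
    and radical_I: "n > 0 \<Longrightarrow> radical R (I n) = M"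
begin

lemma M_prime: "primeideal M R"
  by (rule maximalideal_prime[OF M_max])

lemma contract_mem: "a \<in> carrier R \<Longrightarrow> a \<in> C.contract P \<longleftrightarrow> mnm a 0 \<in> P"
  by (simp add: C.contract_def rees_unit)

lemma prime_eq_M:
  assumes "primeideal q R" "M \<subseteq> q"
  shows "q = M"
  using maximalideal.I_maximal[OF M_max primeideal.axioms(1)[OF assms(1)] assms(2)]
    primeideal.I_notcarr[OF assms(1)] additive_subgroup.a_subset
    ideal.axioms(1)[OF primeideal.axioms(1)[OF assms(1)]] by metis

lemma pow_notin_prime:
  assumes "primeideal q R" "a \<in> carrier R" "a \<notin> q"
  shows "a [^] (k::nat) \<notin> q"
  using prime_inter_powers[OF cring_axioms assms(1,2)] assms(3) by blast

text \<open>If a prime contains \<open>I n\<close> with n > 0, it contains the radical M and equals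
  M by maximality. In degree 0 the ideal is all of R.\<close>

lemma exists_I_notin:
  assumes q: "primeideal q R" "q \<noteq> M"
  shows "\<exists>b\<in>I n. b \<notin> q"
proof (cases "n = 0")
  case True
  then show ?thesis
    using I_0 C.R.one_notin_prime[OF q(1)] by auto
next
  case False
  show ?thesis
  proof (rule ccontr)
    assume "\<not> (\<exists>b\<in>I n. b \<notin> q)"
    then have sub: "I n \<subseteq> q"
      by blast
    have "M \<subseteq> q"
    proof
      fix a assume "a \<in> M"
      then obtain k :: nat where "a \<in> carrier R" "a [^] k \<in> I n"
        using radical_I[of n] False by (auto simp: radical_def)
      then show "a \<in> q"
        using pow_notin_prime[OF q(1), of a k] sub by blast
    qed
    then show False
      using prime_eq_M[OF q(1)] q(2) by blast
  qed
qed

text \<open>For a homogeneous prime over \<open>q \<noteq> M\<close> each \<open>I n\<close> contains some \<open>b\<close> outside \<open>q\<close>, and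
  \<open>b (a t^n) = a (b t^n)\<close> decides membership in one direction. In the other direction, a power of
  \<open>a t^n\<close> is compared in its degree with a power of some \<open>c t^d\<close> outside the prime.\<close>

lemma mem_of_contract:
  assumes P: "P \<in> proj_points S G" "C.contract P \<noteq> M" and a: "a \<in> I n" "a \<in> C.contract P"
  shows "mnm a n \<in> P"
proof -
  have prime: "primeideal P S"
    using C.proj_points_prime[OF P(1)] .
  obtain b where b: "b \<in> I n" "b \<notin> C.contract P"
    using exists_I_notin[OF C.prime_contract[OF prime] P(2)] by blast
  have c: "a \<in> carrier R" "b \<in> carrier R"
    using I_carrier a b by auto
  have "mnm b 0 \<otimes>\<^bsub>S\<^esub> mnm a n = mnm a 0 \<otimes>\<^bsub>S\<^esub> mnm b n"
    using c by (simp add: mnm_mult m_comm del: UP.monom_mult)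
  moreover have "mnm a 0 \<otimes>\<^bsub>S\<^esub> mnm b n \<in> P"
    using a(2) c contract_mem mnm_S[OF b(1)]
    by (intro ideal.I_r_closed[OF primeideal.axioms(1)[OF prime]]) auto
  moreover have "mnm b 0 \<notin> P"
    using b(2) c contract_mem by blast
  ultimately show ?thesis
    using primeideal.I_prime[OF prime, of "mnm b 0" "mnm a n"] mnm_S[OF a(1)] mnm_S[of b 0] c I_0 by auto
qed

lemma I_pow: "a \<in> I n \<Longrightarrow> a [^] (k::nat) \<in> I (n * k)"
proof (induction k)
  case 0
  then show ?case
    by (simp add: I_0)
next
  case (Suc k)
  then show ?case
    using I_mult[of "a [^] k" "n * k" a n] by (simp add: add.commute)
qed

lemma contract_of_mem:
  assumes P: "P \<in> proj_points S G" "C.contract P \<noteq> M" and a: "a \<in> I n" "mnm a n \<in> P"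
  shows "a \<in> C.contract P"
proof -
  have prime: "primeideal P S"
    using C.proj_points_prime[OF P(1)] .
  note qprime = C.prime_contract[OF prime]
  obtain d c where d: "d > 0" "c \<in> I d" "mnm c d \<notin> P"
    using proj_point_positive[OF P(1)] by blast
  have cc: "a \<in> carrier R" "c \<in> carrier R"
    using I_carrier a d by auto
  have c_pow: "mnm (c [^] k) (d * k) \<notin> P" for k :: nat
  proof (induction k)
    case 0
    show ?case
      using C.one_notin_prime[OF prime] by (simp add: S_ops)
  next
    case (Suc k)
    have "mnm (c [^] Suc k) (d * Suc k) = mnm (c [^] k) (d * k) \<otimes>\<^bsub>S\<^esub> mnm c d"
      using cc by (simp add: mnm_mult add.commute del: UP.monom_mult)
    then show ?case
      using Suc C.mult_notin_prime[OF prime mnm_S[OF I_pow[OF d(2)]] mnm_S[OF d(2)] _ d(3), of k] by simp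
  qed
  \<comment> \<open>A positive exponent d is essential: one factor of the power is then
    \<open>mnm a n\<close> itself, which puts the power into P.\<close>
  obtain e where e: "d = Suc e"
    using d(1) by (cases d) auto
  have "mnm (a [^] d) (n * d) = mnm (a [^] e) (n * e) \<otimes>\<^bsub>S\<^esub> mnm a n"
    using cc by (simp add: e mnm_mult add.commute del: UP.monom_mult)
  then have a_pow: "mnm (a [^] d) (n * d) \<in> P"
    using ideal.I_l_closed[OF primeideal.axioms(1)[OF prime] a(2) mnm_S[OF I_pow[OF a(1), of e]]]
    by simp
  \<comment> \<open>The exponents d and n bring the powers of both monomials into degree n d, where
    the scalar factors can be exchanged.\<close>
  have "mnm (a [^] d) 0 \<otimes>\<^bsub>S\<^esub> mnm (c [^] n) (d * n) = mnm (c [^] n) 0 \<otimes>\<^bsub>S\<^esub> mnm (a [^] d) (n * d)"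
    using cc by (simp add: mnm_mult m_comm mult.commute del: UP.monom_mult)
  moreover have "mnm (c [^] n) 0 \<otimes>\<^bsub>S\<^esub> mnm (a [^] d) (n * d) \<in> P"
    using a_pow mnm_S[of "c [^] n" 0] cc I_0
    by (intro ideal.I_l_closed[OF primeideal.axioms(1)[OF prime]]) auto
  ultimately have "mnm (a [^] d) 0 \<in> P"
    using c_pow[of n] primeideal.I_prime[OF prime, of "mnm (a [^] d) 0" "mnm (c [^] n) (d * n)"]
      mnm_S[OF I_pow[OF d(2)]] mnm_S[of "a [^] d" 0] cc I_0 by auto
  then have "a [^] d \<in> C.contract P"
    using contract_mem[of "a [^] d" P] cc by simp
  then show ?thesis
    using pow_notin_prime[OF qprime cc(1)] by blast
qed

lemma coeffs_in_proj_point: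
  assumes q: "primeideal q R" "q \<noteq> M"
  shows "coeffs_in q \<in> proj_points S G" and "C.contract (coeffs_in q) = q"
proof -
  interpret q: primeideal q R by fact
  have prime: "primeideal (coeffs_in q) S"
    by (rule coeffs_in_prime[OF q(1)])
  have carr: "coeffs_in q \<inter> (\<Union>n. G n) \<subseteq> carrier S"
    by (auto simp: coeffs_in_def)
  have "coeffs_in q \<subseteq> Idl\<^bsub>S\<^esub> (coeffs_in q \<inter> (\<Union>n. G n))"
  proof
    fix p assume p: "p \<in> coeffs_in q"
    show "p \<in> Idl\<^bsub>S\<^esub> (coeffs_in q \<inter> (\<Union>n. G n))"
    proof (rule ideal_mem_of_monomials)
      show "ideal (Idl\<^bsub>S\<^esub> (coeffs_in q \<inter> (\<Union>n. G n))) S"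
        by (rule S.genideal_ideal[OF carr])
      show "p \<in> carrier S"
        using p by (simp add: coeffs_in_def)
      fix n
      have "cf p n \<in> I n" "cf p n \<in> q"
        using p by (auto simp: coeffs_in_def S_carrier)
      then have "mnm (cf p n) n \<in> coeffs_in q \<inter> (\<Union>n. G n)"
        using mnm_coeffs_in[of "cf p n" n q] q.is_ideal piece_iff by blast
      then show "mnm (cf p n) n \<in> Idl\<^bsub>S\<^esub> (coeffs_in q \<inter> (\<Union>n. G n))"
        using S.genideal_self[OF carr] by blast
    qed
  qed
  moreover have "Idl\<^bsub>S\<^esub> (coeffs_in q \<inter> (\<Union>n. G n)) \<subseteq> coeffs_in q"
    using primeideal.axioms(1)[OF prime] by (intro S.genideal_minimal) auto
  ultimately have hom: "coeffs_in q = Idl\<^bsub>S\<^esub> (coeffs_in q \<inter> (\<Union>n. G n))"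
    by (rule equalityI)
  \<comment> \<open>An element of \<open>I 1\<close> outside q gives a monomial of positive degree
    outside \<open>coeffs_in q\<close>, so the irrelevant ideal is not contained in it.\<close>
  obtain b where b: "b \<in> I 1" "b \<notin> q"
    using exists_I_notin[OF q] by blast
  have pos: "(\<Union>n\<in>{0<..}. G n) \<subseteq> carrier S"
    using C.piece_sub by blast
  have "mnm b 1 \<in> irrelevant_ideal S G"
    unfolding irrelevant_ideal_def using S.genideal_self[OF pos] b(1) piece_iff[of "mnm b 1" 1] by force
  moreover have "mnm b 1 \<notin> coeffs_in q"
    using mnm_coeffs_in[OF b(1) q.is_ideal] b(2) by simp
  ultimately have "\<not> irrelevant_ideal S G \<subseteq> coeffs_in q"
    by blast
  then show "coeffs_in q \<in> proj_points S G"
    unfolding proj_points_def using prime hom by blast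
  have "r \<in> C.contract (coeffs_in q) \<longleftrightarrow> r \<in> q" if "r \<in> carrier R" for r
    using contract_mem[OF that] mnm_coeffs_in[of r 0 q] that q.is_ideal I_0 by simp
  moreover have "C.contract (coeffs_in q) \<subseteq> carrier R"
    by (auto simp: C.contract_def)
  ultimately show "C.contract (coeffs_in q) = q"
    using q.Icarr by blast
qed

text \<open>Over q \<noteq> M the homogeneous elements of a point are exactly the a t^n with a in q,
  and a homogeneous ideal is generated by its homogeneous elements; so the contraction determines
  the point.\<close>

lemma proj_point_le:
  assumes P: "P \<in> proj_points S G" "C.contract P \<noteq> M"
    and Q: "Q \<in> proj_points S G" and eq: "C.contract P = C.contract Q"
  shows "P \<subseteq> Q"
proof -
  have Q': "C.contract Q \<noteq> M"
    using P eq by simp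
  have "Idl\<^bsub>S\<^esub> {x. \<exists>n. \<exists>a\<in>I n. x = mnm a n \<and> mnm a n \<in> P} \<subseteq> Q"
    using contract_of_mem[OF P] mem_of_contract[OF Q Q'] eq
      primeideal.axioms(1)[OF C.proj_points_prime[OF Q]]
    by (intro S.genideal_minimal) auto
  then show ?thesis
    using proj_point_homogeneous[OF P(1)] by simp
qed

lemma proj_point_eq_coeffs_in:
  assumes P: "P \<in> proj_points S G" "C.contract P \<noteq> M"
  shows "P = coeffs_in (C.contract P)"
proof -
  note q = coeffs_in_proj_point[OF C.prime_contract[OF C.proj_points_prime[OF P(1)]] P(2)]
  show ?thesis
    using proj_point_le[OF P q(1)] proj_point_le[OF q(1) _ P(1)] q(2) P(2) by simp
qed

lemma contract_neq_M:
  assumes P: "P \<in> proj_points S G"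
    and dim: "krull_dim (S Quot (Idl\<^bsub>S\<^esub> (rees_unit R ` M))) = 0"
  shows "C.contract P \<noteq> M"
proof
  assume PM: "C.contract P = M"
  interpret M: primeideal M R
    by (rule M_prime)
  have prime: "primeideal P S"
    using C.proj_points_prime[OF P] .
  have uM: "rees_unit R ` M \<subseteq> carrier S"
    using M.Icarr by auto
  \<comment> \<open>The homogeneous maximal ideal, written as the preimage of M under the constant
    coefficient map, so that primality is inherited from M.\<close>
  let ?N = "{p \<in> carrier S. cf p 0 \<in> M}"
  have c0: "cf p 0 \<in> carrier R" if "p \<in> carrier S" for p
    using that by (simp add: S_carrier)
  have hom: "(\<lambda>p. cf p 0) \<in> ring_hom S R"
    by (rule ring_hom_memI) (auto simp: S_ops S_carrier)
  have N: "primeideal ?N S"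
    using ring_hom_ring.primeideal_vimage[OF ring_hom_ringI2[OF S.ring_axioms ring_axioms hom] cring_S M_prime] .
  have "Idl\<^bsub>S\<^esub> {x. \<exists>n. \<exists>a\<in>I n. x = mnm a n \<and> mnm a n \<in> P} \<subseteq> ?N"
  proof (rule S.genideal_minimal[OF primeideal.axioms(1)[OF N]], rule subsetI)
    fix x assume "x \<in> {x. \<exists>n. \<exists>a\<in>I n. x = mnm a n \<and> mnm a n \<in> P}"
    then obtain n a where a: "a \<in> I n" "x = mnm a n" "mnm a n \<in> P"
      by blast
    have "cf x 0 \<in> M"
    proof (cases "n = 0")
      case True
      then show ?thesis
        using a PM contract_mem[of a P] I_carrier[OF a(1)] by simp
    next
      case False
      then show ?thesis
        using a I_carrier[OF a(1)] M.zero_closed by simp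
    qed
    then show "x \<in> ?N"
      using a mnm_S by simp
  qed
  then have "P \<subseteq> ?N"
    using proj_point_homogeneous[OF P] by simp
  \<comment> \<open>A monomial of positive degree outside P has constant coefficient zero; it makes
    the inclusion of P in \<open>?N\<close> strict.\<close>
  moreover obtain d c where d: "d > 0" "c \<in> I d" "mnm c d \<notin> P"
    using proj_point_positive[OF P] by blast
  then have "mnm c d \<in> ?N"
    using mnm_S[OF d(2)] I_carrier[OF d(2)] M.zero_closed by simp
  ultimately have "P \<subset> ?N"
    using d(3) by blast
  moreover have "Idl\<^bsub>S\<^esub> (rees_unit R ` M) \<subseteq> P"
    using PM primeideal.axioms(1)[OF prime]
    by (intro S.genideal_minimal) (auto simp: C.contract_def)
  ultimately have "1 \<le> krull_dim (S Quot (Idl\<^bsub>S\<^esub> (rees_unit R ` M)))"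
    using krull_dim_quotient_ge_1[OF cring_S S.genideal_ideal[OF uM] prime _ N] by blast
  then show False
    using dim by simp
qed

lemma proj_contraction_iso:
  assumes dim: "krull_dim (S Quot (Idl\<^bsub>S\<^esub> (rees_unit R ` M))) = 0"
  shows "contraction_iso S G R (rees_unit R) (proj_points S G) (topspace (rs_top (Spec R)) - {M})"
proof -
  let ?W = "topspace (rs_top (Spec R)) - {M}"
  have W_iff: "q \<in> ?W \<longleftrightarrow> primeideal q R \<and> q \<noteq> M" for q
    by (simp add: topspace_Spec[OF cring_axioms])
  have W_open: "openin (rs_top (Spec R)) ?W"
  proof -
    have "?W = {q. primeideal q R \<and> \<not> M \<subseteq> q}"
      using prime_eq_M W_iff by blast
    then show ?thesis
      unfolding openin_Spec[OF cring_axioms] using primeideal.axioms(1)[OF M_prime] by blast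
  qed
  note neq = contract_neq_M[OF _ dim]
  have in_W: "C.contract P \<in> ?W" if "P \<in> proj_points S G" for P
    using neq[OF that] C.prime_contract[OF C.proj_points_prime[OF that]] W_iff by blast
  show ?thesis
    unfolding contraction_iso_def contraction_iso_axioms_def
  proof (intro conjI allI impI C.contraction_axioms W_open)
    show "openin (rs_top (Proj S G)) (proj_points S G)"
      using openin_topspace C.topspace_Proj by metis
    show "bij_betw C.contract (proj_points S G) ?W"
    proof (rule bij_betwI[of _ _ _ coeffs_in])
      show "C.contract \<in> proj_points S G \<rightarrow> ?W"
        using in_W by blast
      show "coeffs_in \<in> ?W \<rightarrow> proj_points S G"
        using coeffs_in_proj_point(1) W_iff by blast
      show "coeffs_in (C.contract P) = P" if "P \<in> proj_points S G" for P
        using proj_point_eq_coeffs_in[OF that neq[OF that]] by simp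
      show "C.contract (coeffs_in q) = q" if "q \<in> ?W" for q
        using coeffs_in_proj_point(2) that W_iff by blast
    qed
    fix V assume "openin (rs_top (Proj S G)) V"
    then obtain J where J: "ideal J S" "V = {P \<in> proj_points S G. \<not> J \<subseteq> P}"
      unfolding C.openin_Proj by blast
    \<comment> \<open>The coefficients of elements of J. As P is \<open>coeffs_in\<close> of its
      contraction, J lies in P exactly when all these coefficients lie in the contraction, so they
      cut out the image of an open set.\<close>
    let ?K = "{cf p n | p n. p \<in> J}"
    have Jc: "p \<in> carrier S" if "p \<in> J" for p
      using ideal.Icarr[OF J(1) that] .
    have K: "?K \<subseteq> carrier R"
      using Jc by (auto simp: S_carrier)
    have JP: "J \<subseteq> P \<longleftrightarrow> Idl\<^bsub>R\<^esub> ?K \<subseteq> C.contract P" if P: "P \<in> proj_points S G" for P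
    proof -
      have "J \<subseteq> P \<longleftrightarrow> J \<subseteq> coeffs_in (C.contract P)"
        using proj_point_eq_coeffs_in[OF P neq[OF P]] by simp
      also have "\<dots> \<longleftrightarrow> ?K \<subseteq> C.contract P"
        using Jc unfolding coeffs_in_def by blast
      also have "\<dots> \<longleftrightarrow> Idl\<^bsub>R\<^esub> ?K \<subseteq> C.contract P"
        using genideal_self[OF K] genideal_minimal[of "C.contract P" ?K]
          primeideal.axioms(1)[OF C.prime_contract[OF C.proj_points_prime[OF P]]] by blast
      finally show ?thesis .
    qed
    have "C.contract ` V = ?W \<inter> {q. primeideal q R \<and> \<not> Idl\<^bsub>R\<^esub> ?K \<subseteq> q}"
    proof
      show "C.contract ` V \<subseteq> ?W \<inter> {q. primeideal q R \<and> \<not> Idl\<^bsub>R\<^esub> ?K \<subseteq> q}"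
      proof
        fix q assume "q \<in> C.contract ` V"
        then obtain P where P: "P \<in> proj_points S G" "\<not> J \<subseteq> P" "q = C.contract P"
          unfolding J(2) by blast
        have "q \<in> ?W" "primeideal q R" "\<not> Idl\<^bsub>R\<^esub> ?K \<subseteq> q"
          using P(2) JP[OF P(1)] in_W[OF P(1)] W_iff[of q] unfolding P(3) by blast+
        then show "q \<in> ?W \<inter> {q. primeideal q R \<and> \<not> Idl\<^bsub>R\<^esub> ?K \<subseteq> q}"
          by blast
      qed
      show "?W \<inter> {q. primeideal q R \<and> \<not> Idl\<^bsub>R\<^esub> ?K \<subseteq> q} \<subseteq> C.contract ` V"
      proof
        fix q assume q: "q \<in> ?W \<inter> {q. primeideal q R \<and> \<not> Idl\<^bsub>R\<^esub> ?K \<subseteq> q}"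
        then have q': "primeideal q R" "q \<noteq> M" "\<not> Idl\<^bsub>R\<^esub> ?K \<subseteq> q"
          using W_iff by blast+
        note e = coeffs_in_proj_point[OF q'(1,2)]
        have "coeffs_in q \<in> V"
          unfolding J(2) using e JP[OF e(1)] q'(3) by simp
        then show "q \<in> C.contract ` V"
          using e(2) by (metis imageI)
      qed
    qed
    moreover have "openin (rs_top (Spec R)) {q. primeideal q R \<and> \<not> Idl\<^bsub>R\<^esub> ?K \<subseteq> q}"
      unfolding openin_Spec[OF cring_axioms] using genideal_ideal[OF K] by blast
    ultimately show "openin (rs_top (Spec R)) (C.contract ` V)"
      using openin_Int[OF W_open] by simp
  next
    fix P x n y assume P: "P \<in> proj_points S G" and "x \<in> G n" "y \<in> G n" "y \<notin> P"
    then obtain a f where a: "a \<in> I n" "x = mnm a n" and f: "f \<in> I n" "y = mnm f n" "mnm f n \<notin> P"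
      using piece_iff by auto
    have c: "a \<in> carrier R" "f \<in> carrier R"
      using a f I_carrier by auto
    \<comment> \<open>The coefficient f itself can serve as denominator: if it were in the
      contraction of P, then f t^n would lie in P.\<close>
    have "rees_unit R f \<notin> P"
      using mem_of_contract[OF P neq[OF P] f(1)] f(3) c by (auto simp: C.contract_def)
    moreover have "rees_unit R f \<otimes>\<^bsub>S\<^esub> x = rees_unit R a \<otimes>\<^bsub>S\<^esub> y"
      using a(2) f(2) c by (simp add: rees_unit mnm_mult m_comm del: UP.monom_mult)
    ultimately show "\<exists>b\<in>carrier R. \<exists>k\<in>carrier R. rees_unit R k \<notin> P \<and>
        rees_unit R k \<otimes>\<^bsub>S\<^esub> x = rees_unit R b \<otimes>\<^bsub>S\<^esub> y"
      using c by blast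
  next
    fix P z u n assume P: "P \<in> proj_points S G" and z: "z \<in> carrier R"
      and "u \<in> G n" "u \<notin> P" and uz: "u \<otimes>\<^bsub>S\<^esub> rees_unit R z = \<zero>\<^bsub>S\<^esub>"
    then obtain w where w: "w \<in> I n" "u = mnm w n" "mnm w n \<notin> P"
      using piece_iff by auto
    have wc: "w \<in> carrier R"
      using w I_carrier by auto
    have "rees_unit R w \<notin> P"
      using mem_of_contract[OF P neq[OF P] w(1)] w(3) wc by (auto simp: C.contract_def)
    \<comment> \<open>Comparing coefficients in degree n turns the relation in R[I] into w z = 0 in
      R, so the coefficient w of u is the annihilator sought.\<close>
    moreover have "mnm (w \<otimes> z) n = \<zero>\<^bsub>UP R\<^esub>"
      using uz wc z mnm_mult[of w z n 0] by (simp add: w(2) rees_unit S_ops del: UP.monom_mult)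
    then have "cf (mnm (w \<otimes> z) n) n = \<zero>"
      by (simp del: UP.monom_mult)
    then have "w \<otimes> z = \<zero>"
      using wc z by (simp del: UP.monom_mult)
    ultimately show "\<exists>w\<in>carrier R. rees_unit R w \<notin> P \<and> w \<otimes> z = \<zero>"
      using wc by blast
  qed
qed

end

section \<open>Affine charts of Proj over basic open sets of Spec R\<close>

lemma (in contraction_iso) contraction_iso_restrict:
  assumes V: "openin (rs_top (Proj A G)) V" "V \<subseteq> U"
  shows "contraction_iso A G R \<alpha> V (contract ` V)"
proof (intro contraction_iso.intro contraction_iso_axioms.intro contraction_axioms V(1))
  show "openin (rs_top (Spec R)) (contract ` V)"
    by (rule open_image[OF V])
  show "bij_betw contract V (contract ` V)"
    using bij V(2) inj_on_subset by (auto simp: bij_betw_def)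
  show "openin (rs_top (Spec R)) (contract ` V')" if "openin (rs_top (Proj A G)) V'" "V' \<subseteq> V" for V'
    using open_image[of V'] that V(2) by simp
  show "\<exists>b\<in>carrier R. \<exists>k\<in>carrier R. \<alpha> k \<notin> P \<and> \<alpha> k \<otimes> a = \<alpha> b \<otimes> f"
    if "P \<in> V" "a \<in> G n" "f \<in> G n" "f \<notin> P" for P a f n
    by (rule clear_denominator[OF subsetD[OF V(2) that(1)] that(2-4)])
  show "\<exists>w\<in>carrier R. \<alpha> w \<notin> P \<and> w \<otimes>\<^bsub>R\<^esub> z = \<zero>\<^bsub>R\<^esub>"
    if "P \<in> V" "z \<in> carrier R" "u \<in> G n" "u \<notin> P" "u \<otimes> \<alpha> z = \<zero>" for P z u n
    by (rule torsion[OF subsetD[OF V(2) that(1)] that(2-5)])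
qed

lemma open_subspace_topspace: "open_subspace X (topspace (rs_top X)) = X"
  by (simp add: open_subspace_def)

text \<open>A chart \<open>Spec R_f\<close> counts for \<open>scheme\<close> only if its coordinate ring has elements in the type of
  the sections of \<open>Proj\<close>, so \<open>R_f\<close> is copied into that type.\<close>

definition to_section ::
    "('a \<times> 'a) set \<Rightarrow> (nat \<Rightarrow> 'a) set \<Rightarrow> ((nat \<Rightarrow> 'a) \<times> (nat \<Rightarrow> 'a)) set" where
  "to_section x = (\<lambda>_. map_prod (\<lambda>a _. a) (\<lambda>a _. a) ` x)"

lemma inj_to_section: "inj to_section"
proof (rule injI)
  fix x y :: "('a \<times> 'a) set"
  have "inj (map_prod (\<lambda>a _. a) (\<lambda>a _. a) :: 'a \<times> 'a \<Rightarrow> (nat \<Rightarrow> 'a) \<times> (nat \<Rightarrow> 'a))"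
    by (intro prod.inj_map injI) (metis)+
  moreover assume "to_section x = to_section y"
  then have "(map_prod (\<lambda>a _. a) (\<lambda>a _. a) :: _ \<Rightarrow> (nat \<Rightarrow> 'a) \<times> (nat \<Rightarrow> 'a)) ` x
      = map_prod (\<lambda>a _. a) (\<lambda>a _. a) ` y"
    unfolding to_section_def by metis
  ultimately show "x = y"
    by (simp add: inj_image_eq_iff)
qed

theorem mainTheorem4:
  fixes R :: "('a, 'm) ring_scheme" and I :: "nat \<Rightarrow> 'a set"
  assumes "normal_domain R" and "noetherian_ring R" and "local_ring R"
    and "graded_family_of_primary_ideals R (max_ideal R) I"
    and "analytic_spread R I = 0"
  shows "rs_preimage (Proj_rees R I) (rees_projection R I) {max_ideal R} = {} \<and>
    lrs_isomorphic (Proj_rees R I)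
      (open_subspace (Spec R) (topspace (rs_top (Spec R)) - {max_ideal R})) \<and>
    noetherian_scheme (Proj_rees R I)"
proof -
  define M where "M = max_ideal R"
  have R: "cring R"
    using assms(3) by (simp add: local_ring_def)
  have "\<exists>!M. maximalideal M R"
    using assms(3) unfolding local_ring_def by blast
  then have "maximalideal M R"
    unfolding M_def max_ideal_def by (rule theI')
  moreover have "graded_family R I"
    using assms(4) by (simp add: graded_family_of_primary_ideals_def)
  moreover have "radical R (I n) = M" if "n > 0" for n
    using assms(4) that unfolding graded_family_of_primary_ideals_def M_def by blast
  ultimately interpret rees_primary R I M
    by (intro rees_primary.intro rees.intro rees_axioms.intro rees_primary_axioms.intro R)
  have dim: "krull_dim (S Quot (Idl\<^bsub>S\<^esub> (rees_unit R ` M))) = 0"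
    using assms(5) by (simp add: analytic_spread_def M_def)
  interpret Pi: contraction_iso S G R "rees_unit R" "proj_points S G" "topspace (rs_top (Spec R)) - {M}"
    by (rule proj_contraction_iso[OF dim])
  have Proj: "Proj_rees R I = Proj S G"
    by (simp add: Proj_rees_def)
  have pts: "proj_points S G = topspace (rs_top (Proj S G))"
    by (simp add: C.topspace_Proj)
  have X: "function_sheaf (Proj S G) C.L C.is_fraction"
    by (rule C.function_sheaf_Proj)
  have Spec_sheaf: "function_sheaf (open_subspace (Spec R) W) C.R.L C.R.is_fraction"
    if "openin (rs_top (Spec R)) W" for W
    using function_sheaf.function_sheaf_open_subspace[OF function_sheaf_Spec[OF R] that] .

  have fibre: "rs_preimage (Proj_rees R I) (rees_projection R I) {M} = {}"
  proof -
    have "pt_map (rees_projection R I) = C.contract"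
      by (simp add: rees_projection_def Let_def C.contract_def fun_eq_iff)
    then show ?thesis
      using contract_neq_M[OF _ dim] by (auto simp: rs_preimage_def Proj C.topspace_Proj)
  qed

  \<comment> \<open>The open set of the criterion is all of Proj here, so the open subspace on the
    left is Proj itself.\<close>
  have iso: "lrs_isomorphic (Proj S G) (open_subspace (Spec R) (topspace (rs_top (Spec R)) - {M}))"
    using sheaf_iso_imp_lrs_isomorphic[OF X Spec_sheaf[OF Pi.W_open]] Pi.contraction_sheaf_iso
    unfolding pts open_subspace_topspace by blast

  have affine: "\<exists>U. openin (rs_top (Proj S G)) U \<and> P \<in> U \<and>
      (\<exists>A :: ((nat \<Rightarrow> 'a) set \<Rightarrow> ((nat \<Rightarrow> 'a) \<times> (nat \<Rightarrow> 'a)) set) ring.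
        cring A \<and> noetherian_ring A \<and> lrs_isomorphic (open_subspace (Proj S G) U) (Spec A))"
    if P: "P \<in> topspace (rs_top (Proj S G))" for P
  proof -
    have P': "P \<in> proj_points S G"
      using P by (simp add: pts)
    \<comment> \<open>Such an f exists because the contraction of P is a prime other than M. Being
      in M, f vanishes at M, so the basic open set of f lies in the punctured spectrum and is fully
      covered by points of Proj.\<close>
    obtain f where f: "f \<in> M" "f \<notin> C.contract P"
      using prime_eq_M[OF C.prime_contract[OF C.proj_points_prime[OF P']]] contract_neq_M[OF P' dim]
      by blast
    have fc: "f \<in> carrier R"
      using f(1) ideal.Icarr[OF primeideal.axioms(1)[OF M_prime]] by blast
    define U where "U = {P \<in> proj_points S G. rees_unit R f \<notin> P}"
    define F where "F = {f [^]\<^bsub>R\<^esub> (n::nat) | n. True}"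
    define W where "W = {Q. primeideal Q R \<and> Q \<inter> F = {}}"
    define A where "A = image_ring to_section (localization R F)"
    have W_eq: "W = {Q. primeideal Q R \<and> f \<notin> Q}"
      unfolding W_def F_def using prime_inter_powers[OF R _ fc] by blast
    have W_open: "openin (rs_top (Spec R)) W"
      unfolding W_eq by (rule openin_Spec_basic[OF R fc])
    have U_open: "openin (rs_top (Proj S G)) U"
      unfolding U_def using fc by (intro C.openin_Proj_basic) simp
    have PU: "P \<in> U"
      using P' f(2) fc by (simp add: U_def C.contract_def)
    have image: "C.contract ` U = W"
    proof
      show "C.contract ` U \<subseteq> W"
        unfolding W_eq using C.prime_contract[OF C.proj_points_prime]
        by (auto simp: U_def C.contract_def)
      show "W \<subseteq> C.contract ` U"
      proof
        fix Q assume "Q \<in> W"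
        then have Q: "primeideal Q R" "f \<notin> Q" "Q \<noteq> M"
          using f(1) unfolding W_eq by auto
        note e = coeffs_in_proj_point[OF Q(1,3)]
        have "coeffs_in Q \<in> U"
          unfolding U_def using e Q(2) fc C.mem_contract[OF fc] by auto
        then show "Q \<in> C.contract ` U"
          using e(2) by (metis imageI)
      qed
    qed
    interpret Loc: mult_system R F
      unfolding F_def by (rule mult_system_powers[OF fc])
    interpret A: localization_at R F A "\<lambda>a. to_section (fraction R F a \<one>\<^bsub>R\<^esub>)"
      unfolding A_def using inj_to_section by (intro Loc.localization_at_image) (rule inj_on_subset, auto)
    interpret Pi_U: contraction_iso S G R "rees_unit R" U W
      using Pi.contraction_iso_restrict[OF U_open] unfolding image by (auto simp: U_def)
    interpret A_iso: contraction_iso A "\<lambda>_. carrier A" R "\<lambda>a. to_section (fraction R F a \<one>\<^bsub>R\<^esub>)"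
        "topspace (rs_top (Spec A))" W
      using A.contraction_iso_Spec W_open unfolding W_def by blast
    have SpecA: "sheaf_iso (Spec A) (homogeneous_localization A (\<lambda>_. carrier A))
        (graded_cring.is_fraction A (\<lambda>_. carrier A)) (open_subspace (Spec R) W) C.R.L C.R.is_fraction"
      using A_iso.contraction_sheaf_iso
      unfolding Spec_eq_Proj(1)[OF A.A.cring_axioms, symmetric] open_subspace_topspace .
    \<comment> \<open>The part of Proj where f does not vanish and the spectrum of the copied ring
      R_f contract isomorphically onto the same open set W, so one contraction is followed by the
      inverse of the other.\<close>
    have "sheaf_iso (open_subspace (Proj S G) U) C.L C.is_fraction
        (Spec A) (homogeneous_localization A (\<lambda>_. carrier A)) (graded_cring.is_fraction A (\<lambda>_. carrier A))"
      by (rule sheaf_iso_trans[OF function_sheaf.function_sheaf_open_subspace[OF X U_open]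
          Spec_sheaf[OF W_open] function_sheaf_Spec[OF A.A.cring_axioms]
          Pi_U.contraction_sheaf_iso sheaf_iso_sym[OF SpecA]])
    then have "lrs_isomorphic (open_subspace (Proj S G) U) (Spec A)"
      by (rule sheaf_iso_imp_lrs_isomorphic[OF function_sheaf.function_sheaf_open_subspace[OF X U_open]
          function_sheaf_Spec[OF A.A.cring_axioms]])
    moreover have "noetherian_ring A"
      by (rule A.noetherian_localization[OF assms(2)])
    ultimately show ?thesis
      using U_open PU A.A.cring_axioms by blast
  qed

  have "scheme (Proj S G)"
    unfolding scheme_def using function_sheaf.locally_ringed_space[OF X] affine by blast
  then have "locally_noetherian_scheme (Proj S G)"
    unfolding locally_noetherian_scheme_def using affine by blast
  \<comment> \<open>Quasi-compactness is obtained for Proj as a whole, without selecting finitely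
    many charts, since contraction embeds Proj as an open part of the Noetherian space Spec
    R.\<close>
  moreover have "compact_space (rs_top (Proj S G))"
    using Pi.compactin_noetherian[OF assms(2)] unfolding compact_space_def pts .
  ultimately have "noetherian_scheme (Proj S G)"
    by (simp add: noetherian_scheme_def)
  then show ?thesis
    using fibre iso by (simp add: Proj M_def)
qed

end
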